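(* For each $n\in\mathbb{N}$, let $\mathcal{G}_n$ be a groupoid with a length function $\ell_n$ and let $(\mathcal{G}_n^{(0)},\mathcal{R}_n,\mu_n)$ be a measure space. Form the groupoid $\mathcal{G}=\bigsqcup_{n\in\mathbb{N}}\mathcal{G}_n$ with the length function $\ell$ on $\mathcal{G}$ restricting to $\ell_n$ on each $\mathcal{G}_n$, and the measure $\mu$ on $\mathcal{G}^{(0)}=\bigsqcup_n\mathcal{G}_n^{(0)}$ (with the $\sigma$-algebra $\mathcal{R}$ generated by $\bigsqcup_n\mathcal{R}_n$) determined by $\mu|_{\mathcal{G}_n^{(0)}}=\mu_n$. Let $P_n\in\mathfrak{B}(L^2(\mathcal{G}_n^{(0)},\mu_n))$ be a rank-one orthogonal projection for each $n\in\mathbb{N}$, and let $P:=(\mathrm{SOT})\text{-}\sum_{n\in\mathbb{N}}P_n\in\mathfrak{B}(L^2(\mathcal{G}^{(0)},\mu))$ be their direct sum. Then the following are equivalent: (1) $P\in\mathbf{C}^*_{\mathrm{dyn}}(\mathcal{G})$; (2) $P\in\mathbf{C}^*_{\mathrm{dyn},\mathrm{q}}(\mathcal{G})$; (3) the groupoids $\mathcal{G}_n$ are asymptotically expanding in the associated measures $\nu_n$ to $P_n$, uniformly in $n$ in the sense that they have the same expansion parameters.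
   Context: Groupoids. A groupoid $\mathcal{G}$ (no topology assumed) has unit space $\mathcal{G}^{(0)}\subseteq\mathcal{G}$ and source and range maps $\mathrm{s},\mathrm{r}:\mathcal{G}\to\mathcal{G}^{(0)}$; $\gamma_1\gamma_2$ is defined when $\mathrm{s}(\gamma_1)=\mathrm{r}(\gamma_2)$. For $K\subseteq\mathcal{G}$ put $K^{-1}=\{\gamma^{-1}:\gamma\in K\}$; for $A\subseteq\mathcal{G}^{(0)}$, $\mathrm{r}(K\cdot A)=\{\mathrm{r}(\gamma):\gamma\in K,\mathrm{s}(\gamma)\in A\}$. $K$ is symmetric if $K=K^{-1}$, unital if $\mathcal{G}^{(0)}\subseteq K$, and a bisection if $\mathrm{s}|_K,\mathrm{r}|_K$ are injective; then $\tau_K:=\mathrm{r}|_K\circ(\mathrm{s}|_K)^{-1}:\mathrm{s}(K)\to\mathrm{r}(K)$. A length function is a map $\ell:\mathcal{G}\to[0,\infty)$ with $\ell=0$ on $\mathcal{G}^{(0)}$, $\ell(\gamma^{-1})=\ell(\gamma)$, and $\ell(\gamma_1\gamma_2)\le\ell(\gamma_1)+\ell(\gamma_2)$ for composable pairs; $\ell(K):=\sup_{\gamma\in K}\ell(\gamma)$. With respect to a given measure $\mu$ on $(\mathcal{G}^{(0)},\mathcal{R})$: a bisection $K$ is admissible if $\mathrm{s}(K),\mathrm{r}(K)\in\mathcal{R}$, $\tau_K$ is a measurable isomorphism preserving the measure class of $\mu$ (it and its inverse send null sets to null sets), and $\ell(K)<\infty$. A subset is decomposable if it is a finite union of admissible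 bisections. A unital symmetric decomposable $K$ is $N$-decomposable if $K=\bigcup_{i=1}^N K_i$ with admissible bisections $K_i$ such that some $K_i=\mathcal{G}^{(0)}$ and there is a bijection $\sigma$ of $\{1,\dots,N\}$ with $K_i^{-1}=K_{\sigma(i)}$. Operators. $T\in\mathfrak{B}(L^2(\mathcal{G}^{(0)},\mu))$ has finite dynamical propagation if there is a unital symmetric $N$-decomposable $K\subseteq\mathcal{G}$ with $\ell(K)\le L$ for some $N,L>0$ such that $\chi_AT\chi_B=0$ for all $A,B\in\mathcal{R}$ with $\mu(\mathrm{r}(K\cdot A)\cap B)=0$. The dynamical Roe algebra $\mathbf{C}^*_{\mathrm{dyn}}(\mathcal{G})$ is the operator-norm closure of the set of such operators. $T$ is dynamically quasi-local if for every $\epsilon>0$ there is a unital symmetric $N_\epsilon$-decomposable $K_\epsilon$ with $\ell(K_\epsilon)\le L_\epsilon$ for some $N_\epsilon,L_\epsilon>0$ such that $\|\chi_AT\chi_B\|<\epsilon$ for all $A,B\in\mathcal{R}$ with $\mu(\mathrm{r}(K_\epsilon\cdot A)\cap B)=0$; $\mathbf{C}^*_{\mathrm{dyn},\mathrm{q}}(\mathcal{G})$ is the set of dynamically quasi-local operators. Here $L^2(\mathcal{G}^{(0)},\mu)=\bigoplus_n L^2(\mathcal{G}_n^{(0)},\mu_n)$, each $P_n$ is extended by zero, and the sum converges in the strong operator topology (SOT). Associated measure. If $\xi_n\in L^2(\mathcal{G}_n^{(0)},\mu_n)$ is a unit vector in the range of $P_n$, the associated probability measure is $d\nu_n(x)=|\xi_n(x)|^2\,d\mu_n(x)$.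 Asymptotic expansion. For a groupoid $\mathcal{G}$ with length function $\ell$ and a probability measure $\nu$ on $(\mathcal{G}^{(0)},\mathcal{R})$, $\mathcal{G}$ is asymptotically expanding in measure $\nu$ with expansion parameters $\alpha\mapsto C_\alpha$, $\alpha\mapsto N_\alpha$, $\alpha\mapsto L_\alpha$ (positive functions on $(0,\frac12]$) if for every $\alpha\in(0,\frac12]$ there is a unital symmetric $K_\alpha\subseteq\mathcal{G}$, $N_\alpha$-decomposable with respect to $\nu$, with $\ell(K_\alpha)\le L_\alpha$, such that $\nu(\mathrm{r}(K_\alpha\cdot A)\setminus A)>C_\alpha\nu(A)$ for all $A\in\mathcal{R}$ with $\alpha\le\nu(A)\le\frac12$. Condition (3) says that there exist functions $C_\alpha,N_\alpha,L_\alpha$ that serve as expansion parameters for all $(\mathcal{G}_n,\ell_n,\nu_n)$ simultaneously. *)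

theory Defs
  imports "HOL-Analysis.Analysis"
begin

section \<open>Groupoids and length functions\<close>

record 'g groupoid_ops =
  arrows :: "'g set"
  unit_space :: "'g set"
  src :: "'g \<Rightarrow> 'g"
  rng :: "'g \<Rightarrow> 'g"
  gmult :: "'g \<Rightarrow> 'g \<Rightarrow> 'g"
  ginv :: "'g \<Rightarrow> 'g"

text \<open>The product \<open>gmult G a b\<close> is meaningful only for \<open>src G a = rng G b\<close>.\<close>

locale groupoid =
  fixes G :: "'g groupoid_ops"
  assumes units_subset: "unit_space G \<subseteq> arrows G"
    and src_unit: "a \<in> arrows G \<Longrightarrow> src G a \<in> unit_space G"
    and rng_unit: "a \<in> arrows G \<Longrightarrow> rng G a \<in> unit_space G"
    and src_of_unit: "u \<in> unit_space G \<Longrightarrow> src G u = u"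
    and rng_of_unit: "u \<in> unit_space G \<Longrightarrow> rng G u = u"
    and mult_closed: "\<lbrakk>a \<in> arrows G; b \<in> arrows G; src G a = rng G b\<rbrakk> \<Longrightarrow> gmult G a b \<in> arrows G"
    and src_mult: "\<lbrakk>a \<in> arrows G; b \<in> arrows G; src G a = rng G b\<rbrakk> \<Longrightarrow> src G (gmult G a b) = src G b"
    and rng_mult: "\<lbrakk>a \<in> arrows G; b \<in> arrows G; src G a = rng G b\<rbrakk> \<Longrightarrow> rng G (gmult G a b) = rng G a"
    and mult_assoc: "\<lbrakk>a \<in> arrows G; b \<in> arrows G; c \<in> arrows G; src G a = rng G b; src G b = rng G c\<rbrakk>
        \<Longrightarrow> gmult G (gmult G a b) c = gmult G a (gmult G b c)"
    and rng_mult_left: "a \<in> arrows G \<Longrightarrow> gmult G (rng G a) a = a"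
    and mult_src_right: "a \<in> arrows G \<Longrightarrow> gmult G a (src G a) = a"
    and inv_closed: "a \<in> arrows G \<Longrightarrow> ginv G a \<in> arrows G"
    and src_inv: "a \<in> arrows G \<Longrightarrow> src G (ginv G a) = rng G a"
    and rng_inv: "a \<in> arrows G \<Longrightarrow> rng G (ginv G a) = src G a"
    and inv_mult: "a \<in> arrows G \<Longrightarrow> gmult G (ginv G a) a = src G a"
    and mult_inv: "a \<in> arrows G \<Longrightarrow> gmult G a (ginv G a) = rng G a"

definition length_function :: "'g groupoid_ops \<Rightarrow> ('g \<Rightarrow> real) \<Rightarrow> bool" where
  "length_function G len \<longleftrightarrow>
     (\<forall>a\<in>arrows G. 0 \<le> len a) \<and>
     (\<forall>u\<in>unit_space G. len u = 0) \<and>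
     (\<forall>a\<in>arrows G. len (ginv G a) = len a) \<and>
     (\<forall>a\<in>arrows G. \<forall>b\<in>arrows G. src G a = rng G b \<longrightarrow> len (gmult G a b) \<le> len a + len b)"

definition set_length :: "('g \<Rightarrow> real) \<Rightarrow> 'g set \<Rightarrow> ennreal" where
  "set_length len K = (SUP a\<in>K. ennreal (len a))"

definition range_act :: "'g groupoid_ops \<Rightarrow> 'g set \<Rightarrow> 'g set \<Rightarrow> 'g set" where
  "range_act G K A = {rng G a | a. a \<in> K \<and> src G a \<in> A}"

definition symmetric_set :: "'g groupoid_ops \<Rightarrow> 'g set \<Rightarrow> bool" where
  "symmetric_set G K \<longleftrightarrow> K = ginv G ` K"

definition unital_set :: "'g groupoid_ops \<Rightarrow> 'g set \<Rightarrow> bool" where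
  "unital_set G K \<longleftrightarrow> unit_space G \<subseteq> K"

definition bisection :: "'g groupoid_ops \<Rightarrow> 'g set \<Rightarrow> bool" where
  "bisection G K \<longleftrightarrow> K \<subseteq> arrows G \<and> inj_on (src G) K \<and> inj_on (rng G) K"

definition bisection_map :: "'g groupoid_ops \<Rightarrow> 'g set \<Rightarrow> 'g \<Rightarrow> 'g" where
  "bisection_map G K = rng G \<circ> the_inv_into K (src G)"

section \<open>Decomposable sets\<close>

text \<open>Throughout, a measure on the unit space is a measure \<open>M\<close> with \<open>space M = unit_space G\<close>.\<close>

definition admissible :: "'g groupoid_ops \<Rightarrow> ('g \<Rightarrow> real) \<Rightarrow> 'g measure \<Rightarrow> 'g set \<Rightarrow> bool" where
  "admissible G len M K \<longleftrightarrow>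
     bisection G K \<and>
     src G ` K \<in> sets M \<and> rng G ` K \<in> sets M \<and>
     (let t = bisection_map G K; t' = the_inv_into (src G ` K) t in
        t \<in> measurable (restrict_space M (src G ` K)) (restrict_space M (rng G ` K)) \<and>
        t' \<in> measurable (restrict_space M (rng G ` K)) (restrict_space M (src G ` K)) \<and>
        (\<forall>A\<in>null_sets M. A \<subseteq> src G ` K \<longrightarrow> t ` A \<in> null_sets M) \<and>
        (\<forall>A\<in>null_sets M. A \<subseteq> rng G ` K \<longrightarrow> t' ` A \<in> null_sets M)) \<and>
     set_length len K < \<infinity>"

definition decomposable :: "'g groupoid_ops \<Rightarrow> ('g \<Rightarrow> real) \<Rightarrow> 'g measure \<Rightarrow> 'g set \<Rightarrow> bool" where
  "decomposable G len M K \<longleftrightarrow>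
     (\<exists>\<F>. finite \<F> \<and> (\<forall>B\<in>\<F>. admissible G len M B) \<and> K = \<Union>\<F>)"

definition N_decomposable ::
    "'g groupoid_ops \<Rightarrow> ('g \<Rightarrow> real) \<Rightarrow> 'g measure \<Rightarrow> nat \<Rightarrow> 'g set \<Rightarrow> bool" where
  "N_decomposable G len M N K \<longleftrightarrow>
     unital_set G K \<and> symmetric_set G K \<and> decomposable G len M K \<and>
     (\<exists>Ks \<sigma>. (\<forall>i\<in>{1..N}. admissible G len M (Ks i)) \<and>
        K = (\<Union>i\<in>{1..N}. Ks i) \<and>
        (\<exists>i\<in>{1..N}. Ks i = unit_space G) \<and>
        bij_betw \<sigma> {1..N} {1..N} \<and>
        (\<forall>i\<in>{1..N}. ginv G ` Ks i = Ks (\<sigma> i)))"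

section \<open>Bounded operators on \<open>L\<^sup>2\<close>\<close>

text \<open>
  Elements of \<open>L\<^sup>2(M)\<close> are represented by square-integrable complex functions, and equality in
  \<open>L\<^sup>2(M)\<close> is equality almost everywhere.  An operator is a map on representatives that is linear
  up to null sets and bounded for the seminorm; such a map automatically respects equality almost
  everywhere, since \<open>f = g + (f - g)\<close> and \<open>T (f - g)\<close> has seminorm zero if \<open>f = g\<close> almost everywhere.
  Its values outside \<open>L2 M\<close> are irrelevant.
\<close>

type_synonym 'a operator = "('a \<Rightarrow> complex) \<Rightarrow> ('a \<Rightarrow> complex)"

definition L2 :: "'a measure \<Rightarrow> ('a \<Rightarrow> complex) set" where
  "L2 M = {f \<in> borel_measurable M. integrable M (\<lambda>x. (cmod (f x))\<^sup>2)}"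

definition L2_norm :: "'a measure \<Rightarrow> ('a \<Rightarrow> complex) \<Rightarrow> real" where
  "L2_norm M f = sqrt (\<integral>x. (cmod (f x))\<^sup>2 \<partial>M)"

definition L2_inner :: "'a measure \<Rightarrow> ('a \<Rightarrow> complex) \<Rightarrow> ('a \<Rightarrow> complex) \<Rightarrow> complex" where
  "L2_inner M f g = (\<integral>x. f x * cnj (g x) \<partial>M)"

definition bounded_ops :: "'a measure \<Rightarrow> 'a operator set" where
  "bounded_ops M = {T.
     (\<forall>f\<in>L2 M. T f \<in> L2 M) \<and>
     (\<forall>f\<in>L2 M. \<forall>g\<in>L2 M. AE x in M. T (\<lambda>y. f y + g y) x = T f x + T g x) \<and>
     (\<forall>f\<in>L2 M. \<forall>c. AE x in M. T (\<lambda>y. c * f y) x = c * T f x) \<and>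
     (\<exists>B. \<forall>f\<in>L2 M. L2_norm M (T f) \<le> B * L2_norm M f)}"

definition op_norm :: "'a measure \<Rightarrow> 'a operator \<Rightarrow> real" where
  "op_norm M T = (SUP f\<in>{f \<in> L2 M. L2_norm M f \<le> 1}. L2_norm M (T f))"

definition op_diff :: "'a operator \<Rightarrow> 'a operator \<Rightarrow> 'a operator" where
  "op_diff T S = (\<lambda>f x. T f x - S f x)"

definition op_is_zero :: "'a measure \<Rightarrow> 'a operator \<Rightarrow> bool" where
  "op_is_zero M T \<longleftrightarrow> (\<forall>f\<in>L2 M. AE x in M. T f x = 0)"

definition cutoff :: "'a set \<Rightarrow> 'a operator" where
  "cutoff A = (\<lambda>f x. indicator A x * f x)"

definition orthogonal_projection :: "'a measure \<Rightarrow> 'a operator \<Rightarrow> bool" where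
  "orthogonal_projection M T \<longleftrightarrow>
     T \<in> bounded_ops M \<and>
     (\<forall>f\<in>L2 M. AE x in M. T (T f) x = T f x) \<and>
     (\<forall>f\<in>L2 M. \<forall>g\<in>L2 M. L2_inner M (T f) g = L2_inner M f (T g))"

definition op_range :: "'a measure \<Rightarrow> 'a operator \<Rightarrow> ('a \<Rightarrow> complex) set" where
  "op_range M T = {g \<in> L2 M. \<exists>f\<in>L2 M. AE x in M. g x = T f x}"

definition rank_one :: "'a measure \<Rightarrow> 'a operator \<Rightarrow> bool" where
  "rank_one M T \<longleftrightarrow>
     (\<exists>g\<in>op_range M T. \<not> (AE x in M. g x = 0) \<and>
        (\<forall>h\<in>op_range M T. \<exists>c. AE x in M. h x = c * g x))"

definition SOT_sums :: "'a measure \<Rightarrow> (nat \<Rightarrow> 'a operator) \<Rightarrow> 'a operator \<Rightarrow> bool" where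
  "SOT_sums M Q T \<longleftrightarrow> T \<in> bounded_ops M \<and>
     (\<forall>f\<in>L2 M. (\<lambda>k. L2_norm M (\<lambda>x. (\<Sum>n<k. Q n f x) - T f x)) \<longlonglongrightarrow> 0)"

section \<open>Finite dynamical propagation and dynamical quasi-locality\<close>

definition finite_dyn_propagation ::
    "'g groupoid_ops \<Rightarrow> ('g \<Rightarrow> real) \<Rightarrow> 'g measure \<Rightarrow> 'g operator \<Rightarrow> bool" where
  "finite_dyn_propagation G len M T \<longleftrightarrow>
     T \<in> bounded_ops M \<and>
     (\<exists>K N L. 0 < N \<and> 0 < L \<and> N_decomposable G len M N K \<and> set_length len K \<le> ennreal L \<and>
        (\<forall>A\<in>sets M. \<forall>B\<in>sets M. emeasure M (range_act G K A \<inter> B) = 0 \<longrightarrow>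
           op_is_zero M (cutoff A \<circ> T \<circ> cutoff B)))"

definition dyn_Roe_algebra ::
    "'g groupoid_ops \<Rightarrow> ('g \<Rightarrow> real) \<Rightarrow> 'g measure \<Rightarrow> 'g operator set" where
  "dyn_Roe_algebra G len M = {T \<in> bounded_ops M.
     \<forall>\<epsilon>>0. \<exists>S. finite_dyn_propagation G len M S \<and> op_norm M (op_diff T S) < \<epsilon>}"

definition dyn_quasi_local_algebra ::
    "'g groupoid_ops \<Rightarrow> ('g \<Rightarrow> real) \<Rightarrow> 'g measure \<Rightarrow> 'g operator set" where
  "dyn_quasi_local_algebra G len M = {T \<in> bounded_ops M.
     \<forall>\<epsilon>>0. \<exists>K N L. 0 < N \<and> 0 < L \<and> N_decomposable G len M N K \<and> set_length len K \<le> ennreal L \<and>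
        (\<forall>A\<in>sets M. \<forall>B\<in>sets M. emeasure M (range_act G K A \<inter> B) = 0 \<longrightarrow>
           op_norm M (cutoff A \<circ> T \<circ> cutoff B) < \<epsilon>)}"

section \<open>Asymptotic expansion in measure\<close>

definition associated_measure :: "'a measure \<Rightarrow> ('a \<Rightarrow> complex) \<Rightarrow> 'a measure" where
  "associated_measure M \<xi> = density M (\<lambda>x. ennreal ((cmod (\<xi> x))\<^sup>2))"

text \<open>The parameters are functions on \<open>(0, 1/2]\<close>; their values elsewhere are unconstrained.\<close>

definition asymptotically_expanding ::
    "'g groupoid_ops \<Rightarrow> ('g \<Rightarrow> real) \<Rightarrow> 'g measure \<Rightarrow>
     (real \<Rightarrow> real) \<Rightarrow> (real \<Rightarrow> nat) \<Rightarrow> (real \<Rightarrow> real) \<Rightarrow> bool" where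
  "asymptotically_expanding G len \<nu> C N L \<longleftrightarrow>
     (\<forall>\<alpha>\<in>{0<..1/2}. 0 < C \<alpha> \<and> 0 < N \<alpha> \<and> 0 < L \<alpha> \<and>
        (\<exists>K. N_decomposable G len \<nu> (N \<alpha>) K \<and> set_length len K \<le> ennreal (L \<alpha>) \<and>
           (\<forall>A\<in>sets \<nu>. \<alpha> \<le> measure \<nu> A \<and> measure \<nu> A \<le> 1/2 \<longrightarrow>
              measure \<nu> (range_act G K A - A) > C \<alpha> * measure \<nu> A)))"

section \<open>Disjoint unions\<close>

definition disj_groupoid :: "(nat \<Rightarrow> 'g groupoid_ops) \<Rightarrow> (nat \<times> 'g) groupoid_ops" where
  "disj_groupoid G =
     \<lparr>arrows = (SIGMA n:UNIV. arrows (G n)),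
      unit_space = (SIGMA n:UNIV. unit_space (G n)),
      src = (\<lambda>(n, a). (n, src (G n) a)),
      rng = (\<lambda>(n, a). (n, rng (G n) a)),
      gmult = (\<lambda>(n, a) (m, b). (n, gmult (G n) a b)),
      ginv = (\<lambda>(n, a). (n, ginv (G n) a))\<rparr>"

definition disj_length :: "(nat \<Rightarrow> 'g \<Rightarrow> real) \<Rightarrow> nat \<times> 'g \<Rightarrow> real" where
  "disj_length len = (\<lambda>(n, a). len n a)"

definition disj_measure :: "(nat \<Rightarrow> 'g measure) \<Rightarrow> (nat \<times> 'g) measure" where
  "disj_measure M =
     measure_of (SIGMA n:UNIV. space (M n)) (\<Union>n. (\<lambda>A. Pair n ` A) ` sets (M n))
       (\<lambda>A. \<Sum>n. emeasure (M n) (Pair n -` A))"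

definition extend_by_zero :: "nat \<Rightarrow> 'g operator \<Rightarrow> (nat \<times> 'g) operator" where
  "extend_by_zero n T = (\<lambda>f (m, x). if m = n then T (\<lambda>y. f (n, y)) x else 0)"

lemma groupoid_disj_groupoid:
  assumes "\<And>n. groupoid (G n)"
  shows "groupoid (disj_groupoid G)"
  using assms unfolding groupoid_def disj_groupoid_def by (auto simp: subset_iff)

lemma length_function_disj_length:
  assumes "\<And>n. length_function (G n) (len n)"
  shows "length_function (disj_groupoid G) (disj_length len)"
  using assms unfolding length_function_def disj_groupoid_def disj_length_def by auto

lemma space_disj_measure: "space (disj_measure M) = (SIGMA n:UNIV. space (M n))"
  unfolding disj_measure_def
  by (rule space_measure_of) (use sets.sets_into_space in fastforce)

lemma sets_disj_measure:
  "sets (disj_measure M) =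
     sigma_sets (SIGMA n:UNIV. space (M n)) (\<Union>n. (\<lambda>A. Pair n ` A) ` sets (M n))"
  unfolding disj_measure_def
  by (rule sets_measure_of) (use sets.sets_into_space in fastforce)

lemma measurable_Pair_disj_measure: "Pair n \<in> measurable (M n) (disj_measure M)"
proof (rule measurable_sigma_sets[OF sets_disj_measure])
  show "(\<Union>n. (\<lambda>A. Pair n ` A) ` sets (M n)) \<subseteq> Pow (SIGMA n:UNIV. space (M n))"
    using sets.sets_into_space by fastforce
  show "Pair n \<in> space (M n) \<rightarrow> (SIGMA n:UNIV. space (M n))"
    by auto
  fix y assume "y \<in> (\<Union>n. (\<lambda>A. Pair n ` A) ` sets (M n))"
  then obtain m A where y: "A \<in> sets (M m)" "y = Pair m ` A" by auto
  show "Pair n -` y \<inter> space (M n) \<in> sets (M n)"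
  proof (cases "m = n")
    case True
    then have "Pair n -` y = A" using y by auto
    then show ?thesis using y True by auto
  next
    case False
    then have "Pair n -` y = {}" using y by auto
    then show ?thesis by simp
  qed
qed

lemma sets_vimage_Pair_disj_measure:
  assumes "A \<in> sets (disj_measure M)"
  shows "Pair n -` A \<in> sets (M n)"
proof -
  have "A \<subseteq> (SIGMA n:UNIV. space (M n))"
    using sets.sets_into_space[OF assms] by (simp add: space_disj_measure)
  then have "Pair n -` A \<inter> space (M n) = Pair n -` A" by auto
  then show ?thesis
    using measurable_sets[OF measurable_Pair_disj_measure assms, of n] by simp
qed

lemma emeasure_disj_measure:
  assumes "A \<in> sets (disj_measure M)"
  shows "emeasure (disj_measure M) A = (\<Sum>n. emeasure (M n) (Pair n -` A))"
proof (rule emeasure_measure_of[OF disj_measure_def _ _ _ assms])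
  show "(\<Union>n. (\<lambda>A. Pair n ` A) ` sets (M n)) \<subseteq> Pow (SIGMA n:UNIV. space (M n))"
    using sets.sets_into_space by fastforce
  show "positive (sets (disj_measure M)) (\<lambda>A. \<Sum>n. emeasure (M n) (Pair n -` A))"
    by (simp add: positive_def)
  show "countably_additive (sets (disj_measure M)) (\<lambda>A. \<Sum>n. emeasure (M n) (Pair n -` A))"
  proof (rule countably_additiveI)
    fix F :: "nat \<Rightarrow> (nat \<times> 'a) set"
    assume F: "range F \<subseteq> sets (disj_measure M)" "disjoint_family F"
    have sm: "(\<Sum>i. emeasure (M n) (Pair n -` F i)) = emeasure (M n) (Pair n -` (\<Union>i. F i))" for n
    proof -
      have "range (\<lambda>i. Pair n -` F i) \<subseteq> sets (M n)"
        using F sets_vimage_Pair_disj_measure by blast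
      moreover have "disjoint_family (\<lambda>i. Pair n -` F i)"
        using F(2) unfolding disjoint_family_on_def by auto
      ultimately show ?thesis by (simp add: suminf_emeasure vimage_Union vimage_UN)
    qed
    have "(\<Sum>i n. emeasure (M n) (Pair n -` F i)) = (\<Sum>n i. emeasure (M n) (Pair n -` F i))"
      using nn_integral_suminf[of "\<lambda>n i. emeasure (M n) (Pair n -` F i)" "count_space UNIV"]
      by (simp add: nn_integral_count_space_nat)
    then show "(\<Sum>i n. emeasure (M n) (Pair n -` F i)) = (\<Sum>n. emeasure (M n) (Pair n -` (\<Union>i. F i)))"
      by (simp add: sm)
  qed
qed

lemma emeasure_disj_measure_component:
  assumes "A \<in> sets (M n)"
  shows "emeasure (disj_measure M) (Pair n ` A) = emeasure (M n) A"
proof -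
  have "Pair n ` A \<in> sets (disj_measure M)"
    unfolding sets_disj_measure using assms by (intro sigma_sets.Basic) auto
  then have "emeasure (disj_measure M) (Pair n ` A) =
      (\<Sum>m. emeasure (M m) (Pair m -` Pair n ` A))"
    by (rule emeasure_disj_measure)
  also have "\<dots> = (\<Sum>m\<in>{n}. emeasure (M m) (Pair m -` Pair n ` A))"
  proof (rule suminf_finite)
    fix m assume "m \<notin> {n}"
    then have "Pair m -` Pair n ` A = {}" by auto
    then show "emeasure (M m) (Pair m -` Pair n ` A) = 0" by simp
  qed simp
  also have "\<dots> = emeasure (M n) A"
  proof -
    have "Pair n -` Pair n ` A = A" by auto
    then show ?thesis by simp
  qed
  finally show ?thesis .
qed

end

theory Submission
  imports Defs
begin

text \<open>
  On the fibre \<open>n\<close> the projection is \<open>f \<mapsto> \<langle>f, \<xi>\<^sub>n\<rangle>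
  \<xi>\<^sub>n\<close>. Dividing by \<open>\<xi>\<^sub>n\<close> identifies it with the averaging
  projection \<open>g \<mapsto> \<integral> g d\<nu>\<^sub>n\<close> on
  \<open>L\<^sup>2(\<nu>\<^sub>n)\<close>, so the three conditions compare averages over
  \<open>\<nu>\<^sub>n\<close> with the dynamics of bisections.

  An operator at distance less than \<open>\<epsilon>\<close> from one of finite propagation is
  \<open>\<epsilon>\<close>-quasi-local, because cutting off is contractive
  (\<open>dyn_Roe_subset_quasi_local\<close>).

  If the direct sum is quasi-local with \<open>K\<close> at precision \<open>\<epsilon>\<close>, let
  \<open>B\<close> be the complement of \<open>r(K \<cdot> A)\<close> in one fibre. The corner of the
  projection between \<open>A\<close> and \<open>B\<close> has norm \<open>sqrt (\<nu>(A)
  \<nu>(B))\<close>, which must be below \<open>\<epsilon>\<close>; so \<open>\<nu>(B)\<close> is small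
  as soon as \<open>\<nu>(A) \<ge> \<alpha>\<close>, and \<open>r(K \<cdot> A)\<close> exhausts most of
  the fibre (\<open>quasi_local_imp_expanding\<close>).

  For the remaining implication (\<open>expanding_imp_Roe\<close>) the average has to be approximated by
  an operator that moves points only along finitely many bisections. Such an operator is a power of a
  lazy random walk, and it is close to the average if the walk has a spectral gap. A bisection distorts
  \<open>\<nu>\<close> by a Radon--Nikodym derivative \<open>\<rho>\<close>, and weighting its arrows by
  \<open>min 1 \<rho>\<close> makes the walk that uses all bisections and their inverses reversible with
  bounded weights (\<open>reversible_walk_of_partial_automorphisms\<close>). Where \<open>\<rho> >
  m\<close> the measure is at most \<open>1/m\<close>, so, after discarding a set of small measure,
  growth of \<open>r(K \<cdot> A)\<close> turns into flow out of \<open>A\<close>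
  (\<open>edge_expansion_of_vertex_expansion\<close>). This holds only for sets of measure at least
  \<open>\<alpha>\<close>; a maximal set with little outgoing flow has measure below
  \<open>\<alpha>\<close>, and outside it sets of every size expand
  (\<open>expansion_after_removing_small_set\<close>). There Cheeger's inequality
  (\<open>Cheeger_nonneg\<close>, \<open>Poincare_inequality_median\<close>) gives the spectral gap and
  powers of the walk converge to the average in norm (\<open>walk_contraction\<close>). The removed set
  changes the projection by \<open>O(sqrt \<alpha>)\<close> (\<open>cutoff_rank_one_estimate\<close>).
  All constants depend on the expansion parameters only, so the walks on the fibres fit together to one
  operator of finite propagation on the disjoint union.

  Two points of bookkeeping: the classes of \<open>\<mu>\<^sub>n\<close> and
  \<open>\<nu>\<^sub>n\<close> agree only on \<open>{\<xi>\<^sub>n \<noteq> 0}\<close>, so bisections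
  are restricted to arrows with both ends there (\<open>admissible_on_support\<close>); and the
  permutation that matches bisections with their inverses may vary with \<open>n\<close>, so each
  bisection is listed together with its inverse (\<open>N_decomposable_hull\<close>).
\<close>

section \<open>Square-integrable functions and bounded operators\<close>

lemma L2_iff_nn_integral:
  "f \<in> L2 M \<longleftrightarrow> f \<in> borel_measurable M \<and> (\<integral>\<^sup>+x. ennreal ((cmod (f x))\<^sup>2) \<partial>M) < \<infinity>"
  unfolding L2_def by (auto simp: integrable_iff_bounded)

lemma L2_measurable: "f \<in> L2 M \<Longrightarrow> f \<in> borel_measurable M"
  by (simp add: L2_def)

lemma L2_integrable: "f \<in> L2 M \<Longrightarrow> integrable M (\<lambda>x. (cmod (f x))\<^sup>2)"
  by (simp add: L2_def)

lemma L2_norm_nonneg: "0 \<le> L2_norm M f"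
  by (simp add: L2_norm_def)

lemma L2_norm_square: "(L2_norm M f)\<^sup>2 = (\<integral>x. (cmod (f x))\<^sup>2 \<partial>M)"
  by (simp add: L2_norm_def)

lemma nn_integral_eq_L2_norm:
  assumes "f \<in> L2 M"
  shows "(\<integral>\<^sup>+x. ennreal ((cmod (f x))\<^sup>2) \<partial>M) = ennreal ((L2_norm M f)\<^sup>2)"
  using nn_integral_eq_integral[OF L2_integrable[OF assms]] by (simp add: L2_norm_square)

lemma L2_norm_leI:
  assumes "0 \<le> c" "(\<integral>\<^sup>+x. ennreal ((cmod (f x))\<^sup>2) \<partial>M) \<le> ennreal (c\<^sup>2)" "f \<in> L2 M"
  shows "L2_norm M f \<le> c"
proof -
  have "(L2_norm M f)\<^sup>2 \<le> c\<^sup>2" using assms by (simp add: nn_integral_eq_L2_norm)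
  then show ?thesis using assms(1) by (rule power2_le_imp_le)
qed

lemma zero_in_L2 [simp]: "(\<lambda>x. 0) \<in> L2 M" and L2_norm_zero [simp]: "L2_norm M (\<lambda>x. 0) = 0"
  by (simp_all add: L2_def L2_norm_def)

lemma L2_cong_AE:
  assumes "f \<in> L2 M" "g \<in> borel_measurable M" "AE x in M. g x = f x"
  shows "g \<in> L2 M" "L2_norm M g = L2_norm M f"
proof -
  have m: "f \<in> borel_measurable M" using assms(1) by (rule L2_measurable)
  have "integrable M (\<lambda>x. (cmod (g x))\<^sup>2) \<longleftrightarrow> integrable M (\<lambda>x. (cmod (f x))\<^sup>2)"
    using m assms(2,3) by (intro integrable_cong_AE) auto
  then show "g \<in> L2 M" using assms by (simp add: L2_def)
  have "(\<integral>x. (cmod (g x))\<^sup>2 \<partial>M) = (\<integral>x. (cmod (f x))\<^sup>2 \<partial>M)"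
    using m assms(2,3) by (intro integral_cong_AE) auto
  then show "L2_norm M g = L2_norm M f" by (simp add: L2_norm_def)
qed

lemma L2_dominated:
  assumes "g \<in> L2 M" "f \<in> borel_measurable M" "\<And>x. x \<in> space M \<Longrightarrow> cmod (f x) \<le> cmod (g x)"
  shows "f \<in> L2 M" "L2_norm M f \<le> L2_norm M g"
proof -
  have le: "(cmod (f x))\<^sup>2 \<le> (cmod (g x))\<^sup>2" if "x \<in> space M" for x
    using assms(3)[OF that] by (intro power_mono) auto
  have "integrable M (\<lambda>x. (cmod (f x))\<^sup>2)"
    using le assms(2) by (intro Bochner_Integration.integrable_bound[OF L2_integrable[OF assms(1)]]) auto
  then show f: "f \<in> L2 M" using assms by (simp add: L2_def)
  have "(\<integral>x. (cmod (f x))\<^sup>2 \<partial>M) \<le> (\<integral>x. (cmod (g x))\<^sup>2 \<partial>M)"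
    using le L2_integrable[OF f] L2_integrable[OF assms(1)] by (intro integral_mono) auto
  then show "L2_norm M f \<le> L2_norm M g" by (simp add: L2_norm_def)
qed

lemma cutoff_in_L2:
  assumes "A \<in> sets M" "f \<in> L2 M"
  shows "cutoff A f \<in> L2 M" "L2_norm M (cutoff A f) \<le> L2_norm M f"
proof -
  have m: "cutoff A f \<in> borel_measurable M"
    using assms L2_measurable[OF assms(2)] unfolding cutoff_def by (intro borel_measurable_times) auto
  show "cutoff A f \<in> L2 M" "L2_norm M (cutoff A f) \<le> L2_norm M f"
    by (rule L2_dominated[OF assms(2) m]; simp add: cutoff_def indicator_def)+
qed

lemma L2_cmult:
  assumes "f \<in> L2 M"
  shows "(\<lambda>x. c * f x) \<in> L2 M" "L2_norm M (\<lambda>x. c * f x) = cmod c * L2_norm M f"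
  using assms by (auto simp: L2_def L2_norm_def norm_mult power_mult_distrib real_sqrt_mult)

lemma L2_uminus: "f \<in> L2 M \<Longrightarrow> (\<lambda>x. - f x) \<in> L2 M"
  using L2_cmult[of f M "-1"] by simp

lemma cmod_add_square_le: "(cmod (a + b))\<^sup>2 \<le> 2 * (cmod a)\<^sup>2 + 2 * (cmod b)\<^sup>2"
proof -
  have "(cmod (a + b))\<^sup>2 \<le> (cmod a + cmod b)\<^sup>2" by (intro power_mono norm_triangle_ineq) auto
  also have "\<dots> \<le> 2 * (cmod a)\<^sup>2 + 2 * (cmod b)\<^sup>2"
    using sum_squares_bound[of "cmod a" "cmod b"] by (simp add: power2_sum)
  finally show ?thesis .
qed

lemma L2_add:
  assumes "f \<in> L2 M" "g \<in> L2 M"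
  shows "(\<lambda>x. f x + g x) \<in> L2 M"
proof -
  note [measurable] = L2_measurable[OF assms(1)] L2_measurable[OF assms(2)]
  have "integrable M (\<lambda>x. 2 * (cmod (f x))\<^sup>2 + 2 * (cmod (g x))\<^sup>2)"
    using assms by (simp add: L2_integrable)
  then have "integrable M (\<lambda>x. (cmod (f x + g x))\<^sup>2)"
    by (rule Bochner_Integration.integrable_bound) (auto simp: cmod_add_square_le)
  then show ?thesis by (simp add: L2_def)
qed

lemma L2_diff:
  assumes "f \<in> L2 M" "g \<in> L2 M"
  shows "(\<lambda>x. f x - g x) \<in> L2 M"
  using L2_add[OF assms(1) L2_uminus[OF assms(2)]] by simp

lemma L2_sum: "(\<And>i. i \<in> S \<Longrightarrow> f i \<in> L2 M) \<Longrightarrow> (\<lambda>x. \<Sum>i\<in>S. f i x) \<in> L2 M"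
  by (induction S rule: infinite_finite_induct) (auto intro: L2_add)

lemma measurable_cnj [measurable]: "cnj \<in> borel_measurable borel"
  by (intro borel_measurable_continuous_onI continuous_intros)

lemma L2_integrable_inner:
  assumes "f \<in> L2 M" "g \<in> L2 M"
  shows "integrable M (\<lambda>x. f x * cnj (g x))"
proof -
  note [measurable] = L2_measurable[OF assms(1)] L2_measurable[OF assms(2)]
  have "integrable M (\<lambda>x. (cmod (f x))\<^sup>2 + (cmod (g x))\<^sup>2)"
    using assms by (simp add: L2_integrable)
  then show ?thesis
  proof (rule Bochner_Integration.integrable_bound)
    have "cmod (f x) * cmod (g x) \<le> (cmod (f x))\<^sup>2 + (cmod (g x))\<^sup>2" for x
    proof -
      have "0 \<le> cmod (f x) * cmod (g x)" by simp
      then show ?thesis using sum_squares_bound[of "cmod (f x)" "cmod (g x)"] by linarith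
    qed
    then show "AE x in M. norm (f x * cnj (g x)) \<le> norm ((cmod (f x))\<^sup>2 + (cmod (g x))\<^sup>2)"
      by (simp add: norm_mult)
  qed measurable
qed

lemma L2_Cauchy_Schwarz:
  assumes "f \<in> L2 M" "g \<in> L2 M"
  shows "cmod (L2_inner M f g) \<le> L2_norm M f * L2_norm M g"
proof -
  note [measurable] = L2_measurable[OF assms(1)] L2_measurable[OF assms(2)]
  have "ennreal (\<integral>x. cmod (f x) * cmod (g x) \<partial>M) = (\<integral>\<^sup>+x. ennreal (cmod (f x)) * ennreal (cmod (g x)) \<partial>M)"
    using integrable_norm[OF L2_integrable_inner[OF assms]]
    by (subst nn_integral_eq_integral[symmetric]) (auto simp: norm_mult ennreal_mult)
  then have "(ennreal (\<integral>x. cmod (f x) * cmod (g x) \<partial>M))\<^sup>2 \<le>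
      (\<integral>\<^sup>+x. (ennreal (cmod (f x)))\<^sup>2 \<partial>M) * (\<integral>\<^sup>+x. (ennreal (cmod (g x)))\<^sup>2 \<partial>M)"
    using Cauchy_Schwarz_nn_integral[of "\<lambda>x. ennreal (cmod (f x))" M "\<lambda>x. ennreal (cmod (g x))"] by simp
  also have "\<dots> = ennreal ((L2_norm M f * L2_norm M g)\<^sup>2)"
    using nn_integral_eq_L2_norm[OF assms(1)] nn_integral_eq_L2_norm[OF assms(2)]
    by (simp add: ennreal_power power_mult_distrib ennreal_mult)
  finally have "(\<integral>x. cmod (f x) * cmod (g x) \<partial>M)\<^sup>2 \<le> (L2_norm M f * L2_norm M g)\<^sup>2"
    by (simp add: ennreal_power integral_nonneg_AE)
  then have "(\<integral>x. cmod (f x) * cmod (g x) \<partial>M) \<le> L2_norm M f * L2_norm M g"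
    by (rule power2_le_imp_le) (simp add: L2_norm_nonneg)
  moreover have "cmod (L2_inner M f g) \<le> (\<integral>x. cmod (f x) * cmod (g x) \<partial>M)"
    unfolding L2_inner_def using integral_norm_bound[of M "\<lambda>x. f x * cnj (g x)"] by (simp add: norm_mult)
  ultimately show ?thesis by simp
qed

lemma L2_norm_triangle:
  assumes "f \<in> L2 M" "g \<in> L2 M"
  shows "L2_norm M (\<lambda>x. f x + g x) \<le> L2_norm M f + L2_norm M g"
proof -
  have "(L2_norm M (\<lambda>x. f x + g x))\<^sup>2 = (\<integral>x. (cmod (f x))\<^sup>2 + (cmod (g x))\<^sup>2 + 2 * Re (f x * cnj (g x)) \<partial>M)"
    unfolding L2_norm_square cmod_power2
    by (rule Bochner_Integration.integral_cong) (auto simp: power2_eq_square algebra_simps)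
  also have "\<dots> = (L2_norm M f)\<^sup>2 + (L2_norm M g)\<^sup>2 + 2 * Re (L2_inner M f g)"
    using L2_integrable_inner[OF assms] assms
    by (simp add: L2_integrable L2_norm_square L2_inner_def del: times_complex.sel)
  also have "Re (L2_inner M f g) \<le> L2_norm M f * L2_norm M g"
    using complex_Re_le_cmod L2_Cauchy_Schwarz[OF assms] by (rule order_trans)
  finally have "(L2_norm M (\<lambda>x. f x + g x))\<^sup>2 \<le> (L2_norm M f + L2_norm M g)\<^sup>2"
    by (simp add: power2_sum)
  then show ?thesis by (rule power2_le_imp_le) (simp add: L2_norm_nonneg)
qed

lemma L2_norm_eq_0_iff:
  assumes "f \<in> L2 M"
  shows "L2_norm M f = 0 \<longleftrightarrow> (AE x in M. f x = 0)"
proof -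
  have "L2_norm M f = 0 \<longleftrightarrow> (\<integral>x. (cmod (f x))\<^sup>2 \<partial>M) = 0" by (simp add: L2_norm_def)
  also have "\<dots> \<longleftrightarrow> (AE x in M. (cmod (f x))\<^sup>2 = 0)"
    by (intro integral_nonneg_eq_0_iff_AE L2_integrable assms) auto
  finally show ?thesis by simp
qed

lemma bounded_opsD:
  assumes "T \<in> bounded_ops M"
  shows "f \<in> L2 M \<Longrightarrow> T f \<in> L2 M"
    "f \<in> L2 M \<Longrightarrow> g \<in> L2 M \<Longrightarrow> AE x in M. T (\<lambda>y. f y + g y) x = T f x + T g x"
    "f \<in> L2 M \<Longrightarrow> AE x in M. T (\<lambda>y. c * f y) x = c * T f x"
  using assms by (auto simp: bounded_ops_def)

lemma bounded_opsE:
  assumes "T \<in> bounded_ops M"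
  obtains B where "0 \<le> B" "\<And>f. f \<in> L2 M \<Longrightarrow> L2_norm M (T f) \<le> B * L2_norm M f"
proof -
  obtain B where B: "\<And>f. f \<in> L2 M \<Longrightarrow> L2_norm M (T f) \<le> B * L2_norm M f"
    using assms unfolding bounded_ops_def by blast
  have "L2_norm M (T f) \<le> \<bar>B\<bar> * L2_norm M f" if "f \<in> L2 M" for f
    using B[OF that] mult_right_mono[OF abs_ge_self[of B] L2_norm_nonneg[of M f]] by linarith
  then show thesis using that[of "\<bar>B\<bar>"] by simp
qed

lemma bounded_ops_diff:
  assumes "T \<in> bounded_ops M" "f \<in> L2 M" "g \<in> L2 M"
  shows "AE x in M. T (\<lambda>y. f y - g y) x = T f x - T g x"
proof -
  have "AE x in M. T (\<lambda>y. (f y - g y) + g y) x = T (\<lambda>y. f y - g y) x + T g x"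
    by (rule bounded_opsD[OF assms(1)]) (use assms L2_diff in auto)
  then show ?thesis by (auto simp: algebra_simps elim: eventually_mono)
qed

text \<open>Boundedness forces an operator on representatives to respect equality almost everywhere.\<close>

lemma bounded_ops_cong_AE:
  assumes "T \<in> bounded_ops M" "f \<in> L2 M" "g \<in> L2 M" "AE x in M. f x = g x"
  shows "AE x in M. T f x = T g x"
proof -
  obtain B where B: "\<And>f. f \<in> L2 M \<Longrightarrow> L2_norm M (T f) \<le> B * L2_norm M f"
    using bounded_opsE[OF assms(1)] by metis
  let ?d = "\<lambda>x. f x - g x"
  have d: "?d \<in> L2 M" using assms by (intro L2_diff)
  have "L2_norm M ?d = 0" using assms(4) by (subst L2_norm_eq_0_iff[OF d]) auto
  then have "L2_norm M (T ?d) \<le> 0" using B[OF d] by simp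
  then have "AE x in M. T ?d x = 0"
    using L2_norm_eq_0_iff[OF bounded_opsD(1)[OF assms(1) d]] L2_norm_nonneg[of M "T ?d"] by simp
  with bounded_ops_diff[OF assms(1-3)] show ?thesis by eventually_elim simp
qed

lemma op_norm_upper:
  assumes "\<And>f. f \<in> L2 M \<Longrightarrow> L2_norm M (T f) \<le> B * L2_norm M f" "0 \<le> B" "f \<in> L2 M" "L2_norm M f \<le> 1"
  shows "L2_norm M (T f) \<le> op_norm M T"
  unfolding op_norm_def
proof (rule cSUP_upper)
  show "bdd_above ((\<lambda>f. L2_norm M (T f)) ` {f \<in> L2 M. L2_norm M f \<le> 1})"
  proof (rule bdd_aboveI2)
    fix f assume f: "f \<in> {f \<in> L2 M. L2_norm M f \<le> 1}"
    then have "L2_norm M (T f) \<le> B * L2_norm M f" using assms by auto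
    also have "\<dots> \<le> B * 1" using f assms(2) by (intro mult_left_mono) auto
    finally show "L2_norm M (T f) \<le> B" by simp
  qed
qed (use assms in auto)

lemma op_norm_least:
  assumes "\<And>f. f \<in> L2 M \<Longrightarrow> L2_norm M f \<le> 1 \<Longrightarrow> L2_norm M (T f) \<le> B"
  shows "op_norm M T \<le> B"
  unfolding op_norm_def
proof (rule cSUP_least)
  have "(\<lambda>x. 0) \<in> {f \<in> L2 M. L2_norm M f \<le> 1}" by simp
  then show "{f \<in> L2 M. L2_norm M f \<le> 1} \<noteq> {}" by blast
qed (use assms in auto)

section \<open>Coarea formula and Cheeger's inequality\<close>

text \<open>A form of Zorn's lemma up to null sets: only countable chains have to be closed up, because
  each enlargement can be chosen to come within \<open>(1/2)^n\<close> of the largest measure still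
  attainable.\<close>

lemma maximal_in_measure:
  assumes N: "finite_measure N" and F0: "F0 \<in> \<F>" and sets: "\<F> \<subseteq> sets N"
    and UN: "\<And>F :: nat \<Rightarrow> 'a set. incseq F \<Longrightarrow> (\<And>n. F n \<in> \<F>) \<Longrightarrow> (\<Union>n. F n) \<in> \<F>"
  obtains F where "F \<in> \<F>" "\<And>F'. F' \<in> \<F> \<Longrightarrow> F \<subseteq> F' \<Longrightarrow> measure N F' \<le> measure N F"
proof -
  interpret finite_measure N by fact
  have "\<exists>F. \<forall>n. F n \<in> \<F> \<and> (F n \<subseteq> F (Suc n) \<and>
    (\<forall>F'\<in>\<F>. F n \<subseteq> F' \<longrightarrow> measure N F' \<le> measure N (F (Suc n)) + (1/2)^n))"
  proof (rule dependent_nat_choice)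
    show "\<exists>x. x \<in> \<F>" using F0 by blast
    fix X and n :: nat assume X: "X \<in> \<F>"
    let ?S = "measure N ` {F'\<in>\<F>. X \<subseteq> F'}"
    have bdd: "bdd_above ?S" by (intro bdd_aboveI[of _ "measure N (space N)"]) (auto simp: bounded_measure)
    have "Sup ?S - (1/2)^n < Sup ?S" by simp
    moreover have "?S \<noteq> {}" using X by blast
    ultimately obtain s where "s \<in> ?S" "Sup ?S - (1/2)^n < s" by (rule less_cSupE)
    then obtain Y where Y: "Y \<in> \<F>" "X \<subseteq> Y" "Sup ?S - (1/2)^n < measure N Y" by blast
    have "measure N F' \<le> measure N Y + (1/2)^n" if "F' \<in> \<F>" "X \<subseteq> F'" for F'
    proof -
      have "measure N F' \<le> Sup ?S" using that by (intro cSup_upper bdd) auto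
      then show ?thesis using Y by simp
    qed
    then show "\<exists>Y. Y \<in> \<F> \<and> X \<subseteq> Y \<and> (\<forall>F'\<in>\<F>. X \<subseteq> F' \<longrightarrow> measure N F' \<le> measure N Y + (1/2)^n)"
      using Y by blast
  qed
  then obtain F where F: "\<And>n. F n \<in> \<F>" "\<And>n. F n \<subseteq> F (Suc n)"
    "\<And>n F'. F' \<in> \<F> \<Longrightarrow> F n \<subseteq> F' \<Longrightarrow> measure N F' \<le> measure N (F (Suc n)) + (1/2)^n" by blast
  have U: "(\<Union>n. F n) \<in> \<F>" using F by (intro UN incseq_SucI) auto
  show thesis
  proof (rule that[OF U])
    fix F' assume F': "F' \<in> \<F>" "(\<Union>n. F n) \<subseteq> F'"
    show "measure N F' \<le> measure N (\<Union>n. F n)"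
    proof (rule field_le_epsilon)
      fix e :: real assume "e > 0"
      then obtain n where n: "(1/2)^n < e" using real_arch_pow_inv[of e "1/2"] by auto
      have "measure N F' \<le> measure N (F (Suc n)) + (1/2)^n" using F' by (intro F(3)) auto
      also have "measure N (F (Suc n)) \<le> measure N (\<Union>n. F n)"
        using U sets by (intro finite_measure_mono) auto
      finally show "measure N F' \<le> measure N (\<Union>n. F n) + e" using n by simp
    qed
  qed
qed

text \<open>Think of \<open>J(A \<times> B)\<close> as the flow from \<open>A\<close> to
  \<open>B\<close>. Call a set of measure at most \<open>1/2\<close> bad if its outgoing flow is at most
  \<open>c/2\<close> times its measure. By hypothesis bad sets have measure below
  \<open>\<alpha>\<close>, so increasing unions of bad sets are bad and there is a maximal one,
  \<open>F\<close>. If a set \<open>A\<close> outside \<open>F\<close> had too little flow to the rest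
  of the complement of \<open>F\<close>, then \<open>F \<union> A\<close> would be bad as well.\<close>

lemma expansion_after_removing_small_set:
  assumes N: "finite_measure N" and N1: "measure N (space N) = 1" and J: "finite_measure J"
    and sJ: "sets J = sets (N \<Otimes>\<^sub>M N)"
    and sym: "\<And>A B. A \<in> sets N \<Longrightarrow> B \<in> sets N \<Longrightarrow> measure J (A \<times> B) = measure J (B \<times> A)"
    and c: "0 < c" and \<alpha>: "0 < \<alpha>" "\<alpha> \<le> 1/4"
    and exp: "\<And>A. A \<in> sets N \<Longrightarrow> \<alpha> \<le> measure N A \<Longrightarrow> measure N A \<le> 1/2 \<Longrightarrow>
      c * measure N A \<le> measure J (A \<times> (space N - A))"
  obtains F where "F \<in> sets N" "measure N F \<le> \<alpha>"
    "\<And>A. A \<in> sets N \<Longrightarrow> A \<subseteq> space N - F \<Longrightarrow> measure N A \<le> measure N (space N - F) / 2 \<Longrightarrow>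
      c / 2 * measure N A \<le> measure J (A \<times> (space N - F - A))"
proof -
  interpret N: finite_measure N by fact
  interpret J: finite_measure J by fact
  let ?X = "space N"
  let ?\<nu> = "measure N" and ?m = "\<lambda>A B. measure J (A \<times> B)"
  have rect: "A \<times> B \<in> sets J" if "A \<in> sets N" "B \<in> sets N" for A B using that by (simp add: sJ)
  have m_mono: "?m A B \<le> ?m A' B'" if "A \<subseteq> A'" "B \<subseteq> B'" "A' \<in> sets N" "B' \<in> sets N" for A B A' B'
    using that rect by (intro J.finite_measure_mono) auto
  have m_Un: "?m (A \<union> A') B \<le> ?m A B + ?m A' B" if "A \<in> sets N" "A' \<in> sets N" "B \<in> sets N" for A A' B
    using that rect unfolding Sigma_Un_distrib1 by (intro measure_Un_le) auto
  define \<F> where "\<F> = {F \<in> sets N. ?\<nu> F \<le> 1/2 \<and> ?m F (?X - F) \<le> c / 2 * ?\<nu> F}"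
  have small: "?\<nu> F < \<alpha>" if "F \<in> \<F>" for F
  proof (rule ccontr)
    assume "\<not> ?\<nu> F < \<alpha>"
    then have "c * ?\<nu> F \<le> c / 2 * ?\<nu> F" using exp[of F] that by (auto simp: \<F>_def)
    then have "c * ?\<nu> F \<le> 0" by simp
    moreover have "0 < c * ?\<nu> F" using c \<alpha> \<open>\<not> ?\<nu> F < \<alpha>\<close> by (intro mult_pos_pos) auto
    ultimately show False by simp
  qed
  have UN: "(\<Union>n. F n) \<in> \<F>" if F: "incseq F" "\<And>n. F n \<in> \<F>" for F :: "nat \<Rightarrow> 'a set"
  proof -
    let ?U = "\<Union>n. F n"
    have Fs: "F n \<in> sets N" for n using F by (auto simp: \<F>_def)
    then have U: "?U \<in> sets N" by auto
    have lim: "(\<lambda>n. ?\<nu> (F n)) \<longlonglongrightarrow> ?\<nu> ?U"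
      using Fs F(1) by (intro N.finite_Lim_measure_incseq) auto
    have "?\<nu> ?U \<le> 1/2"
      using lim by (rule LIMSEQ_le_const2) (use F in \<open>auto simp: \<F>_def\<close>)
    moreover have "?m ?U (?X - ?U) \<le> c / 2 * ?\<nu> ?U"
    proof (rule LIMSEQ_le)
      show "(\<lambda>n. c / 2 * ?\<nu> (F n)) \<longlonglongrightarrow> c / 2 * ?\<nu> ?U" using lim by (intro tendsto_mult tendsto_const)
      have "(\<lambda>n. measure J (F n \<times> (?X - ?U))) \<longlonglongrightarrow> measure J (\<Union>n. F n \<times> (?X - ?U))"
      proof (intro J.finite_Lim_measure_incseq)
        show "range (\<lambda>n. F n \<times> (?X - ?U)) \<subseteq> sets J" using Fs U rect by blast
        show "incseq (\<lambda>n. F n \<times> (?X - ?U))" using F(1) unfolding incseq_def by blast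
      qed
      also have "(\<Union>n. F n \<times> (?X - ?U)) = ?U \<times> (?X - ?U)" by blast
      finally show "(\<lambda>n. ?m (F n) (?X - ?U)) \<longlonglongrightarrow> ?m ?U (?X - ?U)" .
      have "?m (F n) (?X - ?U) \<le> c / 2 * ?\<nu> (F n)" for n
      proof -
        have "?m (F n) (?X - ?U) \<le> ?m (F n) (?X - F n)" using Fs U by (intro m_mono) auto
        also have "\<dots> \<le> c / 2 * ?\<nu> (F n)" using F(2)[of n] by (simp add: \<F>_def)
        finally show ?thesis .
      qed
      then show "\<exists>k. \<forall>n\<ge>k. ?m (F n) (?X - ?U) \<le> c / 2 * ?\<nu> (F n)" by blast
    qed
    ultimately show ?thesis using U by (simp add: \<F>_def)
  qed
  have "{} \<in> \<F>" by (simp add: \<F>_def)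
  moreover have "\<F> \<subseteq> sets N" by (auto simp: \<F>_def)
  ultimately obtain F where F: "F \<in> \<F>" and max: "\<And>F'. F' \<in> \<F> \<Longrightarrow> F \<subseteq> F' \<Longrightarrow> ?\<nu> F' \<le> ?\<nu> F"
    using maximal_in_measure[OF N _ _ UN] by blast
  have Fs: "F \<in> sets N" and F\<alpha>: "?\<nu> F < \<alpha>" using F small by (auto simp: \<F>_def)
  show thesis
  proof (rule that[OF Fs less_imp_le[OF F\<alpha>]])
    fix A assume A: "A \<in> sets N" "A \<subseteq> ?X - F" and half: "?\<nu> A \<le> ?\<nu> (?X - F) / 2"
    let ?Y = "?X - F" and ?U = "F \<union> A"
    show "c / 2 * ?\<nu> A \<le> ?m A (?Y - A)"
    proof (rule ccontr)
      assume neg: "\<not> c / 2 * ?\<nu> A \<le> ?m A (?Y - A)"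
      have \<nu>A: "0 < ?\<nu> A"
      proof (rule ccontr)
        assume "\<not> 0 < ?\<nu> A"
        then have "?\<nu> A = 0" using measure_nonneg[of N A] by simp
        then show False using neg by simp
      qed
      have Y: "?\<nu> ?Y = 1 - ?\<nu> F" using N.finite_measure_compl[OF Fs] N1 by simp
      have \<nu>U: "?\<nu> ?U = ?\<nu> F + ?\<nu> A" using Fs A by (intro N.finite_measure_Union) auto
      have "?X - ?U = ?Y - A" by blast
      then have "?m ?U (?X - ?U) \<le> ?m F (?Y - A) + ?m A (?Y - A)"
        using m_Un[OF Fs A(1), of "?Y - A"] Fs A by simp
      also have "?m F (?Y - A) \<le> ?m F (?X - F)" using Fs A by (intro m_mono) auto
      also have "\<dots> \<le> c / 2 * ?\<nu> F" using F by (simp add: \<F>_def)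
      finally have mU: "?m ?U (?X - ?U) \<le> c / 2 * ?\<nu> ?U" using neg \<nu>U by (simp add: algebra_simps)
      show False
      proof (cases "?\<nu> ?U \<le> 1/2")
        case True
        then have "?U \<in> \<F>" using mU Fs A by (simp add: \<F>_def)
        then show False using max[of ?U] \<nu>U \<nu>A by auto
      next
        case False
        \<comment> \<open>Now \<open>F \<union> A\<close> is too large to be bad, but its complement is
          a set to which the hypothesis with the full constant \<open>c\<close> applies. This is where
          \<open>\<alpha> \<le> 1/4\<close> is used: it makes the complement so large that the factor
          between \<open>c\<close> and \<open>c/2\<close> gives a contradiction.\<close>
        have \<nu>V: "?\<nu> (?X - ?U) = 1 - ?\<nu> ?U" using N.finite_measure_compl[of ?U] Fs A N1 by simp
        have V1: "\<alpha> \<le> ?\<nu> (?X - ?U)" using half \<nu>V \<nu>U Y F\<alpha> \<alpha> by simp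
        have "c * ?\<nu> (?X - ?U) \<le> ?m (?X - ?U) (?X - (?X - ?U))"
          using False \<nu>V V1 Fs A by (intro exp) auto
        also have "?X - (?X - ?U) = ?U" using Fs A sets.sets_into_space[OF Fs] by auto
        also have "?m (?X - ?U) ?U = ?m ?U (?X - ?U)" using Fs A by (intro sym) auto
        finally have "c * ?\<nu> (?X - ?U) \<le> c * (?\<nu> ?U / 2)" using mU by simp
        then have "?\<nu> (?X - ?U) \<le> ?\<nu> ?U / 2" using c by simp
        then show False using \<nu>V \<nu>U half Y F\<alpha> \<alpha> by simp
      qed
    qed
  qed
qed

lemma ennreal_diff_eq_nn_integral:
  assumes "0 \<le> q"
  shows "ennreal (p - q) = (\<integral>\<^sup>+t. indicator {q..<p} t \<partial>lborel)"
  by (cases "q \<le> p") (auto simp: ennreal_neg)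

text \<open>Both sides are integrals over \<open>t \<ge> 0\<close> of quantities attached to the level
  sets \<open>{h > t}\<close>: by Fubini the left one is \<open>c\<close> times their measure, the right
  one is the flow out of them.\<close>

lemma coarea_expansion:
  fixes h :: "'a \<Rightarrow> real"
  assumes N: "finite_measure N" and J: "finite_measure J" and sJ: "sets J = sets (N \<Otimes>\<^sub>M N)"
    and h: "h \<in> borel_measurable N" "\<And>x. 0 \<le> h x"
    and exp: "\<And>t. 0 \<le> t \<Longrightarrow> ennreal c * emeasure N {x\<in>space N. t < h x} \<le>
      emeasure J ({x\<in>space N. t < h x} \<times> {x\<in>space N. h x \<le> t})"
  shows "ennreal c * (\<integral>\<^sup>+x. ennreal (h x) \<partial>N) \<le> (\<integral>\<^sup>+z. ennreal (h (fst z) - h (snd z)) \<partial>J)"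
proof -
  interpret N: finite_measure N by fact
  interpret J: finite_measure J by fact
  interpret NL: pair_sigma_finite N lborel ..
  interpret JL: pair_sigma_finite J lborel ..
  note [measurable] = h(1)
  have [measurable]: "fst \<in> measurable J N" "snd \<in> measurable J N"
    by (simp_all cong: measurable_cong_sets add: sJ)
  have sp: "space J = space N \<times> space N" using sets_eq_imp_space_eq[OF sJ] by (simp add: space_pair_measure)
  have "(\<integral>\<^sup>+x. ennreal (h x) \<partial>N) = (\<integral>\<^sup>+x. \<integral>\<^sup>+t. indicator {(x, t). 0 \<le> t \<and> t < h x} (x, t) \<partial>lborel \<partial>N)"
  proof (rule nn_integral_cong)
    fix x
    have "ennreal (h x) = (\<integral>\<^sup>+t. indicator {0..<h x} t \<partial>lborel)"
      using ennreal_diff_eq_nn_integral[of 0 "h x"] by simp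
    also have "\<dots> = (\<integral>\<^sup>+t. indicator {(x, t). 0 \<le> t \<and> t < h x} (x, t) \<partial>lborel)"
      by (rule nn_integral_cong) (simp add: indicator_def)
    finally show "ennreal (h x) = \<dots>" .
  qed
  also have "\<dots> = (\<integral>\<^sup>+t. \<integral>\<^sup>+x. indicator {(x, t). 0 \<le> t \<and> t < h x} (x, t) \<partial>N \<partial>lborel)"
    by (intro NL.Fubini'[symmetric]) measurable
  finally have 1: "(\<integral>\<^sup>+x. ennreal (h x) \<partial>N) = \<dots>" .
  have "(\<integral>\<^sup>+z. ennreal (h (fst z) - h (snd z)) \<partial>J)
      = (\<integral>\<^sup>+z. \<integral>\<^sup>+t. indicator {(z, t). h (snd z) \<le> t \<and> t < h (fst z)} (z, t) \<partial>lborel \<partial>J)"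
  proof (rule nn_integral_cong)
    fix z
    have "ennreal (h (fst z) - h (snd z)) = (\<integral>\<^sup>+t. indicator {h (snd z)..<h (fst z)} t \<partial>lborel)"
      using h(2) by (rule ennreal_diff_eq_nn_integral)
    also have "\<dots> = (\<integral>\<^sup>+t. indicator {(z, t). h (snd z) \<le> t \<and> t < h (fst z)} (z, t) \<partial>lborel)"
      by (rule nn_integral_cong) (simp add: indicator_def)
    finally show "ennreal (h (fst z) - h (snd z)) = \<dots>" .
  qed
  also have "\<dots> = (\<integral>\<^sup>+t. \<integral>\<^sup>+z. indicator {(z, t). h (snd z) \<le> t \<and> t < h (fst z)} (z, t) \<partial>J \<partial>lborel)"
    by (intro JL.Fubini'[symmetric]) measurable
  finally have 2: "(\<integral>\<^sup>+z. ennreal (h (fst z) - h (snd z)) \<partial>J) = \<dots>" .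
  show ?thesis unfolding 1 2
  proof (subst nn_integral_cmult[symmetric])
    show "(\<lambda>t. \<integral>\<^sup>+x. indicator {(x, t). 0 \<le> t \<and> t < h x} (x, t) \<partial>N) \<in> borel_measurable lborel"
      by measurable
    show "(\<integral>\<^sup>+t. ennreal c * (\<integral>\<^sup>+x. indicator {(x, t). 0 \<le> t \<and> t < h x} (x, t) \<partial>N) \<partial>lborel)
      \<le> (\<integral>\<^sup>+t. \<integral>\<^sup>+z. indicator {(z, t). h (snd z) \<le> t \<and> t < h (fst z)} (z, t) \<partial>J \<partial>lborel)"
    proof (rule nn_integral_mono)
      fix t :: real
      show "ennreal c * (\<integral>\<^sup>+x. indicator {(x, t). 0 \<le> t \<and> t < h x} (x, t) \<partial>N)
        \<le> (\<integral>\<^sup>+z. indicator {(z, t). h (snd z) \<le> t \<and> t < h (fst z)} (z, t) \<partial>J)"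
      proof (cases "0 \<le> t")
        case True
        have "(\<integral>\<^sup>+x. indicator {(x, t). 0 \<le> t \<and> t < h x} (x, t) \<partial>N)
            = (\<integral>\<^sup>+x. indicator {x\<in>space N. t < h x} x \<partial>N)"
          using True by (intro nn_integral_cong) (auto simp: indicator_def)
        also have "\<dots> = emeasure N {x\<in>space N. t < h x}" by (intro nn_integral_indicator) measurable
        finally have a: "(\<integral>\<^sup>+x. indicator {(x, t). 0 \<le> t \<and> t < h x} (x, t) \<partial>N) = \<dots>" .
        have "(\<integral>\<^sup>+z. indicator {(z, t). h (snd z) \<le> t \<and> t < h (fst z)} (z, t) \<partial>J)
            = (\<integral>\<^sup>+z. indicator ({x\<in>space N. t < h x} \<times> {x\<in>space N. h x \<le> t}) z \<partial>J)"
          by (intro nn_integral_cong) (auto simp: indicator_def sp)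
        also have "\<dots> = emeasure J ({x\<in>space N. t < h x} \<times> {x\<in>space N. h x \<le> t})"
          by (intro nn_integral_indicator) (simp add: sJ)
        finally show ?thesis using a exp[OF True] by simp
      qed simp
    qed
  qed
qed

lemma difference_of_squares_bound:
  fixes p q s :: real
  assumes "0 < s"
  shows "p\<^sup>2 - q\<^sup>2 \<le> s / 2 * (p - q)\<^sup>2 + (1 / s) * (p\<^sup>2 + q\<^sup>2)"
proof -
  have "0 \<le> (s * (p - q) - (p + q))\<^sup>2" "0 \<le> (p - q)\<^sup>2" by auto
  then have "2 * s * (p\<^sup>2 - q\<^sup>2) \<le> s\<^sup>2 * (p - q)\<^sup>2 + 2 * (p\<^sup>2 + q\<^sup>2)"
    by (simp add: power2_eq_square algebra_simps)
  also have "\<dots> = 2 * s * (s / 2 * (p - q)\<^sup>2 + (1 / s) * (p\<^sup>2 + q\<^sup>2))"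
    using assms by (simp add: field_simps power2_eq_square)
  finally show ?thesis using assms by simp
qed

text \<open>Apply the coarea inequality to \<open>u\<^sup>2\<close> and bound \<open>u(x)\<^sup>2 -
  u(y)\<^sup>2\<close> by \<open>(s/2) (u(x) - u(y))\<^sup>2 + (1/s) (u(x)\<^sup>2 +
  u(y)\<^sup>2)\<close>. The hypotheses on the marginals of \<open>J\<close> turn the last term into a
  multiple of the integral of \<open>u\<^sup>2\<close>.\<close>

lemma Cheeger_nonneg:
  fixes u :: "'a \<Rightarrow> real"
  assumes N: "finite_measure N" and J: "finite_measure J" and sJ: "sets J = sets (N \<Otimes>\<^sub>M N)"
    and b: "0 < b"
    and m1: "\<And>f. f \<in> borel_measurable N \<Longrightarrow> (\<integral>\<^sup>+z. f (fst z) \<partial>J) \<le> ennreal b * (\<integral>\<^sup>+x. f x \<partial>N)"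
    and m2: "\<And>f. f \<in> borel_measurable N \<Longrightarrow> (\<integral>\<^sup>+z. f (snd z) \<partial>J) \<le> ennreal b * (\<integral>\<^sup>+x. f x \<partial>N)"
    and u: "u \<in> borel_measurable N" "\<And>x. 0 \<le> u x" and fin: "(\<integral>\<^sup>+x. ennreal ((u x)\<^sup>2) \<partial>N) < \<infinity>"
    and c: "0 < c"
    and exp: "\<And>t. 0 \<le> t \<Longrightarrow> ennreal c * emeasure N {x\<in>space N. t < u x} \<le>
      emeasure J ({x\<in>space N. t < u x} \<times> {x\<in>space N. u x \<le> t})"
  shows "ennreal (c\<^sup>2 / (4 * b)) * (\<integral>\<^sup>+x. ennreal ((u x)\<^sup>2) \<partial>N)
    \<le> (\<integral>\<^sup>+z. ennreal ((u (fst z) - u (snd z))\<^sup>2) \<partial>J)"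
proof -
  note [measurable] = u(1)
  have [measurable]: "fst \<in> measurable J N" "snd \<in> measurable J N"
    by (simp_all cong: measurable_cong_sets add: sJ)
  define H where "H = (\<integral>\<^sup>+x. ennreal ((u x)\<^sup>2) \<partial>N)"
  define E where "E = (\<integral>\<^sup>+z. ennreal ((u (fst z) - u (snd z))\<^sup>2) \<partial>J)"
  \<comment> \<open>With this \<open>s\<close> the error term \<open>(1/s) 2 b H\<close> is exactly half
    of the left-hand side \<open>c H\<close>.\<close>
  define s where "s = 4 * b / c"
  have s: "0 < s" using b c by (simp add: s_def)
  have lev: "t < (u x)\<^sup>2 \<longleftrightarrow> sqrt t < u x" "(u x)\<^sup>2 \<le> t \<longleftrightarrow> u x \<le> sqrt t" if "0 \<le> t" for t x
    using real_sqrt_less_iff[of t "(u x)\<^sup>2"] real_sqrt_le_iff[of "(u x)\<^sup>2" t] u(2)[of x] by auto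
  have "ennreal c * H \<le> (\<integral>\<^sup>+z. ennreal ((u (fst z))\<^sup>2 - (u (snd z))\<^sup>2) \<partial>J)"
    unfolding H_def
  proof (rule coarea_expansion[OF N J sJ])
    fix t :: real assume t: "0 \<le> t"
    then show "ennreal c * emeasure N {x\<in>space N. t < (u x)\<^sup>2} \<le>
      emeasure J ({x\<in>space N. t < (u x)\<^sup>2} \<times> {x\<in>space N. (u x)\<^sup>2 \<le> t})"
      using exp[of "sqrt t"] lev by simp
  qed auto
  also have "\<dots> \<le> (\<integral>\<^sup>+z. ennreal (s / 2) * ennreal ((u (fst z) - u (snd z))\<^sup>2) +
      ennreal (1 / s) * (ennreal ((u (fst z))\<^sup>2) + ennreal ((u (snd z))\<^sup>2)) \<partial>J)"
    using difference_of_squares_bound[OF s] s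
    by (intro nn_integral_mono) (simp add: ennreal_mult[symmetric] ennreal_plus[symmetric] ennreal_leI del:
        ennreal_plus)
  also have "\<dots> = ennreal (s / 2) * E + ennreal (1 / s) *
      ((\<integral>\<^sup>+z. ennreal ((u (fst z))\<^sup>2) \<partial>J) + (\<integral>\<^sup>+z. ennreal ((u (snd z))\<^sup>2) \<partial>J))"
    unfolding E_def by (simp add: nn_integral_add nn_integral_cmult)
  also have "\<dots> \<le> ennreal (s / 2) * E + ennreal (1 / s) * (ennreal b * H + ennreal b * H)"
    unfolding H_def by (intro add_mono mult_left_mono order_refl m1[of "\<lambda>x. ennreal ((u x)\<^sup>2)"]
        m2[of "\<lambda>x. ennreal ((u x)\<^sup>2)"]) auto
  finally have le: "ennreal c * H \<le> ennreal (s / 2) * E + ennreal (1 / s) * (ennreal b * H + ennreal b * H)" .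
  show ?thesis
  proof (cases "E = \<infinity>")
    case False
    obtain H' where H': "H = ennreal H'" "0 \<le> H'" using fin by (cases H) (auto simp: H_def)
    obtain E' where E': "E = ennreal E'" "0 \<le> E'" using False by (cases E) auto
    have "c * H' \<le> s / 2 * E' + 1 / s * (b * H' + b * H')"
      using le b c s H' E' by (simp add: ennreal_mult[symmetric] ennreal_plus[symmetric] del: ennreal_plus)
    also have "1 / s * (b * H' + b * H') = c / 2 * H'" using b c by (simp add: s_def field_simps)
    finally have "c / 2 * H' \<le> s / 2 * E'" by simp
    then have "c\<^sup>2 / (4 * b) * H' \<le> E'" using b c by (simp add: s_def field_simps power2_eq_square)
    then show ?thesis using H' E' b c unfolding H_def[symmetric] E_def[symmetric]
      by (simp add: ennreal_mult[symmetric] ennreal_leI)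
  qed (simp add: E_def)
qed

lemma median_exists:
  fixes g :: "'a \<Rightarrow> real"
  assumes N: "finite_measure N" and g: "g \<in> borel_measurable N"
  obtains a where "measure N {x\<in>space N. a < g x} \<le> measure N (space N) / 2"
    "measure N {x\<in>space N. g x < a} \<le> measure N (space N) / 2"
proof (cases "measure N (space N) = 0")
  case True
  interpret finite_measure N by fact
  have "measure N A \<le> 0" for A using bounded_measure[of A] True by simp
  then show thesis using that[of 0] True by simp
next
  case False
  interpret finite_measure N by fact
  note [measurable] = g
  define v where "v = measure N (space N)"
  have v: "0 < v" using False measure_nonneg[of N "space N"] by (simp add: v_def less_le)
  define T where "T = {a. measure N {x\<in>space N. a < g x} \<le> v / 2}"
  have up: "a' \<in> T" if "a \<in> T" "a \<le> a'" for a a'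
  proof -
    have "measure N {x\<in>space N. a' < g x} \<le> measure N {x\<in>space N. a < g x}"
      using that by (intro finite_measure_mono) auto
    then show ?thesis using that by (simp add: T_def)
  qed
  have "(\<lambda>n. measure N {x\<in>space N. real n < g x}) \<longlonglongrightarrow> measure N (\<Inter>n. {x\<in>space N. real n < g x})"
    by (intro finite_Lim_measure_decseq) (auto simp: decseq_def)
  moreover have "(\<Inter>n. {x\<in>space N. real n < g x}) = {}"
    using reals_Archimedean2 less_asym by auto blast
  ultimately have "(\<lambda>n. measure N {x\<in>space N. real n < g x}) \<longlonglongrightarrow> 0" by simp
  then have "\<forall>\<^sub>F n in sequentially. measure N {x\<in>space N. real n < g x} < v / 2"
    using v by (intro order_tendstoD) auto
  then obtain n0 where "real n0 \<in> T" by (auto simp: T_def eventually_sequentially dest: less_imp_le)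
  then have ne: "T \<noteq> {}" by auto
  have "(\<lambda>n. measure N {x\<in>space N. - real n < g x}) \<longlonglongrightarrow> measure N (\<Union>n. {x\<in>space N. - real n < g x})"
    by (intro finite_Lim_measure_incseq) (auto simp: incseq_def)
  moreover have "(\<Union>n. {x\<in>space N. - real n < g x}) = space N"
    using reals_Archimedean2[of "- g _"] by (auto simp: minus_less_iff)
  ultimately have "(\<lambda>n. measure N {x\<in>space N. - real n < g x}) \<longlonglongrightarrow> v" by (simp add: v_def)
  then have "\<forall>\<^sub>F n in sequentially. v / 2 < measure N {x\<in>space N. - real n < g x}"
    using v by (intro order_tendstoD) auto
  then obtain n1 where "- real n1 \<notin> T" by (auto simp: T_def eventually_sequentially not_le)
  then have bdd: "bdd_below T" using up by (intro bdd_belowI[of _ "- real n1"]) (meson linear)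
  define a where "a = Inf T"
  have above: "b \<in> T" if "a < b" for b
    using that ne bdd up unfolding a_def by (metis cInf_less_iff less_imp_le)
  have below: "b \<notin> T" if "b < a" for b
    using that bdd unfolding a_def by (metis cInf_lower not_le)
  have "measure N {x\<in>space N. a < g x} \<le> v / 2"
  proof (rule LIMSEQ_le_const2)
    have "(\<lambda>n. measure N {x\<in>space N. a + 1 / Suc n < g x}) \<longlonglongrightarrow> measure N (\<Union>n. {x\<in>space N. a + 1 / Suc n < g x})"
    proof (intro finite_Lim_measure_incseq)
      show "incseq (\<lambda>n. {x\<in>space N. a + 1 / Suc n < g x})"
      proof (rule incseq_SucI, safe)
        fix n x assume "a + 1 / real (Suc n) < g x"
        moreover have "1 / real (Suc (Suc n)) \<le> 1 / real (Suc n)" by (intro divide_left_mono) auto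
        ultimately show "a + 1 / real (Suc (Suc n)) < g x" by linarith
      qed
    qed auto
    also have "(\<Union>n. {x\<in>space N. a + 1 / Suc n < g x}) = {x\<in>space N. a < g x}"
    proof (intro equalityI subsetI)
      fix x assume "x \<in> (\<Union>n. {x\<in>space N. a + 1 / Suc n < g x})"
      then obtain n where "x \<in> space N" "a + 1 / Suc n < g x" by blast
      moreover have "0 < 1 / real (Suc n)" by simp
      ultimately have "x \<in> space N" "a < g x" by linarith+
      then show "x \<in> {x\<in>space N. a < g x}" by simp
    next
      fix x assume x: "x \<in> {x\<in>space N. a < g x}"
      then obtain n where "1 / Suc n < g x - a" using nat_approx_posE[of "g x - a"] by auto
      then show "x \<in> (\<Union>n. {x\<in>space N. a + 1 / Suc n < g x})" using x by (auto simp: algebra_simps)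
    qed
    finally show "(\<lambda>n. measure N {x\<in>space N. a + 1 / Suc n < g x}) \<longlonglongrightarrow> measure N {x\<in>space N. a < g x}" .
    have "measure N {x\<in>space N. a + 1 / Suc n < g x} \<le> v / 2" for n
      using above[of "a + 1 / Suc n"] by (simp add: T_def)
    then show "\<exists>k. \<forall>n\<ge>k. measure N {x\<in>space N. a + 1 / Suc n < g x} \<le> v / 2" by blast
  qed
  moreover have "measure N {x\<in>space N. g x < a} \<le> v / 2"
  proof (rule LIMSEQ_le_const2)
    have "(\<lambda>n. measure N {x\<in>space N. g x \<le> a - 1 / Suc n}) \<longlonglongrightarrow> measure N (\<Union>n. {x\<in>space N. g x \<le> a - 1 / Suc n})"
    proof (intro finite_Lim_measure_incseq)
      show "incseq (\<lambda>n. {x\<in>space N. g x \<le> a - 1 / Suc n})"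
      proof (rule incseq_SucI, safe)
        fix n x assume "g x \<le> a - 1 / real (Suc n)"
        moreover have "1 / real (Suc (Suc n)) \<le> 1 / real (Suc n)" by (intro divide_left_mono) auto
        ultimately show "g x \<le> a - 1 / real (Suc (Suc n))" by linarith
      qed
    qed auto
    also have "(\<Union>n. {x\<in>space N. g x \<le> a - 1 / Suc n}) = {x\<in>space N. g x < a}"
    proof (intro equalityI subsetI)
      fix x assume "x \<in> (\<Union>n. {x\<in>space N. g x \<le> a - 1 / Suc n})"
      then obtain n where "x \<in> space N" "g x \<le> a - 1 / Suc n" by blast
      moreover have "0 < 1 / real (Suc n)" by simp
      ultimately have "x \<in> space N" "g x < a" by linarith+
      then show "x \<in> {x\<in>space N. g x < a}" by simp
    next
      fix x assume x: "x \<in> {x\<in>space N. g x < a}"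
      then obtain n where "1 / Suc n < a - g x" using nat_approx_posE[of "a - g x"] by auto
      then have "g x \<le> a - 1 / Suc n" by linarith
      then show "x \<in> (\<Union>n. {x\<in>space N. g x \<le> a - 1 / Suc n})" using x by blast
    qed
    finally show "(\<lambda>n. measure N {x\<in>space N. g x \<le> a - 1 / Suc n}) \<longlonglongrightarrow> measure N {x\<in>space N. g x < a}" .
    have "measure N {x\<in>space N. g x \<le> a - 1 / Suc n} \<le> v / 2" for n
    proof -
      let ?b = "a - 1 / Suc n"
      have "v / 2 < measure N {x\<in>space N. ?b < g x}" using below[of ?b] by (simp add: T_def)
      moreover have "measure N {x\<in>space N. g x \<le> ?b} = v - measure N {x\<in>space N. ?b < g x}"
      proof -
        have "{x\<in>space N. g x \<le> ?b} = space N - {x\<in>space N. ?b < g x}" by auto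
        then show ?thesis unfolding v_def by (simp add: finite_measure_compl)
      qed
      ultimately show ?thesis by simp
    qed
    then show "\<exists>k. \<forall>n\<ge>k. measure N {x\<in>space N. g x \<le> a - 1 / Suc n} \<le> v / 2" by blast
  qed
  ultimately show thesis using that[of a] by (simp add: v_def)
qed

text \<open>The positive and the negative part of \<open>g - a\<close>, for a median \<open>a\<close>,
  live on sets of at most half the measure, so all their level sets expand and Cheeger's inequality
  applies to each of them. Splitting \<open>g - a\<close> into these parts can only decrease the energy.\<close>

lemma Poincare_inequality_median:
  fixes g :: "'a \<Rightarrow> real"
  assumes N: "finite_measure N" and J: "finite_measure J" and sJ: "sets J = sets (N \<Otimes>\<^sub>M N)"
    and b: "0 < b"
    and m1: "\<And>f. f \<in> borel_measurable N \<Longrightarrow> (\<integral>\<^sup>+z. f (fst z) \<partial>J) \<le> ennreal b * (\<integral>\<^sup>+x. f x \<partial>N)"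
    and m2: "\<And>f. f \<in> borel_measurable N \<Longrightarrow> (\<integral>\<^sup>+z. f (snd z) \<partial>J) \<le> ennreal b * (\<integral>\<^sup>+x. f x \<partial>N)"
    and c: "0 < c"
    and exp: "\<And>A. A \<in> sets N \<Longrightarrow> measure N A \<le> measure N (space N) / 2 \<Longrightarrow>
      c * measure N A \<le> measure J (A \<times> (space N - A))"
    and g: "g \<in> borel_measurable N" and fin: "(\<integral>\<^sup>+x. ennreal ((g x)\<^sup>2) \<partial>N) < \<infinity>"
  obtains a where "ennreal (c\<^sup>2 / (4 * b)) * (\<integral>\<^sup>+x. ennreal ((g x - a)\<^sup>2) \<partial>N)
    \<le> (\<integral>\<^sup>+z. ennreal ((g (fst z) - g (snd z))\<^sup>2) \<partial>J)"
proof -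
  interpret N: finite_measure N by fact
  interpret J: finite_measure J by fact
  note [measurable] = g
  have [measurable]: "fst \<in> measurable J N" "snd \<in> measurable J N"
    by (simp_all cong: measurable_cong_sets add: sJ)
  obtain a where a: "measure N {x\<in>space N. a < g x} \<le> measure N (space N) / 2"
    "measure N {x\<in>space N. g x < a} \<le> measure N (space N) / 2"
    using median_exists[OF N g] .
  have fin_a: "(\<integral>\<^sup>+x. ennreal ((g x - a)\<^sup>2) \<partial>N) < \<infinity>"
  proof -
    have "(\<integral>\<^sup>+x. ennreal ((g x - a)\<^sup>2) \<partial>N) \<le> (\<integral>\<^sup>+x. ennreal 2 * ennreal ((g x)\<^sup>2) + ennreal (2 * a\<^sup>2) \<partial>N)"
    proof (rule nn_integral_mono)
      fix x
      have "0 \<le> (g x + a)\<^sup>2" by simp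
      then have "(g x - a)\<^sup>2 \<le> 2 * (g x)\<^sup>2 + 2 * a\<^sup>2" by (simp add: power2_eq_square algebra_simps)
      then show "ennreal ((g x - a)\<^sup>2) \<le> ennreal 2 * ennreal ((g x)\<^sup>2) + ennreal (2 * a\<^sup>2)"
        by (simp add: ennreal_mult[symmetric] ennreal_plus[symmetric] ennreal_leI del: ennreal_plus
            ennreal_numeral)
    qed
    also have "\<dots> = ennreal 2 * (\<integral>\<^sup>+x. ennreal ((g x)\<^sup>2) \<partial>N) + ennreal (2 * a\<^sup>2) * emeasure N (space N)"
      by (simp add: nn_integral_add nn_integral_cmult)
    also have "\<dots> < \<infinity>" using fin by (simp add: ennreal_mult_less_top N.emeasure_eq_measure)
    finally show ?thesis .
  qed
  have part: "ennreal (c\<^sup>2 / (4 * b)) * (\<integral>\<^sup>+x. ennreal ((u x)\<^sup>2) \<partial>N)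
    \<le> (\<integral>\<^sup>+z. ennreal ((u (fst z) - u (snd z))\<^sup>2) \<partial>J)"
    if u[measurable]: "u \<in> borel_measurable N" and u0: "\<And>x. 0 \<le> u x" and ug: "\<And>x. \<bar>u x\<bar> \<le> \<bar>g x - a\<bar>"
      and half: "measure N {x\<in>space N. 0 < u x} \<le> measure N (space N) / 2" for u
  proof (rule Cheeger_nonneg[OF N J sJ b m1 m2 u u0 _ c])
    have "(\<integral>\<^sup>+x. ennreal ((u x)\<^sup>2) \<partial>N) \<le> (\<integral>\<^sup>+x. ennreal ((g x - a)\<^sup>2) \<partial>N)"
      using ug by (intro nn_integral_mono ennreal_leI) (simp add: abs_le_square_iff)
    then show "(\<integral>\<^sup>+x. ennreal ((u x)\<^sup>2) \<partial>N) < \<infinity>" using fin_a by (rule le_less_trans)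
    fix t :: real assume t: "0 \<le> t"
    let ?A = "{x\<in>space N. t < u x}"
    have "measure N ?A \<le> measure N {x\<in>space N. 0 < u x}" using t by (intro N.finite_measure_mono) auto
    then have "c * measure N ?A \<le> measure J (?A \<times> (space N - ?A))" using half by (intro exp) auto
    moreover have "space N - ?A = {x\<in>space N. u x \<le> t}" by auto
    ultimately show "ennreal c * emeasure N ?A \<le> emeasure J (?A \<times> {x\<in>space N. u x \<le> t})"
      using c by (simp add: N.emeasure_eq_measure J.emeasure_eq_measure ennreal_mult[symmetric] ennreal_leI)
  qed
  let ?p = "\<lambda>x. max 0 (g x - a)" and ?q = "\<lambda>x. max 0 (a - g x)"
  have sets_eq: "{x\<in>space N. 0 < ?p x} = {x\<in>space N. a < g x}" "{x\<in>space N. 0 < ?q x} = {x\<in>space N. g x < a}"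
    by auto
  have P: "ennreal (c\<^sup>2 / (4 * b)) * (\<integral>\<^sup>+x. ennreal ((?p x)\<^sup>2) \<partial>N)
    \<le> (\<integral>\<^sup>+z. ennreal ((?p (fst z) - ?p (snd z))\<^sup>2) \<partial>J)"
    using a(1) by (intro part) (auto simp: sets_eq)
  have Q: "ennreal (c\<^sup>2 / (4 * b)) * (\<integral>\<^sup>+x. ennreal ((?q x)\<^sup>2) \<partial>N)
    \<le> (\<integral>\<^sup>+z. ennreal ((?q (fst z) - ?q (snd z))\<^sup>2) \<partial>J)"
    using a(2) by (intro part) (auto simp: sets_eq)
  have "(\<integral>\<^sup>+x. ennreal ((g x - a)\<^sup>2) \<partial>N) = (\<integral>\<^sup>+x. ennreal ((?p x)\<^sup>2) + ennreal ((?q x)\<^sup>2) \<partial>N)"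
    by (intro nn_integral_cong) (auto simp: max_def power2_commute)
  also have "\<dots> = (\<integral>\<^sup>+x. ennreal ((?p x)\<^sup>2) \<partial>N) + (\<integral>\<^sup>+x. ennreal ((?q x)\<^sup>2) \<partial>N)"
    by (intro nn_integral_add) auto
  finally have "ennreal (c\<^sup>2 / (4 * b)) * (\<integral>\<^sup>+x. ennreal ((g x - a)\<^sup>2) \<partial>N) =
    ennreal (c\<^sup>2 / (4 * b)) * (\<integral>\<^sup>+x. ennreal ((?p x)\<^sup>2) \<partial>N) + ennreal (c\<^sup>2 / (4 * b)) * (\<integral>\<^sup>+x. ennreal ((?q
        x)\<^sup>2) \<partial>N)"
    by (simp add: distrib_left)
  also have "\<dots> \<le> (\<integral>\<^sup>+z. ennreal ((?p (fst z) - ?p (snd z))\<^sup>2) \<partial>J) + (\<integral>\<^sup>+z. ennreal ((?q (fst z) - ?q (snd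
      z))\<^sup>2) \<partial>J)"
    by (intro add_mono P Q)
  also have "\<dots> = (\<integral>\<^sup>+z. ennreal ((?p (fst z) - ?p (snd z))\<^sup>2) + ennreal ((?q (fst z) - ?q (snd z))\<^sup>2) \<partial>J)"
    by (intro nn_integral_add[symmetric]) auto
  also have "\<dots> \<le> (\<integral>\<^sup>+z. ennreal ((g (fst z) - g (snd z))\<^sup>2) \<partial>J)"
  proof (rule nn_integral_mono)
    fix z
    have *: "(max 0 p - max 0 q)\<^sup>2 + (max 0 (- p) - max 0 (- q))\<^sup>2 \<le> (p - q)\<^sup>2" for p q :: real
    proof -
      have "0 \<le> p * (- q)" if "0 \<le> p" "q \<le> 0" using that by (intro mult_nonneg_nonneg) auto
      moreover have "0 \<le> (- p) * q" if "p \<le> 0" "0 \<le> q" using that by (intro mult_nonneg_nonneg) auto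
      ultimately show ?thesis
        by (cases "0 \<le> p"; cases "0 \<le> q") (auto simp: max_def power2_eq_square algebra_simps)
    qed
    have "(?p (fst z) - ?p (snd z))\<^sup>2 + (?q (fst z) - ?q (snd z))\<^sup>2 \<le> (g (fst z) - g (snd z))\<^sup>2"
      using *[of "g (fst z) - a" "g (snd z) - a"] by simp
    then show "ennreal ((?p (fst z) - ?p (snd z))\<^sup>2) + ennreal ((?q (fst z) - ?q (snd z))\<^sup>2) \<le> ennreal ((g
        (fst z) - g (snd z))\<^sup>2)"
      by (simp add: ennreal_plus[symmetric] ennreal_leI del: ennreal_plus)
  qed
  finally show thesis by (rule that)
qed

section \<open>Spectral gap of reversible walks\<close>

text \<open>A walk on the points of \<open>N\<close> whose edges lead from \<open>x\<close> to \<open>t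
  i x\<close> with weight \<open>w i x\<close>. Reversibility says that the measure that the edges put
  on pairs of points is invariant under exchanging the two ends. It is required for the sum over
  \<open>I\<close> only, so that an edge may be reversed by one with a different index.\<close>

locale reversible_walk = finite_measure N
  for N :: "'a measure" +
  fixes I :: "'i set" and t :: "'i \<Rightarrow> 'a \<Rightarrow> 'a" and w :: "'i \<Rightarrow> 'a \<Rightarrow> real"
  assumes finite_I: "finite I" and I_ne: "I \<noteq> {}"
    and t_measurable: "\<And>i. i \<in> I \<Longrightarrow> t i \<in> measurable N N"
    and w_measurable: "\<And>i. i \<in> I \<Longrightarrow> w i \<in> borel_measurable N"
    and w_nonneg: "\<And>i x. i \<in> I \<Longrightarrow> 0 \<le> w i x" and w_le_1: "\<And>i x. i \<in> I \<Longrightarrow> w i x \<le> 1"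
    and reversible: "\<And>f. f \<in> borel_measurable (N \<Otimes>\<^sub>M N) \<Longrightarrow>
      (\<Sum>i\<in>I. \<integral>\<^sup>+x. ennreal (w i x) * f (x, t i x) \<partial>N) = (\<Sum>i\<in>I. \<integral>\<^sup>+x. ennreal (w i x) * f (t i x, x) \<partial>N)"
begin

definition edge_measure :: "('a \<times> 'a) measure" where
  "edge_measure = distr (density (count_space I \<Otimes>\<^sub>M N) (\<lambda>(i, x). ennreal (w i x))) (N \<Otimes>\<^sub>M N) (\<lambda>(i, x). (x, t i
      x))"

lemma nn_integral_edge_measure:
  assumes f: "f \<in> borel_measurable (N \<Otimes>\<^sub>M N)"
  shows "(\<integral>\<^sup>+z. f z \<partial>edge_measure) = (\<Sum>i\<in>I. \<integral>\<^sup>+x. ennreal (w i x) * f (x, t i x) \<partial>N)"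
proof -
  interpret C: sigma_finite_measure "count_space I" by (rule sigma_finite_measure_count_space_finite[OF
      finite_I])
  have ci: "countable I" using finite_I by (rule countable_finite)
  have mt: "(\<lambda>(i, x). (x, t i x)) \<in> measurable (count_space I \<Otimes>\<^sub>M N) (N \<Otimes>\<^sub>M N)"
    by (rule measurable_pair_measure_countable1[OF ci]) (use t_measurable in auto)
  have mw: "(\<lambda>(i, x). ennreal (w i x)) \<in> borel_measurable (count_space I \<Otimes>\<^sub>M N)"
    by (rule measurable_pair_measure_countable1[OF ci]) (use w_measurable in auto)
  have mf: "(\<lambda>(i, x). f (x, t i x)) \<in> borel_measurable (count_space I \<Otimes>\<^sub>M N)"
    using measurable_compose[OF mt f] by (simp add: case_prod_beta')
  have "(\<integral>\<^sup>+z. f z \<partial>edge_measure) =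
      (\<integral>\<^sup>+p. f (case p of (i, x) \<Rightarrow> (x, t i x)) \<partial>density (count_space I \<Otimes>\<^sub>M N) (\<lambda>(i, x). ennreal (w i x)))"
    unfolding edge_measure_def using mt f by (intro nn_integral_distr) auto
  also have "\<dots> = (\<integral>\<^sup>+p. (case p of (i, x) \<Rightarrow> ennreal (w i x)) * f (case p of (i, x) \<Rightarrow> (x, t i x)) \<partial>(count_space
      I \<Otimes>\<^sub>M N))"
    using mf by (intro nn_integral_density mw) (simp add: case_prod_beta')
  also have "\<dots> = (\<integral>\<^sup>+i. \<integral>\<^sup>+x. ennreal (w i x) * f (x, t i x) \<partial>N \<partial>count_space I)"
    using mw mf by (subst nn_integral_fst[symmetric]) (auto simp: case_prod_beta')
  also have "\<dots> = (\<Sum>i\<in>I. \<integral>\<^sup>+x. ennreal (w i x) * f (x, t i x) \<partial>N)"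
    using finite_I by (rule nn_integral_count_space_finite)
  finally show ?thesis .
qed

lemma sets_edge_measure: "sets edge_measure = sets (N \<Otimes>\<^sub>M N)"
  by (simp add: edge_measure_def)

lemma emeasure_edge_measure:
  assumes "A \<in> sets N" "B \<in> sets N"
  shows "emeasure edge_measure (A \<times> B) = (\<Sum>i\<in>I. \<integral>\<^sup>+x. ennreal (w i x) * (indicator A x * indicator B (t i x))
      \<partial>N)"
proof -
  have "A \<times> B \<in> sets (N \<Otimes>\<^sub>M N)" using assms by simp
  then have "emeasure edge_measure (A \<times> B) = (\<integral>\<^sup>+z. indicator (A \<times> B) z \<partial>edge_measure)"
    by (simp add: sets_edge_measure)
  also have "\<dots> = (\<Sum>i\<in>I. \<integral>\<^sup>+x. ennreal (w i x) * indicator (A \<times> B) (x, t i x) \<partial>N)"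
    using assms by (intro nn_integral_edge_measure) auto
  finally show ?thesis by (simp add: indicator_times)
qed

lemma emeasure_edge_measure_swap:
  assumes "A \<in> sets N" "B \<in> sets N"
  shows "emeasure edge_measure (A \<times> B) = emeasure edge_measure (B \<times> A)"
proof -
  have "(\<lambda>z. indicator A (fst z) * indicator B (snd z) :: ennreal) \<in> borel_measurable (N \<Otimes>\<^sub>M N)"
    using assms by measurable
  from reversible[OF this] show ?thesis
    using assms by (simp add: emeasure_edge_measure mult_ac)
qed

lemma nn_integral_edge_fst:
  assumes f: "f \<in> borel_measurable N"
  shows "(\<integral>\<^sup>+z. f (fst z) \<partial>edge_measure) \<le> ennreal (card I) * (\<integral>\<^sup>+x. f x \<partial>N)"
proof -
  note [measurable] = f
  have "(\<integral>\<^sup>+z. f (fst z) \<partial>edge_measure) = (\<Sum>i\<in>I. \<integral>\<^sup>+x. ennreal (w i x) * f x \<partial>N)"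
    by (subst nn_integral_edge_measure) auto
  also have "\<dots> \<le> (\<Sum>i\<in>I. \<integral>\<^sup>+x. f x \<partial>N)"
  proof (intro sum_mono nn_integral_mono)
    fix i x assume "i \<in> I"
    then have "ennreal (w i x) \<le> 1" using w_le_1 by (simp add: ennreal_le_1)
    then show "ennreal (w i x) * f x \<le> f x" using mult_right_mono[of "ennreal (w i x)" 1 "f x"] by simp
  qed
  finally show ?thesis by (simp add: ennreal_of_nat_eq_real_of_nat)
qed

lemma nn_integral_edge_snd_eq:
  assumes f: "f \<in> borel_measurable N"
  shows "(\<integral>\<^sup>+z. f (snd z) \<partial>edge_measure) = (\<integral>\<^sup>+z. f (fst z) \<partial>edge_measure)"
proof -
  note [measurable] = f
  show ?thesis
    using reversible[of "\<lambda>z. f (fst z)"] by (subst (1 2) nn_integral_edge_measure) auto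
qed

lemma finite_edge_measure: "finite_measure edge_measure"
proof
  have "emeasure edge_measure (space edge_measure) = (\<integral>\<^sup>+z. 1 \<partial>edge_measure)" by simp
  also have "\<dots> \<le> ennreal (card I) * (\<integral>\<^sup>+x. 1 \<partial>N)" by (rule nn_integral_edge_fst[of "\<lambda>_. 1"]) simp
  also have "\<dots> < \<infinity>" by (simp add: ennreal_mult_less_top emeasure_eq_measure)
  finally show "emeasure edge_measure (space edge_measure) \<noteq> \<infinity>" by simp
qed

definition laplacian :: "('a \<Rightarrow> complex) \<Rightarrow> 'a \<Rightarrow> complex" where
  "laplacian g x = (\<Sum>i\<in>I. of_real (w i x) * (g x - g (t i x)))"

text \<open>The factor makes the walk lazy: it is \<open>1\<close> minus half of the average of
  \<open>card I\<close> differences, which keeps it a contraction whose energy loss can be read off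
  pointwise.\<close>

definition walk :: "('a \<Rightarrow> complex) \<Rightarrow> 'a \<Rightarrow> complex" where
  "walk g x = g x - of_real (1 / (2 * card I)) * laplacian g x"

definition energy :: "('a \<Rightarrow> complex) \<Rightarrow> real" where
  "energy g = (\<integral>x. (\<Sum>i\<in>I. w i x * (cmod (g x - g (t i x)))\<^sup>2) \<partial>N)"

lemma walk_diff_const: "walk (\<lambda>x. g x - c) x = walk g x - c"
  by (simp add: walk_def laplacian_def)

lemma card_pos: "0 < real (card I)"
  using finite_I I_ne by (simp add: card_gt_0_iff)

lemma measurable_translate: "i \<in> I \<Longrightarrow> g \<in> borel_measurable N \<Longrightarrow> (\<lambda>x. g (t i x)) \<in> borel_measurable N"
  using measurable_compose[OF t_measurable] by blast

lemma laplacian_measurable: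
  assumes "g \<in> borel_measurable N" shows "laplacian g \<in> borel_measurable N"
  unfolding laplacian_def using assms w_measurable measurable_translate
  by (intro borel_measurable_sum borel_measurable_times borel_measurable_diff borel_measurable_of_real) auto

lemma walk_measurable: "g \<in> borel_measurable N \<Longrightarrow> walk g \<in> borel_measurable N"
  unfolding walk_def by (intro borel_measurable_diff borel_measurable_times laplacian_measurable) auto

lemma weighted_integrable:
  assumes g: "g \<in> L2 N" and i: "i \<in> I"
  shows "integrable N (\<lambda>x. w i x * (cmod (g x))\<^sup>2)" "integrable N (\<lambda>x. w i x * (cmod (g (t i x)))\<^sup>2)"
    "integrable N (\<lambda>x. w i x * (cmod (g x - g (t i x)))\<^sup>2)"
proof -
  note [measurable] = L2_measurable[OF g] w_measurable[OF i] measurable_translate[OF i L2_measurable[OF g]]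
  show 1: "integrable N (\<lambda>x. w i x * (cmod (g x))\<^sup>2)"
    by (rule Bochner_Integration.integrable_bound[OF L2_integrable[OF g]])
      (use i in \<open>auto simp: abs_mult w_nonneg w_le_1 mult_left_le_one_le\<close>)
  show 2: "integrable N (\<lambda>x. w i x * (cmod (g (t i x)))\<^sup>2)"
  proof (rule integrableI_bounded)
    have "(\<integral>\<^sup>+x. ennreal (norm (w i x * (cmod (g (t i x)))\<^sup>2)) \<partial>N)
        = (\<integral>\<^sup>+x. ennreal (w i x) * ennreal ((cmod (g (t i x)))\<^sup>2) \<partial>N)"
      using i by (intro nn_integral_cong) (simp add: abs_mult w_nonneg ennreal_mult)
    also have "\<dots> \<le> (\<Sum>i\<in>I. \<integral>\<^sup>+x. ennreal (w i x) * ennreal ((cmod (g (t i x)))\<^sup>2) \<partial>N)"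
      using i finite_I by (intro member_le_sum) auto
    also have "\<dots> = (\<integral>\<^sup>+z. ennreal ((cmod (g (snd z)))\<^sup>2) \<partial>edge_measure)"
      by (subst nn_integral_edge_measure) auto
    also have "\<dots> = (\<integral>\<^sup>+z. ennreal ((cmod (g (fst z)))\<^sup>2) \<partial>edge_measure)"
      by (rule nn_integral_edge_snd_eq[of "\<lambda>x. ennreal ((cmod (g x))\<^sup>2)"]) measurable
    also have "\<dots> \<le> ennreal (card I) * (\<integral>\<^sup>+x. ennreal ((cmod (g x))\<^sup>2) \<partial>N)"
      by (rule nn_integral_edge_fst) measurable
    also have "\<dots> < \<infinity>" using g by (simp add: L2_iff_nn_integral ennreal_mult_less_top)
    finally show "(\<integral>\<^sup>+x. ennreal (norm (w i x * (cmod (g (t i x)))\<^sup>2)) \<partial>N) < \<infinity>" .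
  qed measurable
  have "integrable N (\<lambda>x. 2 * (w i x * (cmod (g x))\<^sup>2) + 2 * (w i x * (cmod (g (t i x)))\<^sup>2))"
    using 1 2 by simp
  then show "integrable N (\<lambda>x. w i x * (cmod (g x - g (t i x)))\<^sup>2)"
  proof (rule Bochner_Integration.integrable_bound)
    have "w i x * (cmod (g x - g (t i x)))\<^sup>2 \<le> 2 * (w i x * (cmod (g x))\<^sup>2) + 2 * (w i x * (cmod (g (t i
        x)))\<^sup>2)" for x
      using mult_left_mono[OF cmod_add_square_le[of "g x" "- g (t i x)"] w_nonneg[OF i, of x]]
      by (simp add: algebra_simps)
    then show "AE x in N. norm (w i x * (cmod (g x - g (t i x)))\<^sup>2)
        \<le> norm (2 * (w i x * (cmod (g x))\<^sup>2) + 2 * (w i x * (cmod (g (t i x)))\<^sup>2))"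
      using w_nonneg[OF i] by (intro AE_I2) (simp add: abs_mult)
  qed measurable
qed

text \<open>Reversibility applied to \<open>|g(x)|\<^sup>2\<close>, a function of the first coordinate
  only.\<close>

lemma stationary:
  assumes g: "g \<in> L2 N"
  shows "(\<integral>x. (\<Sum>i\<in>I. w i x * (cmod (g x))\<^sup>2) \<partial>N) = (\<integral>x. (\<Sum>i\<in>I. w i x * (cmod (g (t i x)))\<^sup>2) \<partial>N)"
proof -
  note [measurable] = L2_measurable[OF g]
  have *: "ennreal (\<integral>x. (\<Sum>i\<in>I. w i x * k i x) \<partial>N) = (\<Sum>i\<in>I. \<integral>\<^sup>+x. ennreal (w i x) * ennreal (k i x) \<partial>N)"
    if "\<And>i. i \<in> I \<Longrightarrow> integrable N (\<lambda>x. w i x * k i x)" "\<And>i x. 0 \<le> k i x" for k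
  proof -
    have "(\<integral>\<^sup>+x. ennreal (w i x) * ennreal (k i x) \<partial>N) = ennreal (\<integral>x. w i x * k i x \<partial>N)" if i: "i \<in> I" for i
      using that \<open>\<And>i x. 0 \<le> k i x\<close> w_nonneg[OF i] \<open>\<And>i. i \<in> I \<Longrightarrow> integrable N (\<lambda>x. w i x * k i x)\<close>
      by (subst nn_integral_eq_integral[symmetric]) (auto simp: ennreal_mult)
    then have "(\<Sum>i\<in>I. \<integral>\<^sup>+x. ennreal (w i x) * ennreal (k i x) \<partial>N) = (\<Sum>i\<in>I. ennreal (\<integral>x. w i x * k i x \<partial>N))"
      by simp
    also have "\<dots> = ennreal (\<Sum>i\<in>I. \<integral>x. w i x * k i x \<partial>N)"
      using that w_nonneg by (intro sum_ennreal integral_nonneg_AE) auto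
    finally show ?thesis using that by (simp add: Bochner_Integration.integral_sum)
  qed
  have "ennreal (\<integral>x. (\<Sum>i\<in>I. w i x * (cmod (g x))\<^sup>2) \<partial>N) = ennreal (\<integral>x. (\<Sum>i\<in>I. w i x * (cmod (g (t i x)))\<^sup>2) \<partial>N)"
    using weighted_integrable[OF g] reversible[of "\<lambda>z. ennreal ((cmod (g (fst z)))\<^sup>2)"]
    by (subst (1 2) *) auto
  then show ?thesis
    using w_nonneg by (subst (asm) ennreal_inj) (auto intro!: integral_nonneg_AE sum_nonneg AE_I2)
qed

text \<open>Write the walk as \<open>g - k \<Delta>g\<close> with \<open>k = 1/(2n)\<close>.
  Polarisation gives \<open>2 Re (\<Delta>g conj(g)) = S + A - B\<close>, where \<open>S\<close> is the
  local energy and \<open>A - B\<close> integrates to \<open>0\<close> by stationarity, and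
  Cauchy--Schwarz over the \<open>n\<close> edges gives \<open>|\<Delta>g|\<^sup>2 \<le> n S\<close>.
  The choice of \<open>k\<close> leaves \<open>- k S + k\<^sup>2 n S = - S/(4n)\<close>.\<close>

lemma walk_pointwise:
  "(cmod (walk g x))\<^sup>2 \<le> (cmod (g x))\<^sup>2 - 1 / (4 * card I) * (\<Sum>i\<in>I. w i x * (cmod (g x - g (t i x)))\<^sup>2)
    - 1 / (2 * card I) * ((\<Sum>i\<in>I. w i x * (cmod (g x))\<^sup>2) - (\<Sum>i\<in>I. w i x * (cmod (g (t i x)))\<^sup>2))"
proof -
  define n where "n = real (card I)"
  define k where "k = 1 / (2 * n)"
  have n: "0 < n" using card_pos by (simp add: n_def)
  let ?D = "laplacian g x"
  let ?S = "\<Sum>i\<in>I. w i x * (cmod (g x - g (t i x)))\<^sup>2"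
  let ?A = "\<Sum>i\<in>I. w i x * (cmod (g x))\<^sup>2" and ?B = "\<Sum>i\<in>I. w i x * (cmod (g (t i x)))\<^sup>2"
  have sq: "(cmod (a - b))\<^sup>2 = (cmod a)\<^sup>2 + (cmod b)\<^sup>2 - 2 * Re (b * cnj a)" for a b
    unfolding cmod_power2 by (simp add: power2_eq_square algebra_simps)
  have "2 * Re (of_real w * (a - b) * cnj a) = w * (cmod (a - b))\<^sup>2 + w * (cmod a)\<^sup>2 - w * (cmod b)\<^sup>2"
    for w :: real and a b :: complex
    unfolding cmod_power2 by (simp add: power2_eq_square algebra_simps)
  then have "2 * Re (?D * cnj (g x)) = ?S + ?A - ?B"
    unfolding laplacian_def sum_distrib_right Re_sum sum_distrib_left
    by (simp only: sum.distrib[symmetric] sum_subtractf[symmetric])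
  moreover have "(cmod ?D)\<^sup>2 \<le> n * ?S"
  proof -
    have "(cmod ?D)\<^sup>2 \<le> (\<Sum>i\<in>I. w i x * cmod (g x - g (t i x)))\<^sup>2"
      unfolding laplacian_def using w_nonneg
      by (intro power_mono order_trans[OF norm_sum] sum_mono) (auto simp: norm_mult)
    also have "\<dots> \<le> n * (\<Sum>i\<in>I. (w i x * cmod (g x - g (t i x)))\<^sup>2)"
      unfolding n_def using arith_geo_mean_sqrt[of 1 1] Cauchy_Schwarz_ineq_sum[of "\<lambda>_. 1" _ I] by simp
    also have "\<dots> \<le> n * ?S"
    proof (intro mult_left_mono sum_mono)
      fix i assume i: "i \<in> I"
      have "(w i x)\<^sup>2 \<le> w i x" using w_nonneg[OF i, of x] w_le_1[OF i, of x]
        by (simp add: power2_eq_square mult_left_le_one_le)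
      then show "(w i x * cmod (g x - g (t i x)))\<^sup>2 \<le> w i x * (cmod (g x - g (t i x)))\<^sup>2"
        unfolding power_mult_distrib by (rule mult_right_mono) simp
    qed (use n in simp)
    finally show ?thesis .
  qed
  then have "k\<^sup>2 * (cmod ?D)\<^sup>2 \<le> k\<^sup>2 * (n * ?S)" by (rule mult_left_mono) simp
  moreover have "k\<^sup>2 * (n * ?S) = 1 / (4 * n) * ?S" using n by (simp add: k_def power2_eq_square field_simps)
  moreover have "(cmod (walk g x))\<^sup>2 = (cmod (g x))\<^sup>2 + k\<^sup>2 * (cmod ?D)\<^sup>2 - k * (2 * Re (?D * cnj (g x)))"
  proof -
    have wk: "walk g x = g x - of_real k * ?D" by (simp add: walk_def k_def n_def)
    show ?thesis unfolding wk sq by (simp add: norm_mult power_mult_distrib algebra_simps)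
  qed
  ultimately have "(cmod (walk g x))\<^sup>2 \<le> (cmod (g x))\<^sup>2 + 1 / (4 * n) * ?S - k * (?S + ?A - ?B)" by simp
  also have "\<dots> = (cmod (g x))\<^sup>2 - 1 / (4 * n) * ?S - k * (?A - ?B)"
    using n by (simp add: k_def field_simps)
  finally show ?thesis by (simp add: n_def k_def)
qed

lemma walk_L2:
  assumes g: "g \<in> L2 N"
  shows "walk g \<in> L2 N" "(L2_norm N (walk g))\<^sup>2 \<le> (L2_norm N g)\<^sup>2 - 1 / (4 * card I) * energy g"
proof -
  let ?r = "\<lambda>x. (cmod (g x))\<^sup>2 - 1 / (4 * card I) * (\<Sum>i\<in>I. w i x * (cmod (g x - g (t i x)))\<^sup>2)
    - 1 / (2 * card I) * ((\<Sum>i\<in>I. w i x * (cmod (g x))\<^sup>2) - (\<Sum>i\<in>I. w i x * (cmod (g (t i x)))\<^sup>2))"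
  note int = L2_integrable[OF g] weighted_integrable[OF g]
  have r: "integrable N ?r"
    using int by (intro Bochner_Integration.integrable_diff integrable_mult_right
        Bochner_Integration.integrable_sum) auto
  have pos: "0 \<le> ?r x" for x using walk_pointwise[of g x] zero_le_power2[of "cmod (walk g x)"] by linarith
  have "integrable N (\<lambda>x. (cmod (walk g x))\<^sup>2)"
    using walk_measurable[OF L2_measurable[OF g]] walk_pointwise pos
    by (intro Bochner_Integration.integrable_bound[OF r]) auto
  then show L: "walk g \<in> L2 N" using walk_measurable[OF L2_measurable[OF g]] by (simp add: L2_def)
  have "(L2_norm N (walk g))\<^sup>2 \<le> (\<integral>x. ?r x \<partial>N)"
    unfolding L2_norm_square using walk_pointwise by (intro integral_mono L2_integrable L r)
  also have "\<dots> = (\<integral>x. (cmod (g x))\<^sup>2 \<partial>N) - 1 / (4 * card I) * (\<integral>x. (\<Sum>i\<in>I. w i x * (cmod (g x - g (t i x)))\<^sup>2)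
      \<partial>N)
    - 1 / (2 * card I) * ((\<integral>x. (\<Sum>i\<in>I. w i x * (cmod (g x))\<^sup>2) \<partial>N) - (\<integral>x. (\<Sum>i\<in>I. w i x * (cmod (g (t i x)))\<^sup>2)
        \<partial>N))"
    using int by (subst Bochner_Integration.integral_diff Bochner_Integration.integral_mult_right
        | intro Bochner_Integration.integrable_diff integrable_mult_right Bochner_Integration.integrable_sum |
            simp only:)+
  finally show "(L2_norm N (walk g))\<^sup>2 \<le> (L2_norm N g)\<^sup>2 - 1 / (4 * card I) * energy g"
    by (simp add: stationary[OF g] L2_norm_square energy_def)
qed

lemma const_in_L2: "(\<lambda>x. c) \<in> L2 N"
  by (simp add: L2_def)

lemma L2_integrable_finite:
  assumes "g \<in> L2 N" shows "integrable N g"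
  using L2_integrable_inner[OF assms const_in_L2[of 1]] by simp

text \<open>Stationarity for \<open>g\<close> and for \<open>g + d\<close> differ by \<open>2 Re\<close>
  of the integral of \<open>\<Delta>g\<close> times the conjugate of \<open>d\<close>. Taking for
  \<open>d\<close> the integral of \<open>\<Delta>g\<close> itself shows that this integral vanishes.\<close>

lemma integral_laplacian:
  assumes g: "g \<in> L2 N"
  shows "integrable N (laplacian g)" "(\<integral>x. laplacian g x \<partial>N) = 0"
proof -
  have "laplacian g x = of_real (2 * card I) * (g x - walk g x)" for x
    using card_pos by (simp add: walk_def)
  then show int: "integrable N (laplacian g)"
    using L2_integrable_finite[OF walk_L2(1)[OF g]] L2_integrable_finite[OF g]
    by (subst Bochner_Integration.integrable_cong[OF refl, of N "laplacian g" "\<lambda>x. of_real (2 * card I) * (g x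
        - walk g x)"]) auto
  define d where "d = (\<integral>x. laplacian g x \<partial>N)"
  have gd: "(\<lambda>x. g x + d) \<in> L2 N" by (intro L2_add g const_in_L2)
  let ?f = "\<lambda>g x. (\<Sum>i\<in>I. w i x * (cmod (g x))\<^sup>2) - (\<Sum>i\<in>I. w i x * (cmod (g (t i x)))\<^sup>2)"
  have i0: "integrable N (?f h)" "(\<integral>x. ?f h x \<partial>N) = 0" if "h \<in> L2 N" for h
    using stationary[OF that] weighted_integrable[OF that]
    by (simp_all add: Bochner_Integration.integral_diff Bochner_Integration.integrable_sum)
  have "2 * Re (laplacian g x * cnj d) = ?f (\<lambda>x. g x + d) x - ?f g x" for x
  proof -
    have "2 * Re (of_real w * (a - b) * cnj d) = (w * (cmod (a + d))\<^sup>2 - w * (cmod (b + d))\<^sup>2) - (w * (cmod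
        a)\<^sup>2 - w * (cmod b)\<^sup>2)"
      for w :: real and a b :: complex
      unfolding cmod_power2 by (simp add: power2_eq_square algebra_simps)
    then show ?thesis
      unfolding laplacian_def sum_distrib_right Re_sum sum_distrib_left by (simp only: sum_subtractf)
  qed
  then have "(\<integral>x. 2 * Re (laplacian g x * cnj d) \<partial>N) = (\<integral>x. ?f (\<lambda>x. g x + d) x - ?f g x \<partial>N)" by presburger
  also have "\<dots> = 0" using i0[OF gd] i0[OF g] by (subst Bochner_Integration.integral_diff) auto
  finally have "Re (d * cnj d) = 0" using int by (simp add: d_def[symmetric] del: times_complex.sel)
  then show "(\<integral>x. laplacian g x \<partial>N) = 0" by (simp add: d_def[symmetric] complex_mult_cnj cmod_power2[symmetric])
qed

lemma integral_walk:
  assumes g: "g \<in> L2 N"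
  shows "(\<integral>x. walk g x \<partial>N) = (\<integral>x. g x \<partial>N)"
  using integral_laplacian[OF g] L2_integrable_finite[OF g] unfolding walk_def by simp

lemma energy_eq_nn_integral:
  assumes g: "g \<in> L2 N"
  shows "ennreal (energy g) = (\<integral>\<^sup>+z. ennreal ((cmod (g (fst z) - g (snd z)))\<^sup>2) \<partial>edge_measure)"
proof -
  note [measurable] = L2_measurable[OF g]
  have "(\<integral>\<^sup>+z. ennreal ((cmod (g (fst z) - g (snd z)))\<^sup>2) \<partial>edge_measure) =
     (\<Sum>i\<in>I. \<integral>\<^sup>+x. ennreal (w i x) * ennreal ((cmod (g x - g (t i x)))\<^sup>2) \<partial>N)"
    by (subst nn_integral_edge_measure) auto
  also have "\<dots> = (\<Sum>i\<in>I. ennreal (\<integral>x. w i x * (cmod (g x - g (t i x)))\<^sup>2 \<partial>N))"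
  proof (rule sum.cong[OF refl])
    fix i assume i: "i \<in> I"
    show "(\<integral>\<^sup>+x. ennreal (w i x) * ennreal ((cmod (g x - g (t i x)))\<^sup>2) \<partial>N) = ennreal (\<integral>x. w i x * (cmod (g x
        - g (t i x)))\<^sup>2 \<partial>N)"
      using weighted_integrable(3)[OF g i] w_nonneg[OF i]
      by (subst nn_integral_eq_integral[symmetric]) (auto simp: ennreal_mult)
  qed
  also have "\<dots> = ennreal (\<Sum>i\<in>I. \<integral>x. w i x * (cmod (g x - g (t i x)))\<^sup>2 \<partial>N)"
    using w_nonneg by (intro sum_ennreal integral_nonneg_AE) auto
  also have "\<dots> = ennreal (energy g)"
    unfolding energy_def using weighted_integrable(3)[OF g] by (simp add: Bochner_Integration.integral_sum)
  finally show ?thesis by simp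
qed

text \<open>The inequality for real functions is applied to the real and the imaginary part of
  \<open>g\<close>, with medians \<open>a\<close> and \<open>b\<close>. Since \<open>g\<close> has mean
  \<open>0\<close>, subtracting the constant \<open>a + i b\<close> can only increase its norm.\<close>

lemma spectral_gap:
  assumes c: "0 < c"
    and exp: "\<And>A. A \<in> sets N \<Longrightarrow> measure N A \<le> measure N (space N) / 2 \<Longrightarrow>
      c * measure N A \<le> measure edge_measure (A \<times> (space N - A))"
    and g: "g \<in> L2 N" and mean: "(\<integral>x. g x \<partial>N) = 0"
  shows "c\<^sup>2 / (4 * card I) * (L2_norm N g)\<^sup>2 \<le> energy g"
proof -
  note [measurable] = L2_measurable[OF g]
  have [measurable]: "fst \<in> measurable edge_measure N" "snd \<in> measurable edge_measure N"
    by (simp_all cong: measurable_cong_sets add: sets_edge_measure)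
  define l where "l = c\<^sup>2 / (4 * real (card I))"
  have l: "0 \<le> l" by (simp add: l_def)
  have fin: "(\<integral>\<^sup>+x. ennreal ((cmod (g x))\<^sup>2) \<partial>N) < \<infinity>" using g by (simp add: L2_iff_nn_integral)
  have finRe: "(\<integral>\<^sup>+x. ennreal ((Re (g x))\<^sup>2) \<partial>N) < \<infinity>"
    by (rule le_less_trans[OF nn_integral_mono fin]) (auto simp: cmod_power2 ennreal_leI)
  have finIm: "(\<integral>\<^sup>+x. ennreal ((Im (g x))\<^sup>2) \<partial>N) < \<infinity>"
    by (rule le_less_trans[OF nn_integral_mono fin]) (auto simp: cmod_power2 ennreal_leI)
  have m2: "(\<integral>\<^sup>+z. f (snd z) \<partial>edge_measure) \<le> ennreal (card I) * (\<integral>\<^sup>+x. f x \<partial>N)"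
    if "f \<in> borel_measurable N" for f
    using nn_integral_edge_fst[OF that] nn_integral_edge_snd_eq[OF that] by simp
  note P = Poincare_inequality_median[OF finite_measure_axioms finite_edge_measure sets_edge_measure card_pos
      nn_integral_edge_fst m2 c exp, folded l_def]
  obtain a where a: "ennreal l * (\<integral>\<^sup>+x. ennreal ((Re (g x) - a)\<^sup>2) \<partial>N)
    \<le> (\<integral>\<^sup>+z. ennreal ((Re (g (fst z)) - Re (g (snd z)))\<^sup>2) \<partial>edge_measure)"
    by (rule P[of "\<lambda>x. Re (g x)"]) (use finRe in auto)
  obtain b where b: "ennreal l * (\<integral>\<^sup>+x. ennreal ((Im (g x) - b)\<^sup>2) \<partial>N)
    \<le> (\<integral>\<^sup>+z. ennreal ((Im (g (fst z)) - Im (g (snd z)))\<^sup>2) \<partial>edge_measure)"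
    by (rule P[of "\<lambda>x. Im (g x)"]) (use finIm in auto)
  define d where "d = Complex a b"
  have gd: "(\<lambda>x. g x - d) \<in> L2 N" by (intro L2_diff g const_in_L2)
  have "ennreal l * ennreal ((L2_norm N (\<lambda>x. g x - d))\<^sup>2) = ennreal l * (\<integral>\<^sup>+x. ennreal ((cmod (g x - d))\<^sup>2) \<partial>N)"
    by (simp add: nn_integral_eq_L2_norm[OF gd])
  also have "(\<integral>\<^sup>+x. ennreal ((cmod (g x - d))\<^sup>2) \<partial>N) =
      (\<integral>\<^sup>+x. ennreal ((Re (g x) - a)\<^sup>2) + ennreal ((Im (g x) - b)\<^sup>2) \<partial>N)"
    by (intro nn_integral_cong) (simp add: cmod_power2 d_def ennreal_plus[symmetric] del: ennreal_plus)
  also have "\<dots> = (\<integral>\<^sup>+x. ennreal ((Re (g x) - a)\<^sup>2) \<partial>N) + (\<integral>\<^sup>+x. ennreal ((Im (g x) - b)\<^sup>2) \<partial>N)"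
    by (intro nn_integral_add) auto
  also have "ennreal l * \<dots> \<le> (\<integral>\<^sup>+z. ennreal ((Re (g (fst z)) - Re (g (snd z)))\<^sup>2) \<partial>edge_measure)
    + (\<integral>\<^sup>+z. ennreal ((Im (g (fst z)) - Im (g (snd z)))\<^sup>2) \<partial>edge_measure)"
    unfolding distrib_left by (intro add_mono a b)
  also have "\<dots> = (\<integral>\<^sup>+z. ennreal ((Re (g (fst z)) - Re (g (snd z)))\<^sup>2) + ennreal ((Im (g (fst z)) - Im (g (snd
      z)))\<^sup>2) \<partial>edge_measure)"
    by (intro nn_integral_add[symmetric]) auto
  also have "\<dots> = (\<integral>\<^sup>+z. ennreal ((cmod (g (fst z) - g (snd z)))\<^sup>2) \<partial>edge_measure)"
    by (intro nn_integral_cong) (simp add: cmod_power2 ennreal_plus[symmetric] del: ennreal_plus)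
  also have "\<dots> = ennreal (energy g)" by (rule energy_eq_nn_integral[OF g, symmetric])
  finally have "ennreal (l * (L2_norm N (\<lambda>x. g x - d))\<^sup>2) \<le> ennreal (energy g)"
    using l by (simp add: ennreal_mult)
  moreover have "0 \<le> energy g"
    unfolding energy_def using w_nonneg by (intro integral_nonneg_AE AE_I2 sum_nonneg) auto
  ultimately have e: "l * (L2_norm N (\<lambda>x. g x - d))\<^sup>2 \<le> energy g" by simp
  have "(L2_norm N (\<lambda>x. g x - d))\<^sup>2 = (\<integral>x. (cmod (g x))\<^sup>2 + (cmod d)\<^sup>2 - 2 * Re (g x * cnj d) \<partial>N)"
    unfolding L2_norm_square cmod_power2
    by (intro Bochner_Integration.integral_cong) (auto simp: power2_eq_square algebra_simps)
  also have "\<dots> = (L2_norm N g)\<^sup>2 + (cmod d)\<^sup>2 * measure N (space N) - 2 * Re ((\<integral>x. g x \<partial>N) * cnj d)"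
    using L2_integrable[OF g] L2_integrable_finite[OF g] by (simp add: L2_norm_square)
  finally have "(L2_norm N g)\<^sup>2 \<le> (L2_norm N (\<lambda>x. g x - d))\<^sup>2" by (simp add: mean)
  then have "l * (L2_norm N g)\<^sup>2 \<le> l * (L2_norm N (\<lambda>x. g x - d))\<^sup>2" using l by (rule mult_left_mono)
  then show ?thesis using e by (simp add: l_def)
qed

lemma walk_power_L2: "g \<in> L2 N \<Longrightarrow> (walk ^^ k) g \<in> L2 N"
  by (induction k) (auto intro: walk_L2)

lemma integral_walk_power: "g \<in> L2 N \<Longrightarrow> (\<integral>x. (walk ^^ k) g x \<partial>N) = (\<integral>x. g x \<partial>N)"
  by (induction k) (auto simp: integral_walk walk_power_L2)

lemma walk_power_diff_const: "(walk ^^ k) (\<lambda>x. g x - c) = (\<lambda>x. (walk ^^ k) g x - c)"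
  by (induction k) (auto simp: walk_diff_const)

lemma walk_contraction:
  assumes c: "0 < c"
    and exp: "\<And>A. A \<in> sets N \<Longrightarrow> measure N A \<le> measure N (space N) / 2 \<Longrightarrow>
      c * measure N A \<le> measure edge_measure (A \<times> (space N - A))"
    and g: "g \<in> L2 N" and mean: "(\<integral>x. g x \<partial>N) = 0" and small: "c\<^sup>2 / (16 * (card I)\<^sup>2) \<le> 1"
  shows "(L2_norm N ((walk ^^ k) g))\<^sup>2 \<le> (1 - c\<^sup>2 / (16 * (card I)\<^sup>2)) ^ k * (L2_norm N g)\<^sup>2"
proof (induction k)
  case (Suc k)
  let ?h = "(walk ^^ k) g" and ?q = "1 - c\<^sup>2 / (16 * (card I)\<^sup>2)"
  have h: "?h \<in> L2 N" "(\<integral>x. ?h x \<partial>N) = 0" using walk_power_L2[OF g] integral_walk_power[OF g] mean by auto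
  have "1 / (4 * card I) * (c\<^sup>2 / (4 * card I) * (L2_norm N ?h)\<^sup>2) \<le> 1 / (4 * card I) * energy ?h"
    using spectral_gap[OF c exp h] by (intro mult_left_mono) auto
  then have "(L2_norm N (walk ?h))\<^sup>2 \<le> ?q * (L2_norm N ?h)\<^sup>2"
    using walk_L2(2)[OF h(1)] by (simp add: algebra_simps power2_eq_square)
  also have "\<dots> \<le> ?q * (?q ^ k * (L2_norm N g)\<^sup>2)" using Suc small by (intro mult_left_mono) auto
  finally show ?case by (simp add: mult.assoc)
qed simp

end

section \<open>Bisections as partial automorphisms of the unit space\<close>

text \<open>This is the action of an admissible bisection on units with the arrows forgotten:
  \<open>t\<close> and \<open>u\<close> are inverse to each other between \<open>D\<close> and
  \<open>R\<close>, and their values elsewhere are arbitrary. In this form stability under inverses,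
  composition, restriction and passage to fibres is pure set algebra.\<close>

definition partial_automorphism ::
    "'a measure \<Rightarrow> 'a set \<Rightarrow> 'a set \<Rightarrow> ('a \<Rightarrow> 'a) \<Rightarrow> ('a \<Rightarrow> 'a) \<Rightarrow> bool" where
  "partial_automorphism M D R t u \<longleftrightarrow>
     D \<in> sets M \<and> R \<in> sets M \<and>
     (\<forall>x\<in>D. t x \<in> R \<and> u (t x) = x) \<and> (\<forall>y\<in>R. u y \<in> D \<and> t (u y) = y) \<and>
     (\<forall>A\<in>sets M. {x\<in>D. t x \<in> A} \<in> sets M) \<and> (\<forall>A\<in>sets M. {y\<in>R. u y \<in> A} \<in> sets M) \<and>
     (\<forall>A\<in>sets M. A \<subseteq> D \<longrightarrow> (t ` A \<in> null_sets M \<longleftrightarrow> A \<in> null_sets M))"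

lemma partial_automorphismD:
  assumes "partial_automorphism M D R t u"
  shows "D \<in> sets M" "R \<in> sets M"
    "x \<in> D \<Longrightarrow> t x \<in> R" "x \<in> D \<Longrightarrow> u (t x) = x" "y \<in> R \<Longrightarrow> u y \<in> D" "y \<in> R \<Longrightarrow> t (u y) = y"
    "A \<in> sets M \<Longrightarrow> {x\<in>D. t x \<in> A} \<in> sets M" "A \<in> sets M \<Longrightarrow> {y\<in>R. u y \<in> A} \<in> sets M"
    "A \<in> sets M \<Longrightarrow> A \<subseteq> D \<Longrightarrow> t ` A \<in> null_sets M \<longleftrightarrow> A \<in> null_sets M"
  using assms unfolding partial_automorphism_def by blast+

lemma partial_automorphism_image_eq:
  assumes "partial_automorphism M D R t u" "A \<subseteq> D"
  shows "t ` A = {y\<in>R. u y \<in> A}"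
proof
  show "t ` A \<subseteq> {y\<in>R. u y \<in> A}"
    using assms unfolding partial_automorphism_def by auto
  show "{y\<in>R. u y \<in> A} \<subseteq> t ` A"
    using assms unfolding partial_automorphism_def by (auto intro!: rev_image_eqI)
qed

lemma partial_automorphism_image_sets:
  assumes "partial_automorphism M D R t u" "A \<in> sets M" "A \<subseteq> D"
  shows "t ` A \<in> sets M"
  using assms by (simp add: partial_automorphism_image_eq[OF assms(1,3)])
    (simp add: partial_automorphism_def)

lemma partial_automorphism_inverse:
  assumes "partial_automorphism M D R t u"
  shows "partial_automorphism M R D u t"
proof -
  have "(u ` A \<in> null_sets M \<longleftrightarrow> A \<in> null_sets M)" if A: "A \<in> sets M" "A \<subseteq> R" for A
  proof -
    have uA: "u ` A = {x\<in>D. t x \<in> A}"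
      using assms A unfolding partial_automorphism_def by (auto intro!: rev_image_eqI)
    then have "u ` A \<in> sets M" "u ` A \<subseteq> D"
      using assms A unfolding partial_automorphism_def by auto
    moreover have "t ` u ` A = A"
      using assms A unfolding partial_automorphism_def by (force simp: image_iff subset_iff)
    ultimately show ?thesis
      using assms unfolding partial_automorphism_def by metis
  qed
  then show ?thesis
    using assms unfolding partial_automorphism_def by blast
qed

lemma partial_automorphism_comp:
  assumes 1: "partial_automorphism M D1 R1 t1 u1" and 2: "partial_automorphism M D2 R2 t2 u2"
  shows "partial_automorphism M {x\<in>D1. t1 x \<in> D2} {y\<in>R2. u2 y \<in> R1} (t2 \<circ> t1) (u1 \<circ> u2)"
proof -
  note d1 = 1[unfolded partial_automorphism_def] and d2 = 2[unfolded partial_automorphism_def]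
  have D: "{x\<in>D1. t1 x \<in> D2} \<in> sets M" and R: "{y\<in>R2. u2 y \<in> R1} \<in> sets M"
    using d1 d2 by blast+
  have "{x \<in> {x\<in>D1. t1 x \<in> D2}. (t2 \<circ> t1) x \<in> A} = {x\<in>D1. t1 x \<in> {x\<in>D2. t2 x \<in> A}}" for A
    by auto
  moreover have "{x\<in>D1. t1 x \<in> {x\<in>D2. t2 x \<in> A}} \<in> sets M" if "A \<in> sets M" for A
    using that d1 d2 by blast
  ultimately have m1: "{x \<in> {x\<in>D1. t1 x \<in> D2}. (t2 \<circ> t1) x \<in> A} \<in> sets M" if "A \<in> sets M" for A
    using that by simp
  have "{x \<in> {y\<in>R2. u2 y \<in> R1}. (u1 \<circ> u2) x \<in> A} = {x\<in>R2. u2 x \<in> {x\<in>R1. u1 x \<in> A}}" for A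
    by auto
  moreover have "{x\<in>R2. u2 x \<in> {x\<in>R1. u1 x \<in> A}} \<in> sets M" if "A \<in> sets M" for A
    using that d1 d2 by blast
  ultimately have m2: "{x \<in> {y\<in>R2. u2 y \<in> R1}. (u1 \<circ> u2) x \<in> A} \<in> sets M" if "A \<in> sets M" for A
    using that by simp
  have n: "(t2 \<circ> t1) ` A \<in> null_sets M \<longleftrightarrow> A \<in> null_sets M"
    if A: "A \<in> sets M" "A \<subseteq> {x\<in>D1. t1 x \<in> D2}" for A
  proof -
    have "t1 ` A \<in> sets M" "t1 ` A \<subseteq> D2"
      using partial_automorphism_image_sets[OF 1] A by auto
    then have "t2 ` t1 ` A \<in> null_sets M \<longleftrightarrow> t1 ` A \<in> null_sets M"
      using d2 by blast
    moreover have "t1 ` A \<in> null_sets M \<longleftrightarrow> A \<in> null_sets M"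
      using A d1 by blast
    ultimately show ?thesis by (simp add: image_comp)
  qed
  show ?thesis
    unfolding partial_automorphism_def using D R m1 m2 n d1 d2 by auto
qed

text \<open>The measure may be replaced by any other one with the same null sets inside
  \<open>S\<close>. This is how bisections pass between \<open>\<mu>\<close> and the associated measure,
  whose classes agree only where the unit vector does not vanish.\<close>

lemma partial_automorphism_restrict:
  assumes a: "partial_automorphism M D R t u" and S: "S \<in> sets M" and N: "sets N = sets M"
    and null: "\<And>A. A \<in> sets M \<Longrightarrow> A \<subseteq> S \<Longrightarrow> A \<in> null_sets N \<longleftrightarrow> A \<in> null_sets M"
  shows "partial_automorphism N {x\<in>D. x \<in> S \<and> t x \<in> S} {y\<in>R. y \<in> S \<and> u y \<in> S} t u"
proof -
  note d = a[unfolded partial_automorphism_def]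
  have "{x\<in>D. x \<in> S \<and> t x \<in> S} = {x\<in>D. t x \<in> S} \<inter> S" "{y\<in>R. y \<in> S \<and> u y \<in> S} = {y\<in>R. u y \<in> S} \<inter> S"
    by auto
  then have DR: "{x\<in>D. x \<in> S \<and> t x \<in> S} \<in> sets M" "{y\<in>R. y \<in> S \<and> u y \<in> S} \<in> sets M"
    using d S by (simp_all only:) blast+
  have "{x\<in>{x\<in>D. x \<in> S \<and> t x \<in> S}. t x \<in> A} = {x\<in>D. x \<in> S \<and> t x \<in> S} \<inter> {x\<in>D. t x \<in> A}"
    "{x\<in>{y\<in>R. y \<in> S \<and> u y \<in> S}. u x \<in> A} = {y\<in>R. y \<in> S \<and> u y \<in> S} \<inter> {x\<in>R. u x \<in> A}" for A by auto
  moreover have "{x\<in>D. x \<in> S \<and> t x \<in> S} \<inter> {x\<in>D. t x \<in> A} \<in> sets M"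
    "{y\<in>R. y \<in> S \<and> u y \<in> S} \<inter> {x\<in>R. u x \<in> A} \<in> sets M" if "A \<in> sets M" for A
    by (rule sets.Int; use d DR that in blast)+
  ultimately have m: "{x\<in>{x\<in>D. x \<in> S \<and> t x \<in> S}. t x \<in> A} \<in> sets M"
    "{x\<in>{y\<in>R. y \<in> S \<and> u y \<in> S}. u x \<in> A} \<in> sets M" if "A \<in> sets M" for A
    using that by (simp_all only:)
  have n: "t ` A \<in> null_sets N \<longleftrightarrow> A \<in> null_sets N" if A: "A \<in> sets M" "A \<subseteq> {x\<in>D. x \<in> S \<and> t x \<in> S}" for A
  proof -
    have "A \<subseteq> D" "A \<subseteq> S" "t ` A \<subseteq> S" using A by auto
    moreover have "t ` A \<in> sets M" using partial_automorphism_image_sets[OF a] A by auto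
    ultimately show ?thesis using null A d by metis
  qed
  show ?thesis
    unfolding partial_automorphism_def N using DR m n d by auto
qed

lemma set_length_le_iff:
  assumes "0 \<le> L" "\<And>a. a \<in> K \<Longrightarrow> 0 \<le> len a"
  shows "set_length len K \<le> ennreal L \<longleftrightarrow> (\<forall>a\<in>K. len a \<le> L)"
  using assms by (auto simp: set_length_def SUP_le_iff ennreal_le_iff)

lemma set_length_finiteD:
  assumes "set_length len K < \<infinity>" "\<And>a. a \<in> K \<Longrightarrow> 0 \<le> len a"
  obtains L where "0 < L" "\<And>a. a \<in> K \<Longrightarrow> len a \<le> L"
proof -
  have "len a \<le> enn2real (set_length len K) + 1" if "a \<in> K" for a
  proof -
    have "ennreal (len a) \<le> set_length len K"
      unfolding set_length_def using that by (rule SUP_upper)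
    then have "len a \<le> enn2real (set_length len K)"
      using assms that by (metis enn2real_ennreal enn2real_mono infinity_ennreal_def)
    then show ?thesis by simp
  qed
  moreover have "0 < enn2real (set_length len K) + 1"
    by (simp add: add_nonneg_pos)
  ultimately show thesis using that by blast
qed

lemma admissible_iff_partial_automorphism:
  assumes G: "groupoid G" and len: "length_function G len"
  shows "admissible G len M K \<longleftrightarrow>
    K \<subseteq> arrows G \<and> inj_on (src G) K \<and> (\<exists>L. \<forall>a\<in>K. len a \<le> L) \<and>
    (\<exists>t u. partial_automorphism M (src G ` K) (rng G ` K) t u \<and> (\<forall>a\<in>K. rng G a = t (src G a)))"
    (is "?l \<longleftrightarrow> ?r")
proof
  assume ?l
  note ad = this[unfolded admissible_def bisection_def Let_def]
  define D where "D = src G ` K"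
  define R where "R = rng G ` K"
  define t where "t = bisection_map G K"
  define u where "u = the_inv_into D t"
  have injs: "inj_on (src G) K" and injr: "inj_on (rng G) K" and K: "K \<subseteq> arrows G" using ad by auto
  have ts: "t (src G a) = rng G a" if "a \<in> K" for a
    using that injs by (simp add: t_def bisection_map_def the_inv_into_f_f)
  have inj: "inj_on t D"
  proof (rule inj_onI)
    fix x y assume "x \<in> D" "y \<in> D" and e: "t x = t y"
    then obtain a b where ab: "a \<in> K" "b \<in> K" "x = src G a" "y = src G b" by (auto simp: D_def)
    then have "rng G a = rng G b" using e ts by simp
    then have "a = b" using injr ab(1,2) by (metis inj_onD)
    then show "x = y" using ab by simp
  qed
  have us: "u (rng G a) = src G a" if "a \<in> K" for a
    unfolding u_def using the_inv_into_f_f[OF inj, of "src G a"] that ts by (auto simp: D_def)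
  have D: "D \<in> sets M" and R: "R \<in> sets M" using ad by (auto simp: D_def R_def)
  have mt: "t \<in> measurable (restrict_space M D) (restrict_space M R)"
    and mu: "u \<in> measurable (restrict_space M R) (restrict_space M D)"
    and nt: "\<And>A. A \<in> null_sets M \<Longrightarrow> A \<subseteq> D \<Longrightarrow> t ` A \<in> null_sets M"
    and nu: "\<And>A. A \<in> null_sets M \<Longrightarrow> A \<subseteq> R \<Longrightarrow> u ` A \<in> null_sets M"
    using ad by (auto simp: D_def R_def t_def u_def)
  have sub: "D \<subseteq> space M" "R \<subseteq> space M" using D R sets.sets_into_space by auto
  have tt: "\<forall>x\<in>D. t x \<in> R \<and> u (t x) = x" "\<forall>y\<in>R. u y \<in> D \<and> t (u y) = y"
    using ts us by (auto simp: D_def R_def)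
  have m1: "{x\<in>D. t x \<in> A} \<in> sets M" if "A \<in> sets M" for A
  proof -
    have "t -` (A \<inter> R) \<inter> space (restrict_space M D) \<in> sets (restrict_space M D)"
      by (rule measurable_sets[OF mt]) (use that in \<open>auto simp: sets_restrict_space\<close>)
    moreover have "t -` (A \<inter> R) \<inter> space (restrict_space M D) = {x\<in>D. t x \<in> A}"
      using tt sub by (auto simp: space_restrict_space)
    ultimately show ?thesis using D by (auto simp: sets_restrict_space_iff)
  qed
  have m2: "{x\<in>R. u x \<in> A} \<in> sets M" if "A \<in> sets M" for A
  proof -
    have "u -` (A \<inter> D) \<inter> space (restrict_space M R) \<in> sets (restrict_space M R)"
      by (rule measurable_sets[OF mu]) (use that in \<open>auto simp: sets_restrict_space\<close>)
    moreover have "u -` (A \<inter> D) \<inter> space (restrict_space M R) = {x\<in>R. u x \<in> A}"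
      using tt sub by (auto simp: space_restrict_space)
    ultimately show ?thesis using R by (auto simp: sets_restrict_space_iff)
  qed
  have "t ` A \<in> null_sets M \<longleftrightarrow> A \<in> null_sets M" if "A \<subseteq> D" for A
  proof -
    have "u ` t ` A = A" "t ` A \<subseteq> R" using tt that by (force simp: image_iff subset_iff)+
    then show ?thesis using nt nu that by metis
  qed
  then have "partial_automorphism M D R t u"
    unfolding partial_automorphism_def using D R tt m1 m2 by blast
  then have p: "\<exists>t u. partial_automorphism M (src G ` K) (rng G ` K) t u \<and> (\<forall>a\<in>K. rng G a = t (src G a))"
    using ts unfolding D_def R_def by metis
  have "set_length len K < \<infinity>" using ad by blast
  moreover have "0 \<le> len a" if "a \<in> K" for a using that len K unfolding length_function_def by blast
  ultimately obtain L where "\<And>a. a \<in> K \<Longrightarrow> len a \<le> L" using set_length_finiteD[of len K] by metis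
  then have "\<exists>L. \<forall>a\<in>K. len a \<le> L" by blast
  with K injs p show ?r by (intro conjI)
next
  assume ?r
  then obtain t u L where K: "K \<subseteq> arrows G" and injs: "inj_on (src G) K" and L: "\<forall>a\<in>K. len a \<le> L"
    and p: "partial_automorphism M (src G ` K) (rng G ` K) t u" and ts: "\<forall>a\<in>K. rng G a = t (src G a)"
    by blast
  define D where "D = src G ` K"
  define R where "R = rng G ` K"
  note d = partial_automorphismD[OF p, folded D_def R_def]
  define t' where "t' = bisection_map G K"
  define u' where "u' = the_inv_into D t'"
  have t': "t' x = t x" if "x \<in> D" for x
    using that injs ts by (auto simp: t'_def bisection_map_def the_inv_into_f_f D_def)
  have inj: "inj_on t' D" using t' d(4) by (metis inj_on_def)
  have u': "u' y = u y" if "y \<in> R" for y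
  proof -
    have "u y \<in> D" "t (u y) = y" using d(5,6) that by auto
    then show ?thesis unfolding u'_def using the_inv_into_f_f[OF inj, of "u y"] t' by simp
  qed
  have injr: "inj_on (rng G) K"
  proof (rule inj_onI)
    fix a b assume ab: "a \<in> K" "b \<in> K" and "rng G a = rng G b"
    then have "u (t (src G a)) = u (t (src G b))" using ts by simp
    then have "src G a = src G b" using d(4) ab by (simp add: D_def)
    then show "a = b" using injs ab by (metis inj_onD)
  qed
  have sub: "D \<subseteq> space M" "R \<subseteq> space M" using d(1,2) sets.sets_into_space by auto
  have mt: "t' \<in> measurable (restrict_space M D) (restrict_space M R)"
  proof (rule measurableI)
    show "t' x \<in> space (restrict_space M R)" if "x \<in> space (restrict_space M D)" for x
      using that t' d(3) sub by (auto simp: space_restrict_space)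
    show "t' -` A \<inter> space (restrict_space M D) \<in> sets (restrict_space M D)"
      if A: "A \<in> sets (restrict_space M R)" for A
    proof -
      have "A \<in> sets M" using A d(2) by (auto simp: sets_restrict_space_iff)
      moreover have "t' -` A \<inter> space (restrict_space M D) = {x\<in>D. t x \<in> A}"
        using t' sub by (auto simp: space_restrict_space)
      ultimately show ?thesis using d(1,7) by (auto simp: sets_restrict_space_iff)
    qed
  qed
  have mu: "u' \<in> measurable (restrict_space M R) (restrict_space M D)"
  proof (rule measurableI)
    show "u' x \<in> space (restrict_space M D)" if "x \<in> space (restrict_space M R)" for x
      using that u' d(5) sub by (auto simp: space_restrict_space)
    show "u' -` A \<inter> space (restrict_space M R) \<in> sets (restrict_space M R)"
      if A: "A \<in> sets (restrict_space M D)" for A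
    proof -
      have "A \<in> sets M" using A d(1) by (auto simp: sets_restrict_space_iff)
      moreover have "u' -` A \<inter> space (restrict_space M R) = {x\<in>R. u x \<in> A}"
        using u' sub by (auto simp: space_restrict_space)
      ultimately show ?thesis using d(2,8) by (auto simp: sets_restrict_space_iff)
    qed
  qed
  have nt: "t' ` A \<in> null_sets M" if "A \<in> null_sets M" "A \<subseteq> D" for A
  proof -
    have "t' ` A = t ` A" using t' that(2) by (intro image_cong) auto
    then show ?thesis using d(9)[OF null_setsD2[OF that(1)] that(2)] that by simp
  qed
  have nu: "u' ` A \<in> null_sets M" if "A \<in> null_sets M" "A \<subseteq> R" for A
  proof -
    have "u' ` A = u ` A" using u' that(2) by (intro image_cong) auto
    moreover have "u ` A \<in> null_sets M"
    proof -
      have "partial_automorphism M R D u t" using partial_automorphism_inverse[OF p] by (simp add: D_def R_def)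
      from partial_automorphismD(9)[OF this null_setsD2[OF that(1)] that(2)] that show ?thesis by simp
    qed
    ultimately show ?thesis by simp
  qed
  have "0 \<le> max 0 L" by simp
  then have "set_length len K \<le> ennreal (max 0 L)"
    using len K L by (subst set_length_le_iff) (force simp: length_function_def)+
  then have "set_length len K < \<infinity>"
    using ennreal_less_top order_le_less_trans by (metis infinity_ennreal_def)
  then show ?l
    unfolding admissible_def bisection_def Let_def
    unfolding t'_def[symmetric] D_def[symmetric] R_def[symmetric] u'_def[symmetric]
    using K injs injr d(1,2) mt mu nt nu \<open>set_length len K < \<infinity>\<close> by blast
qed

lemma admissibleE:
  assumes "groupoid G" "length_function G len" "admissible G len M K"
  obtains t u L where "K \<subseteq> arrows G" "inj_on (src G) K" "0 < L" "\<And>a. a \<in> K \<Longrightarrow> len a \<le> L"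
    "partial_automorphism M (src G ` K) (rng G ` K) t u" "\<And>a. a \<in> K \<Longrightarrow> rng G a = t (src G a)"
proof -
  from admissible_iff_partial_automorphism[OF assms(1,2), of M K] assms(3)
  obtain t u L where "K \<subseteq> arrows G" "inj_on (src G) K" "\<forall>a\<in>K. len a \<le> L"
    "partial_automorphism M (src G ` K) (rng G ` K) t u" "\<forall>a\<in>K. rng G a = t (src G a)" by blast
  with that[of "max 1 L" t u] show thesis by force
qed

lemma admissibleI:
  assumes "groupoid G" "length_function G len" "K \<subseteq> arrows G" "inj_on (src G) K" "\<And>a. a \<in> K \<Longrightarrow> len a \<le> L"
    "partial_automorphism M D R t u" "src G ` K = D" "rng G ` K = R" "\<And>a. a \<in> K \<Longrightarrow> rng G a = t (src G a)"
  shows "admissible G len M K"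
proof -
  have "partial_automorphism M (src G ` K) (rng G ` K) t u" using assms(6) unfolding assms(7,8) .
  then show ?thesis
    unfolding admissible_iff_partial_automorphism[OF assms(1,2)] using assms(3-5) assms(9) by blast
qed

lemma admissible_inverse:
  assumes G: "groupoid G" and len: "length_function G len" and K: "admissible G len M K"
  shows "admissible G len M (ginv G ` K)"
proof -
  interpret groupoid G by fact
  from admissibleE[OF G len K] obtain t u L where a: "K \<subseteq> arrows G" "inj_on (src G) K" "\<And>a. a \<in> K \<Longrightarrow> len a \<le> L"
    "partial_automorphism M (src G ` K) (rng G ` K) t u" "\<And>a. a \<in> K \<Longrightarrow> rng G a = t (src G a)" by metis
  note d = a(4)[unfolded partial_automorphism_def]
  have si: "src G (ginv G a) = rng G a" "rng G (ginv G a) = src G a" if "a \<in> K" for a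
    using that a(1) src_inv rng_inv by auto
  have u: "u (rng G a) = src G a" if "a \<in> K" for a using that a(5) d by auto
  show ?thesis
  proof (rule admissibleI[OF G len _ _ _ partial_automorphism_inverse[OF a(4)]])
    show "ginv G ` K \<subseteq> arrows G" using a(1) inv_closed by auto
    show "inj_on (src G) (ginv G ` K)"
    proof (rule inj_onI)
      fix x y assume "x \<in> ginv G ` K" "y \<in> ginv G ` K" and e: "src G x = src G y"
      then obtain b c where bc: "b \<in> K" "c \<in> K" "x = ginv G b" "y = ginv G c" by auto
      then have "u (rng G b) = u (rng G c)" using e si by simp
      then have "src G b = src G c" using u bc by simp
      then have "b = c" using a(2) bc by (metis inj_onD)
      then show "x = y" using bc by simp
    qed
    show "len b \<le> L" if "b \<in> ginv G ` K" for b
      using that len a(1,3) unfolding length_function_def by force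
    show "src G ` ginv G ` K = rng G ` K" using si by (force simp: image_iff)
    show "rng G ` ginv G ` K = src G ` K" using si by (force simp: image_iff)
    show "rng G b = u (src G b)" if "b \<in> ginv G ` K" for b using that si u by auto
  qed
qed

definition set_mult :: "'g groupoid_ops \<Rightarrow> 'g set \<Rightarrow> 'g set \<Rightarrow> 'g set" where
  "set_mult G K H = {gmult G a b | a b. a \<in> K \<and> b \<in> H \<and> src G a = rng G b}"

text \<open>A product of bisections acts by the composition of their actions; lengths add by the
  triangle inequality.\<close>

lemma admissible_set_mult:
  assumes G: "groupoid G" and len: "length_function G len"
    and K: "admissible G len M K" and H: "admissible G len M H"
  shows "admissible G len M (set_mult G K H)"
proof -
  interpret groupoid G by fact
  from admissibleE[OF G len K] obtain t u L where k: "K \<subseteq> arrows G" "inj_on (src G) K" "\<And>a. a \<in> K \<Longrightarrow> len a \<le> L"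
    "partial_automorphism M (src G ` K) (rng G ` K) t u" "\<And>a. a \<in> K \<Longrightarrow> rng G a = t (src G a)" by metis
  from admissibleE[OF G len H] obtain t' u' L' where h: "H \<subseteq> arrows G" "inj_on (src G) H" "\<And>a. a \<in> H \<Longrightarrow> len a \<le>
      L'"
    "partial_automorphism M (src G ` H) (rng G ` H) t' u'" "\<And>a. a \<in> H \<Longrightarrow> rng G a = t' (src G a)" by metis
  have u: "u (rng G a) = src G a" if "a \<in> K" for a using that k(4,5) by (auto simp: partial_automorphism_def)
  have p: "gmult G a b \<in> arrows G" "src G (gmult G a b) = src G b" "rng G (gmult G a b) = rng G a"
    "len (gmult G a b) \<le> len a + len b"
    if "a \<in> K" "b \<in> H" "src G a = rng G b" for a b
    using that k(1) h(1) mult_closed src_mult rng_mult len unfolding length_function_def by blast+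
  show ?thesis
  proof (rule admissibleI[OF G len _ _ _ partial_automorphism_comp[OF h(4) k(4)]])
    show "set_mult G K H \<subseteq> arrows G" using p by (auto simp: set_mult_def)
    show "inj_on (src G) (set_mult G K H)"
    proof (rule inj_onI)
      fix x y assume "x \<in> set_mult G K H" "y \<in> set_mult G K H" and e: "src G x = src G y"
      then obtain a b a' b' where x: "x = gmult G a b" "a \<in> K" "b \<in> H" "src G a = rng G b"
        and y: "y = gmult G a' b'" "a' \<in> K" "b' \<in> H" "src G a' = rng G b'" by (auto simp: set_mult_def)
      have "b = b'" using e x y p h(2) by (auto dest: inj_onD)
      moreover have "a = a'" using calculation x y k(2) by (metis inj_onD)
      ultimately show "x = y" using x y by simp
    qed
    show "len x \<le> L + L'" if "x \<in> set_mult G K H" for x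
      using that p k(3) h(3) by (fastforce simp: set_mult_def)
    show "src G ` set_mult G K H = {x \<in> src G ` H. t' x \<in> src G ` K}"
    proof (intro set_eqI iffI)
      fix x assume "x \<in> {x \<in> src G ` H. t' x \<in> src G ` K}"
      then obtain b a where "b \<in> H" "x = src G b" "a \<in> K" "t' x = src G a" by auto
      moreover from this have "src G a = rng G b" using h(5) by simp
      ultimately have "gmult G a b \<in> set_mult G K H" "src G (gmult G a b) = x"
        using p(2) unfolding set_mult_def by blast+
      then show "x \<in> src G ` set_mult G K H" by blast
    next
      fix x assume "x \<in> src G ` set_mult G K H"
      then obtain a b where ab: "a \<in> K" "b \<in> H" "src G a = rng G b" "x = src G (gmult G a b)"
        unfolding set_mult_def by blast
      then have "x = src G b" "t' x = src G a" using p(2) h(5) by auto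
      then show "x \<in> {x \<in> src G ` H. t' x \<in> src G ` K}" using ab(1,2) by blast
    qed
    show "rng G ` set_mult G K H = {y \<in> rng G ` K. u y \<in> rng G ` H}"
    proof (intro set_eqI iffI)
      fix x assume "x \<in> {y \<in> rng G ` K. u y \<in> rng G ` H}"
      then obtain b a where "b \<in> H" "x = rng G a" "a \<in> K" "u x = rng G b" by auto
      moreover from this have "src G a = rng G b" using u by simp
      ultimately have "gmult G a b \<in> set_mult G K H" "rng G (gmult G a b) = x"
        using p(3) unfolding set_mult_def by blast+
      then show "x \<in> rng G ` set_mult G K H" by blast
    next
      fix x assume "x \<in> rng G ` set_mult G K H"
      then obtain a b where ab: "a \<in> K" "b \<in> H" "src G a = rng G b" "x = rng G (gmult G a b)"
        unfolding set_mult_def by blast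
      then have "x = rng G a" "u x = rng G b" using p(3) u by auto
      then show "x \<in> {y \<in> rng G ` K. u y \<in> rng G ` H}" using ab(1,2) by blast
    qed
    show "rng G x = (t \<circ> t') (src G x)" if "x \<in> set_mult G K H" for x
      using that p k(5) h(5) by (auto simp: set_mult_def)
  qed
qed

lemma admissible_restrict:
  assumes G: "groupoid G" and len: "length_function G len" and K: "admissible G len M K"
    and S: "S \<in> sets M" and N: "sets N = sets M"
    and null: "\<And>A. A \<in> sets M \<Longrightarrow> A \<subseteq> S \<Longrightarrow> A \<in> null_sets N \<longleftrightarrow> A \<in> null_sets M"
  shows "admissible G len N {a\<in>K. src G a \<in> S \<and> rng G a \<in> S}"
proof -
  from admissibleE[OF G len K] obtain t u L where a: "K \<subseteq> arrows G" "inj_on (src G) K" "\<And>a. a \<in> K \<Longrightarrow> len a \<le> L"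
    "partial_automorphism M (src G ` K) (rng G ` K) t u" "\<And>a. a \<in> K \<Longrightarrow> rng G a = t (src G a)" by metis
  have u: "u (rng G a) = src G a" if "a \<in> K" for a using that a(4,5) by (auto simp: partial_automorphism_def)
  show ?thesis
  proof (rule admissibleI[OF G len _ _ _ partial_automorphism_restrict[OF a(4) S N null]])
    show "{a\<in>K. src G a \<in> S \<and> rng G a \<in> S} \<subseteq> arrows G" using a(1) by auto
    show "inj_on (src G) {a\<in>K. src G a \<in> S \<and> rng G a \<in> S}" using a(2) by (rule inj_on_subset) auto
    show "len b \<le> L" if "b \<in> {a\<in>K. src G a \<in> S \<and> rng G a \<in> S}" for b using that a(3) by auto
    show "src G ` {a\<in>K. src G a \<in> S \<and> rng G a \<in> S} = {x \<in> src G ` K. x \<in> S \<and> t x \<in> S}"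
      using a(5) by force
    show "rng G ` {a\<in>K. src G a \<in> S \<and> rng G a \<in> S} = {y \<in> rng G ` K. y \<in> S \<and> u y \<in> S}"
      using u by force
  qed (use a(5) in auto)
qed

lemma admissible_units:
  assumes G: "groupoid G" and len: "length_function G len" and M: "space M = unit_space G"
  shows "admissible G len M (unit_space G)"
proof -
  interpret groupoid G by fact
  have s: "src G ` unit_space G = unit_space G" "rng G ` unit_space G = unit_space G"
    using src_of_unit rng_of_unit by auto
  have p: "partial_automorphism M (unit_space G) (unit_space G) (\<lambda>x. x) (\<lambda>x. x)"
  proof -
    have "{x \<in> space M. x \<in> A} = A" if "A \<in> sets M" for A using sets.sets_into_space[OF that] by auto
    then show ?thesis unfolding partial_automorphism_def M[symmetric] by auto
  qed
  show ?thesis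
  proof (rule admissibleI[OF G len _ _ _ p])
    show "len a \<le> 0" if "a \<in> unit_space G" for a using that len by (auto simp: length_function_def)
    show "inj_on (src G) (unit_space G)" using src_of_unit by (auto simp: inj_on_def)
  qed (use s units_subset rng_of_unit src_of_unit in auto)
qed

lemma range_act_UN: "range_act G (\<Union>i\<in>I. K i) A = (\<Union>i\<in>I. range_act G (K i) A)"
  unfolding range_act_def by auto

lemma range_act_mono: "K \<subseteq> K' \<Longrightarrow> A \<subseteq> A' \<Longrightarrow> range_act G K A \<subseteq> range_act G K' A'"
  unfolding range_act_def by auto

lemma range_act_admissible_sets:
  assumes G: "groupoid G" and len: "length_function G len" and K: "admissible G len M K" and A: "A \<in> sets M"
  shows "range_act G K A \<in> sets M"
proof -
  from admissibleE[OF G len K] obtain t u where a: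
    "partial_automorphism M (src G ` K) (rng G ` K) t u" "\<And>a. a \<in> K \<Longrightarrow> rng G a = t (src G a)" by metis
  have "range_act G K A = t ` (A \<inter> src G ` K)"
    unfolding range_act_def using a(2) by force
  moreover have "t ` (A \<inter> src G ` K) \<in> sets M"
    using partial_automorphism_image_sets[OF a(1)] A a(1) by (auto simp: partial_automorphism_def)
  ultimately show ?thesis by simp
qed

lemma range_act_decomposable_sets:
  assumes G: "groupoid G" and len: "length_function G len" and K: "N_decomposable G len M N K" and A: "A \<in>
      sets M"
  shows "range_act G K A \<in> sets M"
proof -
  from K obtain Ks where Ks: "\<forall>i\<in>{1..N}. admissible G len M (Ks i)" "K = (\<Union>i\<in>{1..N}. Ks i)"
    unfolding N_decomposable_def by blast
  have "(\<Union>i\<in>{1..N}. range_act G (Ks i) A) \<in> sets M"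
    using Ks(1) range_act_admissible_sets[OF G len _ A] by (intro sets.finite_UN) auto
  then show ?thesis unfolding Ks(2) range_act_UN .
qed

text \<open>Listing every set together with its inverse makes the permutation that matches sets with
  their inverses the same for all families indexed by the same \<open>I\<close>. Hence families in
  different groupoids can be combined without their original permutations having to agree.\<close>

definition unital_symmetric_hull :: "'g groupoid_ops \<Rightarrow> 'i set \<Rightarrow> ('i \<Rightarrow> 'g set) \<Rightarrow> 'g set" where
  "unital_symmetric_hull G I B = unit_space G \<union> (\<Union>i\<in>I. B i \<union> ginv G ` B i)"

lemma (in groupoid) inv_of_unit:
  assumes "x \<in> unit_space G" shows "ginv G x = x"
proof -
  have x: "x \<in> arrows G" using assms units_subset by auto
  have "gmult G (ginv G x) x = ginv G x"
    using mult_src_right[OF inv_closed[OF x]] src_inv[OF x] rng_of_unit[OF assms] by simp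
  then show ?thesis using inv_mult[OF x] src_of_unit[OF assms] by simp
qed

lemma (in groupoid) inv_inv:
  assumes x: "x \<in> arrows G" shows "ginv G (ginv G x) = x"
proof -
  let ?y = "ginv G x" and ?z = "ginv G (ginv G x)"
  have y: "?y \<in> arrows G" and z: "?z \<in> arrows G" using x inv_closed by auto
  have "?z = gmult G ?z (src G ?z)" using mult_src_right[OF z] by simp
  also have "src G ?z = gmult G ?y x" using inv_mult[OF x] src_inv[OF y] rng_inv[OF x] by simp
  also have "gmult G ?z (gmult G ?y x) = gmult G (gmult G ?z ?y) x"
    using mult_assoc[OF z y x] src_inv[OF y] src_inv[OF x] by simp
  also have "\<dots> = x" using inv_mult[OF y] src_inv[OF x] rng_mult_left[OF x] by simp
  finally show ?thesis .
qed

lemma N_decomposable_hull: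
  assumes G: "groupoid G" and len: "length_function G len" and M: "space M = unit_space G"
    and B: "\<And>i. i \<in> {1..N} \<Longrightarrow> admissible G len M (B i)"
  shows "N_decomposable G len M (2 * N + 1) (unital_symmetric_hull G {1..N} B)"
proof -
  interpret groupoid G by fact
  let ?U = "unit_space G"
  \<comment> \<open>The indices \<open>1..N\<close> carry the given sets, \<open>N+1..2N\<close> their
    inverses, and \<open>2N+1\<close> the units; the permutation exchanges \<open>j\<close> and \<open>j
    + N\<close>.\<close>
  define Ks where "Ks j = (if j = 2 * N + 1 then ?U else if j \<le> N then B j else ginv G ` B (j - N))" for j ::
      nat
  define \<sigma> where "\<sigma> j = (if j = 2 * N + 1 then j else if j \<le> N then j + N else j - N)" for j :: nat
  let ?K = "unital_symmetric_hull G {1..N} B"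
  have sub: "B i \<subseteq> arrows G" if "i \<in> {1..N}" for i using B[OF that] by (auto simp: admissible_def bisection_def)
  have ii: "ginv G ` ginv G ` B i = B i" if "i \<in> {1..N}" for i
    using sub[OF that] inv_inv by (force simp: image_iff subset_iff)
  have iu: "ginv G ` ?U = ?U" using inv_of_unit by (force simp: image_iff)
  have ad: "admissible G len M (Ks i)" if "i \<in> {1..2*N+1}" for i
  proof -
    have "i = 2*N+1 \<or> i \<in> {1..N} \<or> (i - N \<in> {1..N} \<and> i \<noteq> 2*N+1 \<and> \<not> i \<le> N)" using that by auto
    then consider "i = 2*N+1" | "i \<in> {1..N}" | "i - N \<in> {1..N}" "i \<noteq> 2*N+1" "\<not> i \<le> N" by blast
    then show ?thesis
      using B admissible_units[OF G len M] admissible_inverse[OF G len B, of "i - N"]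
      by cases (auto simp: Ks_def)
  qed
  have K: "?K = (\<Union>i\<in>{1..2*N+1}. Ks i)"
  proof (intro equalityI subsetI)
    fix x assume "x \<in> ?K"
    then consider "x \<in> ?U" | i where "i \<in> {1..N}" "x \<in> B i" | i where "i \<in> {1..N}" "x \<in> ginv G ` B i"
      by (auto simp: unital_symmetric_hull_def)
    then show "x \<in> (\<Union>i\<in>{1..2*N+1}. Ks i)"
    proof cases
      case 1 then have "x \<in> Ks (2*N+1)" by (simp add: Ks_def)
      then show ?thesis by force
    next
      case (2 i) then have "x \<in> Ks i" by (simp add: Ks_def)
      then show ?thesis using 2 by force
    next
      case (3 i) then have "x \<in> Ks (i + N)" by (auto simp: Ks_def)
      then show ?thesis using 3 by (intro UN_I[of "i + N"]) auto
    qed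
  next
    fix x assume "x \<in> (\<Union>i\<in>{1..2*N+1}. Ks i)"
    then obtain i where i: "i \<in> {1..2*N+1}" "x \<in> Ks i" by blast
    have "i = 2*N+1 \<or> i \<in> {1..N} \<or> (i - N \<in> {1..N} \<and> i \<noteq> 2*N+1 \<and> \<not> i \<le> N)" using i by auto
    then consider "i = 2*N+1" | "i \<in> {1..N}" | "i - N \<in> {1..N}" "i \<noteq> 2*N+1" "\<not> i \<le> N" by blast
    then show "x \<in> ?K"
    proof cases
      case 1 then show ?thesis using i by (simp add: Ks_def unital_symmetric_hull_def)
    next
      case 2 then have "x \<in> B i" using i by (auto simp: Ks_def)
      then show ?thesis using 2 unfolding unital_symmetric_hull_def by blast
    next
      case 3 then have "x \<in> ginv G ` B (i - N)" using i by (auto simp: Ks_def)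
      then show ?thesis using 3 unfolding unital_symmetric_hull_def by blast
    qed
  qed
  have bij: "bij_betw \<sigma> {1..2*N+1} {1..2*N+1}"
    by (rule bij_betw_byWitness[where f'=\<sigma>]) (auto simp: \<sigma>_def)
  have inv: "ginv G ` Ks i = Ks (\<sigma> i)" if "i \<in> {1..2*N+1}" for i
    using that ii[of "i - N"] iu by (auto simp: Ks_def \<sigma>_def)
  have "ginv G ` ?K = (\<Union>i\<in>{1..2*N+1}. Ks (\<sigma> i))" unfolding K image_UN using inv by (intro SUP_cong) auto
  also have "\<dots> = (\<Union>i\<in>\<sigma> ` {1..2*N+1}. Ks i)" by (simp only: image_image)
  also have "\<dots> = ?K" using bij unfolding K bij_betw_def by simp
  finally have sym: "symmetric_set G ?K" by (simp add: symmetric_set_def)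
  have "decomposable G len M ?K"
    unfolding decomposable_def using ad K by (intro exI[of _ "Ks ` {1..2*N+1}"]) auto
  moreover have "unital_set G ?K" by (simp add: unital_set_def unital_symmetric_hull_def)
  moreover have "Ks (2*N+1) = ?U" by (simp add: Ks_def)
  then have "\<exists>i\<in>{1..2*N+1}. Ks i = ?U" by (rule bexI) simp
  ultimately show ?thesis unfolding N_decomposable_def using sym ad K bij inv by blast
qed

lemma set_length_hull:
  assumes len: "length_function G len" and L: "0 < L"
    and B: "\<And>i. i \<in> I \<Longrightarrow> B i \<subseteq> arrows G" "\<And>i a. i \<in> I \<Longrightarrow> a \<in> B i \<Longrightarrow> len a \<le> L"
  shows "set_length len (unital_symmetric_hull G I B) \<le> ennreal L"
proof -
  have "len a \<le> L" if "a \<in> unital_symmetric_hull G I B" for a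
    using that len L B unfolding unital_symmetric_hull_def length_function_def by fastforce
  then show ?thesis unfolding set_length_def by (auto simp: SUP_le_iff intro!: ennreal_leI)
qed

section \<open>Measures and groupoids on disjoint unions\<close>

lemma sets_disj_measure_iff: "A \<in> sets (disj_measure M) \<longleftrightarrow> (\<forall>n. Pair n -` A \<in> sets (M n))"
proof
  assume a: "\<forall>n. Pair n -` A \<in> sets (M n)"
  have "Pair n ` (Pair n -` A) \<in> sets (disj_measure M)" for n
    unfolding sets_disj_measure using a by (intro sigma_sets.Basic UN_I[of n] imageI) auto
  then have "(\<Union>n. Pair n ` (Pair n -` A)) \<in> sets (disj_measure M)" by blast
  moreover have "(\<Union>n. Pair n ` (Pair n -` A)) = A" by auto
  ultimately show "A \<in> sets (disj_measure M)" by simp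
qed (use sets_vimage_Pair_disj_measure in blast)

lemma measurable_disj_measure_iff:
  "f \<in> measurable (disj_measure M) N \<longleftrightarrow> (\<forall>n. (\<lambda>x. f (n, x)) \<in> measurable (M n) N)"
proof
  assume "f \<in> measurable (disj_measure M) N"
  then show "\<forall>n. (\<lambda>x. f (n, x)) \<in> measurable (M n) N"
    using measurable_compose[OF measurable_Pair_disj_measure] by blast
next
  assume f: "\<forall>n. (\<lambda>x. f (n, x)) \<in> measurable (M n) N"
  show "f \<in> measurable (disj_measure M) N"
  proof (rule measurableI)
    show "f x \<in> space N" if "x \<in> space (disj_measure M)" for x
      using that f by (auto simp: space_disj_measure dest: measurable_space)
    fix A assume A: "A \<in> sets N"
    have "Pair n -` (f -` A \<inter> space (disj_measure M)) = (\<lambda>x. f (n, x)) -` A \<inter> space (M n)" for n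
      by (auto simp: space_disj_measure)
    then show "f -` A \<inter> space (disj_measure M) \<in> sets (disj_measure M)"
      unfolding sets_disj_measure_iff using f A by (simp only:) (auto intro: measurable_sets)
  qed
qed

lemma null_sets_disj_measure_iff:
  "A \<in> null_sets (disj_measure M) \<longleftrightarrow> (\<forall>n. Pair n -` A \<in> null_sets (M n))"
proof (cases "A \<in> sets (disj_measure M)")
  case True
  then have "A \<in> null_sets (disj_measure M) \<longleftrightarrow> (\<Sum>n. emeasure (M n) (Pair n -` A)) = 0"
    by (simp add: null_sets_def emeasure_disj_measure)
  also have "\<dots> \<longleftrightarrow> (\<forall>n. emeasure (M n) (Pair n -` A) = 0)"
    by (subst suminf_eq_zero_iff) auto
  finally show ?thesis using True by (auto simp: null_sets_def sets_disj_measure_iff)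
next
  case False
  then show ?thesis by (auto simp: null_sets_def sets_disj_measure_iff)
qed

text \<open>The restriction of the measure to the fibre \<open>n\<close> is the image of the measure
  \<open>M n\<close> under the inclusion of that fibre.\<close>

lemma nn_integral_disj_measure:
  assumes f: "f \<in> borel_measurable (disj_measure M)"
  shows "(\<integral>\<^sup>+z. f z \<partial>disj_measure M) = (\<Sum>n. \<integral>\<^sup>+x. f (n, x) \<partial>M n)"
proof -
  let ?D = "disj_measure M"
  define Z where "Z n = Pair n ` space (M n)" for n
  have "Pair m -` Z n \<in> sets (M m)" for m n
  proof (cases "m = n")
    case True then have "Pair m -` Z n = space (M m)" by (auto simp: Z_def)
    then show ?thesis by simp
  next
    case False then have "Pair m -` Z n = {}" by (auto simp: Z_def)
    then show ?thesis by simp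
  qed
  then have Z: "Z n \<in> sets ?D" for n
    by (simp add: sets_disj_measure_iff)
  have eq: "density ?D (indicator (Z n)) = distr (M n) ?D (Pair n)" for n
  proof (rule measure_eqI)
    fix A assume "A \<in> sets (density ?D (indicator (Z n)))"
    then have A: "A \<in> sets ?D" by simp
    have "emeasure (density ?D (indicator (Z n))) A = emeasure ?D (Z n \<inter> A)"
      using A Z by (simp add: emeasure_density indicator_inter_arith[symmetric])
    also have "Z n \<inter> A = Pair n ` (Pair n -` A)"
      using sets.sets_into_space[OF A] by (auto simp: Z_def space_disj_measure)
    also have "emeasure ?D \<dots> = emeasure (M n) (Pair n -` A)"
      using A by (intro emeasure_disj_measure_component) (simp add: sets_disj_measure_iff)
    also have "\<dots> = emeasure (distr (M n) ?D (Pair n)) A"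
    proof -
      have "Pair n -` A \<inter> space (M n) = Pair n -` A"
        using sets.sets_into_space[OF A] by (auto simp: space_disj_measure)
      then show ?thesis using A by (simp add: emeasure_distr measurable_Pair_disj_measure)
    qed
    finally show "emeasure (density ?D (indicator (Z n))) A = emeasure (distr (M n) ?D (Pair n)) A" .
  qed simp
  have "(\<integral>\<^sup>+z. f z \<partial>?D) = (\<integral>\<^sup>+z. (\<Sum>n. indicator (Z n) z * f z) \<partial>?D)"
  proof (rule nn_integral_cong)
    fix z assume "z \<in> space ?D"
    then have "(\<Sum>n. indicator (Z n) z * f z) = (\<Sum>n\<in>{fst z}. indicator (Z n) z * f z)"
      by (intro suminf_finite) (auto simp: Z_def indicator_def)
    also have "\<dots> = f z"
      using \<open>z \<in> space ?D\<close> by (cases z) (auto simp: Z_def indicator_def space_disj_measure)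
    finally show "f z = (\<Sum>n. indicator (Z n) z * f z)" by simp
  qed
  also have "\<dots> = (\<Sum>n. \<integral>\<^sup>+z. indicator (Z n) z * f z \<partial>?D)"
    using f Z by (intro nn_integral_suminf borel_measurable_times_ennreal borel_measurable_indicator) auto
  also have "\<dots> = (\<Sum>n. \<integral>\<^sup>+z. f z \<partial>density ?D (indicator (Z n)))"
    using f Z by (intro suminf_cong) (simp add: nn_integral_density)
  also have "\<dots> = (\<Sum>n. \<integral>\<^sup>+x. f (n, x) \<partial>M n)"
    unfolding eq using f by (intro suminf_cong) (simp add: nn_integral_distr measurable_Pair_disj_measure)
  finally show ?thesis .
qed

lemma partial_automorphism_disj_measure:
  assumes p: "\<And>n. partial_automorphism (M n) (D n) (R n) (t n) (u n)"
  shows "partial_automorphism (disj_measure M) (SIGMA n:UNIV. D n) (SIGMA n:UNIV. R n)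
    (\<lambda>(n, x). (n, t n x)) (\<lambda>(n, x). (n, u n x))"
proof -
  note d = p[unfolded partial_automorphism_def]
  have S: "Pair n -` (SIGMA n:UNIV. X n) = X n" for X :: "nat \<Rightarrow> 'a set" and n by auto
  have m: "Pair n -` {z \<in> SIGMA n:UNIV. X n. (case z of (n, x) \<Rightarrow> (n, s n x)) \<in> A} = {x \<in> X n. s n x \<in> Pair n
      -` A}"
    for X :: "nat \<Rightarrow> 'a set" and s A n by auto
  have i: "Pair n -` ((\<lambda>(n, x). (n, t n x)) ` A) = t n ` (Pair n -` A)" for n A
    by (force simp: image_iff)
  show ?thesis
    unfolding partial_automorphism_def sets_disj_measure_iff null_sets_disj_measure_iff S m i
  proof (intro conjI ballI allI impI)
    fix A assume A: "A \<in> sets (disj_measure M)"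
    fix n
    have "Pair n -` A \<in> sets (M n)" using A by (simp add: sets_disj_measure_iff)
    then show "{x \<in> D n. t n x \<in> Pair n -` A} \<in> sets (M n)" "{x \<in> R n. u n x \<in> Pair n -` A} \<in> sets (M n)"
      using d by blast+
  next
    fix A assume A: "A \<in> sets (disj_measure M)" "A \<subseteq> Sigma UNIV D"
    have "t n ` (Pair n -` A) \<in> null_sets (M n) \<longleftrightarrow> Pair n -` A \<in> null_sets (M n)" for n
    proof -
      have "Pair n -` A \<in> sets (M n)" "Pair n -` A \<subseteq> D n" using A by (auto simp: sets_disj_measure_iff)
      then show ?thesis using d by blast
    qed
    then show "(\<forall>n. t n ` Pair n -` A \<in> null_sets (M n)) = (\<forall>n. Pair n -` A \<in> null_sets (M n))" by simp
  qed (use d in auto)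
qed

lemma partial_automorphism_fibre:
  assumes p: "partial_automorphism (disj_measure M) D R t u" and f: "\<And>z. z \<in> D \<Longrightarrow> fst (t z) = fst z"
  shows "partial_automorphism (M n) (Pair n -` D) (Pair n -` R) (\<lambda>x. snd (t (n, x))) (\<lambda>x. snd (u (n, x)))"
proof -
  note d = p[unfolded partial_automorphism_def]
  have tn: "t (n, x) = (n, snd (t (n, x)))" if "(n, x) \<in> D" for x using f[OF that] by (metis fst_conv
      prod.collapse)
  have un: "u (n, y) = (n, snd (u (n, y)))" if "(n, y) \<in> R" for y
    using f[of "u (n, y)"] d that by (metis fst_conv prod.collapse)
  have Pn: "Pair n ` A \<in> sets (disj_measure M)" if "A \<in> sets (M n)" for A
    unfolding sets_disj_measure using that by (intro sigma_sets.Basic) auto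
  have nul: "A \<in> null_sets (M n) \<longleftrightarrow> Pair n ` A \<in> null_sets (disj_measure M)" if "A \<in> sets (M n)" for A
    using that Pn[OF that] by (simp add: null_sets_def emeasure_disj_measure_component)
  have m1: "{x \<in> Pair n -` D. snd (t (n, x)) \<in> A} = Pair n -` {z \<in> D. t z \<in> Pair n ` A}" for A
  proof (intro set_eqI)
    fix x show "x \<in> {x \<in> Pair n -` D. snd (t (n, x)) \<in> A} \<longleftrightarrow> x \<in> Pair n -` {z \<in> D. t z \<in> Pair n ` A}"
      using tn[of x] by (cases "t (n, x)") (auto simp: image_iff)
  qed
  have m2: "{x \<in> Pair n -` R. snd (u (n, x)) \<in> A} = Pair n -` {z \<in> R. u z \<in> Pair n ` A}" for A
  proof (intro set_eqI)
    fix x show "x \<in> {x \<in> Pair n -` R. snd (u (n, x)) \<in> A} \<longleftrightarrow> x \<in> Pair n -` {z \<in> R. u z \<in> Pair n ` A}"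
      using un[of x] by (cases "u (n, x)") (auto simp: image_iff)
  qed
  show ?thesis
    unfolding partial_automorphism_def m1 m2
  proof (intro conjI ballI allI impI)
    show "Pair n -` D \<in> sets (M n)" "Pair n -` R \<in> sets (M n)" using d by (auto simp: sets_disj_measure_iff)
    show "snd (t (n, x)) \<in> Pair n -` R" "snd (u (n, snd (t (n, x)))) = x" if "x \<in> Pair n -` D" for x
    proof -
      have x: "(n, x) \<in> D" using that by simp
      then have "t (n, x) \<in> R" "u (t (n, x)) = (n, x)" using d by blast+
      then show "snd (t (n, x)) \<in> Pair n -` R" "snd (u (n, snd (t (n, x)))) = x"
        using tn[OF x] by (metis vimageI2, metis snd_conv)
    qed
    show "snd (u (n, x)) \<in> Pair n -` D" "snd (t (n, snd (u (n, x)))) = x" if "x \<in> Pair n -` R" for x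
    proof -
      have x: "(n, x) \<in> R" using that by simp
      then have "u (n, x) \<in> D" "t (u (n, x)) = (n, x)" using d by blast+
      then show "snd (u (n, x)) \<in> Pair n -` D" "snd (t (n, snd (u (n, x)))) = x"
        using un[OF x] by (metis vimageI2, metis snd_conv)
    qed
    show "Pair n -` {z \<in> D. t z \<in> Pair n ` A} \<in> sets (M n)" "Pair n -` {z \<in> R. u z \<in> Pair n ` A} \<in> sets (M n)"
      if "A \<in> sets (M n)" for A
      using d Pn[OF that] sets_vimage_Pair_disj_measure by blast+
  next
    fix A assume A: "A \<in> sets (M n)" "A \<subseteq> Pair n -` D"
    then have "Pair n ` A \<subseteq> D" by auto
    then have "t ` Pair n ` A \<in> null_sets (disj_measure M) \<longleftrightarrow> Pair n ` A \<in> null_sets (disj_measure M)"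
      and s: "t ` Pair n ` A \<in> sets (disj_measure M)"
      using d Pn[OF A(1)] partial_automorphism_image_sets[OF p] by blast+
    moreover have "t ` Pair n ` A = Pair n ` (\<lambda>x. snd (t (n, x))) ` A"
      using tn A(2) by (force simp: image_iff)
    moreover have "(\<lambda>x. snd (t (n, x))) ` A \<in> sets (M n)"
    proof -
      have "(\<lambda>x. snd (t (n, x))) ` A = Pair n -` t ` Pair n ` A" unfolding calculation(3) by auto
      then show ?thesis using s sets_vimage_Pair_disj_measure by metis
    qed
    ultimately show "((\<lambda>x. snd (t (n, x))) ` A \<in> null_sets (M n)) = (A \<in> null_sets (M n))"
      using nul A(1) by simp
  qed
qed

lemma disj_groupoid_simps [simp]:
  "arrows (disj_groupoid G) = (SIGMA n:UNIV. arrows (G n))"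
  "unit_space (disj_groupoid G) = (SIGMA n:UNIV. unit_space (G n))"
  "src (disj_groupoid G) (n, a) = (n, src (G n) a)"
  "rng (disj_groupoid G) (n, a) = (n, rng (G n) a)"
  "ginv (disj_groupoid G) (n, a) = (n, ginv (G n) a)"
  "disj_length len (n, a) = len n a"
  by (auto simp: disj_groupoid_def disj_length_def)

text \<open>A length bound common to all fibres is what makes the union admissible.\<close>

lemma admissible_disj_groupoid:
  assumes G: "\<And>n. groupoid (G n)" and len: "\<And>n. length_function (G n) (len n)"
    and K: "\<And>n. admissible (G n) (len n) (M n) (K n)" and L: "\<And>n a. a \<in> K n \<Longrightarrow> len n a \<le> L"
  shows "admissible (disj_groupoid G) (disj_length len) (disj_measure M) (SIGMA n:UNIV. K n)"
proof -
  have "\<exists>t u. partial_automorphism (M n) (src (G n) ` K n) (rng (G n) ` K n) t u \<and>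
      (\<forall>a\<in>K n. rng (G n) a = t (src (G n) a))" for n
    using K[of n] by (subst (asm) admissible_iff_partial_automorphism[OF G len]) blast
  then obtain t u where p: "\<And>n. partial_automorphism (M n) (src (G n) ` K n) (rng (G n) ` K n) (t n) (u n)"
    and t: "\<And>n a. a \<in> K n \<Longrightarrow> rng (G n) a = t n (src (G n) a)" by metis
  have k: "K n \<subseteq> arrows (G n)" "inj_on (src (G n)) (K n)" for n
    using K[of n] by (auto simp: admissible_def bisection_def)
  show ?thesis
  proof (rule admissibleI[OF groupoid_disj_groupoid[OF G] length_function_disj_length[OF len] _ _ _
        partial_automorphism_disj_measure[OF p]])
    show "inj_on (src (disj_groupoid G)) (Sigma UNIV K)"
    proof (rule inj_onI)
      fix y z assume "y \<in> Sigma UNIV K" "z \<in> Sigma UNIV K" "src (disj_groupoid G) y = src (disj_groupoid G) z"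
      then obtain n a b where "y = (n, a)" "z = (n, b)" "a \<in> K n" "b \<in> K n" "src (G n) a = src (G n) b" by auto
      then show "y = z" using k(2)[of n] by (metis inj_onD)
    qed
    show "a \<in> Sigma UNIV K \<Longrightarrow> disj_length len a \<le> L" for a using L by (cases a) auto
    show "Sigma UNIV K \<subseteq> arrows (disj_groupoid G)" using k(1) by auto
    show "src (disj_groupoid G) ` Sigma UNIV K = (SIGMA n:UNIV. src (G n) ` K n)"
      "rng (disj_groupoid G) ` Sigma UNIV K = (SIGMA n:UNIV. rng (G n) ` K n)"
      by (force simp: image_iff)+
    show "rng (disj_groupoid G) a = (case src (disj_groupoid G) a of (n, x) \<Rightarrow> (n, t n x))"
      if "a \<in> Sigma UNIV K" for a using that t by auto
  qed
qed

lemma admissible_fibre: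
  assumes G: "\<And>n. groupoid (G n)" and len: "\<And>n. length_function (G n) (len n)"
    and K: "admissible (disj_groupoid G) (disj_length len) (disj_measure M) K"
  shows "admissible (G n) (len n) (M n) (Pair n -` K)"
proof -
  let ?G = "disj_groupoid G"
  from admissibleE[OF groupoid_disj_groupoid[OF G] length_function_disj_length[OF len] K]
  obtain t u L where k: "K \<subseteq> arrows ?G" "inj_on (src ?G) K" "\<And>a. a \<in> K \<Longrightarrow> disj_length len a \<le> L"
    "partial_automorphism (disj_measure M) (src ?G ` K) (rng ?G ` K) t u" "\<And>a. a \<in> K \<Longrightarrow> rng ?G a = t (src ?G a)"
    by metis
  have t: "t (n, src (G n) a) = (n, rng (G n) a)" if "(n, a) \<in> K" for n a using k(5)[OF that] by simp
  have f: "fst (t z) = fst z" if "z \<in> src ?G ` K" for z using that t by auto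
  show ?thesis
  proof (rule admissibleI[OF G len _ _ _ partial_automorphism_fibre[OF k(4) f]])
    show "inj_on (src (G n)) (Pair n -` K)"
    proof (rule inj_onI)
      fix a b assume "a \<in> Pair n -` K" "b \<in> Pair n -` K" "src (G n) a = src (G n) b"
      then have "(n, a) \<in> K" "(n, b) \<in> K" "src ?G (n, a) = src ?G (n, b)" by auto
      then have "(n, a) = (n, b)" using k(2) by (metis inj_onD)
      then show "a = b" by simp
    qed
    show "len n a \<le> L" if "a \<in> Pair n -` K" for a using k(3)[of "(n, a)"] that by simp
    show "src (G n) ` Pair n -` K = Pair n -` src ?G ` K" "rng (G n) ` Pair n -` K = Pair n -` rng ?G ` K"
      by (force simp: image_iff)+
  qed (use k(1) t in auto)
qed

lemma range_act_fibre:
  "Pair n -` range_act (disj_groupoid G) K A = range_act (G n) (Pair n -` K) (Pair n -` A)"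
  unfolding range_act_def by force

lemma L2_fibre:
  assumes "f \<in> L2 (disj_measure M)"
  shows "(\<lambda>x. f (n, x)) \<in> L2 (M n)" "L2_norm (M n) (\<lambda>x. f (n, x)) \<le> L2_norm (disj_measure M) f"
proof -
  note fm = L2_measurable[OF assms]
  have m: "(\<lambda>x. f (n, x)) \<in> borel_measurable (M n)" using fm by (simp add: measurable_disj_measure_iff)
  have "(\<integral>\<^sup>+x. ennreal ((cmod (f (n, x)))\<^sup>2) \<partial>M n) \<le> (\<Sum>n. \<integral>\<^sup>+x. ennreal ((cmod (f (n, x)))\<^sup>2) \<partial>M n)"
    using sum_le_suminf[of "\<lambda>n. \<integral>\<^sup>+x. ennreal ((cmod (f (n, x)))\<^sup>2) \<partial>M n" "{n}"] by simp
  also have "\<dots> = (\<integral>\<^sup>+z. ennreal ((cmod (f z))\<^sup>2) \<partial>disj_measure M)"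
    using fm by (intro nn_integral_disj_measure[symmetric]) measurable
  finally have le: "(\<integral>\<^sup>+x. ennreal ((cmod (f (n, x)))\<^sup>2) \<partial>M n) \<le> ennreal ((L2_norm (disj_measure M) f)\<^sup>2)"
    by (simp add: nn_integral_eq_L2_norm[OF assms])
  then show L: "(\<lambda>x. f (n, x)) \<in> L2 (M n)"
    using m le_less_trans[OF le ennreal_less_top] by (simp add: L2_iff_nn_integral)
  show "L2_norm (M n) (\<lambda>x. f (n, x)) \<le> L2_norm (disj_measure M) f"
    by (rule L2_norm_leI[OF L2_norm_nonneg le L])
qed

lemma L2_norm_fibrewise:
  assumes f: "f \<in> L2 (disj_measure M)" and F: "\<And>n. (\<lambda>x. F (n, x)) \<in> L2 (M n)" and c: "0 \<le> c"
    and le: "\<And>n. L2_norm (M n) (\<lambda>x. F (n, x)) \<le> c * L2_norm (M n) (\<lambda>x. f (n, x))"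
  shows "F \<in> L2 (disj_measure M)" "L2_norm (disj_measure M) F \<le> c * L2_norm (disj_measure M) f"
proof -
  note fm = L2_measurable[OF f]
  have m: "F \<in> borel_measurable (disj_measure M)"
    using F by (auto simp: measurable_disj_measure_iff dest: L2_measurable)
  have "(\<integral>\<^sup>+z. ennreal ((cmod (F z))\<^sup>2) \<partial>disj_measure M) = (\<Sum>n. \<integral>\<^sup>+x. ennreal ((cmod (F (n, x)))\<^sup>2) \<partial>M n)"
    using m by (intro nn_integral_disj_measure) measurable
  also have "\<dots> \<le> (\<Sum>n. ennreal (c\<^sup>2) * (\<integral>\<^sup>+x. ennreal ((cmod (f (n, x)))\<^sup>2) \<partial>M n))"
  proof (intro suminf_le summableI)
    fix n
    have "(L2_norm (M n) (\<lambda>x. F (n, x)))\<^sup>2 \<le> (c * L2_norm (M n) (\<lambda>x. f (n, x)))\<^sup>2"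
      using le by (intro power_mono L2_norm_nonneg)
    then show "(\<integral>\<^sup>+x. ennreal ((cmod (F (n, x)))\<^sup>2) \<partial>M n) \<le> ennreal (c\<^sup>2) * (\<integral>\<^sup>+x. ennreal ((cmod (f (n,
        x)))\<^sup>2) \<partial>M n)"
      unfolding nn_integral_eq_L2_norm[OF F] nn_integral_eq_L2_norm[OF L2_fibre(1)[OF f]]
      by (simp add: ennreal_mult[symmetric] ennreal_leI power_mult_distrib)
  qed
  also have "\<dots> = ennreal (c\<^sup>2) * (\<integral>\<^sup>+z. ennreal ((cmod (f z))\<^sup>2) \<partial>disj_measure M)"
    using fm by (subst nn_integral_disj_measure) auto
  also have "\<dots> = ennreal ((c * L2_norm (disj_measure M) f)\<^sup>2)"
    by (simp add: nn_integral_eq_L2_norm[OF f] ennreal_mult[symmetric] power_mult_distrib)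
  finally have le: "(\<integral>\<^sup>+z. ennreal ((cmod (F z))\<^sup>2) \<partial>disj_measure M) \<le> ennreal ((c * L2_norm (disj_measure M)
      f)\<^sup>2)" .
  then show L: "F \<in> L2 (disj_measure M)"
    using m le_less_trans[OF le ennreal_less_top] by (simp add: L2_iff_nn_integral)
  show "L2_norm (disj_measure M) F \<le> c * L2_norm (disj_measure M) f"
    by (rule L2_norm_leI[OF mult_nonneg_nonneg[OF c L2_norm_nonneg] le L])
qed

definition single_fibre :: "nat \<Rightarrow> ('a \<Rightarrow> complex) \<Rightarrow> nat \<times> 'a \<Rightarrow> complex" where
  "single_fibre n f = (\<lambda>(m, x). if m = n then f x else 0)"

lemma single_fibre_L2:
  assumes f: "f \<in> L2 (M n)"
  shows "single_fibre n f \<in> L2 (disj_measure M)" "L2_norm (disj_measure M) (single_fibre n f) = L2_norm (M n) f"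
proof -
  have m: "single_fibre n f \<in> borel_measurable (disj_measure M)"
    unfolding measurable_disj_measure_iff
  proof
    fix m show "(\<lambda>x. single_fibre n f (m, x)) \<in> borel_measurable (M m)"
      using L2_measurable[OF f] by (cases "m = n") (simp_all add: single_fibre_def)
  qed
  have "(\<integral>\<^sup>+z. ennreal ((cmod (single_fibre n f z))\<^sup>2) \<partial>disj_measure M)
      = (\<Sum>m. \<integral>\<^sup>+x. ennreal ((cmod (single_fibre n f (m, x)))\<^sup>2) \<partial>M m)"
    using m by (intro nn_integral_disj_measure) measurable
  also have "\<dots> = (\<Sum>m\<in>{n}. \<integral>\<^sup>+x. ennreal ((cmod (single_fibre n f (m, x)))\<^sup>2) \<partial>M m)"
    by (intro suminf_finite) (auto simp: single_fibre_def)
  finally have eq: "(\<integral>\<^sup>+z. ennreal ((cmod (single_fibre n f z))\<^sup>2) \<partial>disj_measure M) = ennreal ((L2_norm (M n)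
      f)\<^sup>2)"
    by (simp add: single_fibre_def nn_integral_eq_L2_norm[OF f])
  then show L: "single_fibre n f \<in> L2 (disj_measure M)" using m by (simp add: L2_iff_nn_integral)
  have "ennreal ((L2_norm (disj_measure M) (single_fibre n f))\<^sup>2) = ennreal ((L2_norm (M n) f)\<^sup>2)"
    using eq by (simp add: nn_integral_eq_L2_norm[OF L])
  then show "L2_norm (disj_measure M) (single_fibre n f) = L2_norm (M n) f"
    using L2_norm_nonneg[of "M n" f] L2_norm_nonneg[of "disj_measure M" "single_fibre n f"]
    by (simp add: power2_eq_iff_nonneg)
qed

section \<open>Walks along bisections\<close>

definition extend_by_id :: "'a set \<Rightarrow> ('a \<Rightarrow> 'a) \<Rightarrow> 'a \<Rightarrow> 'a" where
  "extend_by_id D t x = (if x \<in> D then t x else x)"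

lemma extend_by_id_measurable:
  assumes p: "partial_automorphism M D R t u"
  shows "extend_by_id D t \<in> measurable M M"
proof (rule measurableI)
  note d = partial_automorphismD[OF p]
  show "extend_by_id D t x \<in> space M" if "x \<in> space M" for x
    using that d(3) sets.sets_into_space[OF d(2)] by (auto simp: extend_by_id_def)
  fix A assume A: "A \<in> sets M"
  have "extend_by_id D t -` A \<inter> space M = {x\<in>D. t x \<in> A} \<union> (A - D)"
    using sets.sets_into_space[OF A] sets.sets_into_space[OF d(1)] by (auto simp: extend_by_id_def split:
        if_splits)
  then show "extend_by_id D t -` A \<inter> space M \<in> sets M" using d(1,7) A by auto
qed

text \<open>\<open>\<rho>\<close> is the Radon--Nikodym derivative of the pullback of \<open>N\<close>
  along \<open>t\<close>. Preservation of null sets makes the pullback absolutely continuous, and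
  finiteness allows \<open>\<rho>\<close> to be real-valued.\<close>

lemma change_of_variables:
  assumes N: "finite_measure N" and p: "partial_automorphism N D R t u"
  obtains \<rho> :: "'a \<Rightarrow> real" where "\<rho> \<in> borel_measurable N" "\<And>x. 0 \<le> \<rho> x"
    "\<And>f. f \<in> borel_measurable N \<Longrightarrow>
      (\<integral>\<^sup>+x. ennreal (\<rho> x) * (indicator D x * f x) \<partial>N) = (\<integral>\<^sup>+y. indicator R y * f (u y) \<partial>N)"
proof -
  interpret finite_measure N by fact
  note d = partial_automorphismD[OF p]
  let ?u = "extend_by_id R u"
  have u: "?u \<in> measurable N N" by (rule extend_by_id_measurable[OF partial_automorphism_inverse[OF p]])
  define Q where "Q = distr (density N (indicator R)) N ?u"
  have sQ: "sets Q = sets N" by (simp add: Q_def)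
  have int: "(\<integral>\<^sup>+x. f x \<partial>Q) = (\<integral>\<^sup>+y. indicator R y * f (?u y) \<partial>N)" if "f \<in> borel_measurable N" for f
  proof -
    have "(\<lambda>y. f (?u y)) \<in> borel_measurable N" using measurable_compose[OF u that] .
    then show ?thesis unfolding Q_def using u that d(2) by (simp add: nn_integral_distr nn_integral_density)
  qed
  have fQ: "finite_measure Q"
  proof
    have "emeasure Q (space Q) = (\<integral>\<^sup>+x. 1 \<partial>Q)" by simp
    also have "\<dots> = (\<integral>\<^sup>+y. indicator R y \<partial>N)" by (subst int) auto
    also have "\<dots> < \<infinity>" using d(2) by (simp add: emeasure_eq_measure)
    finally show "emeasure Q (space Q) \<noteq> \<infinity>" by simp
  qed
  interpret Q: finite_measure Q by (rule fQ)
  have ac: "absolutely_continuous N Q"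
    unfolding absolutely_continuous_def
  proof
    fix A assume A: "A \<in> null_sets N"
    have "emeasure Q A = (\<integral>\<^sup>+x. indicator A x \<partial>Q)" using A by (simp add: sQ null_setsD2)
    also have "\<dots> = (\<integral>\<^sup>+y. indicator R y * indicator A (?u y) \<partial>N)" using A by (subst int) auto
    also have "\<dots> = (\<integral>\<^sup>+y. indicator (t ` (A \<inter> D)) y \<partial>N)"
      unfolding partial_automorphism_image_eq[OF p Int_lower2]
      by (intro nn_integral_cong) (use d(5) in \<open>auto simp: indicator_def extend_by_id_def\<close>)
    also have "\<dots> = 0"
    proof -
      have "A \<inter> D \<in> null_sets N" using A d(1) by (simp add: null_set_Int2)
      then have "t ` (A \<inter> D) \<in> null_sets N" using d(9)[of "A \<inter> D"] by auto
      then show ?thesis by (simp add: null_setsD1 null_setsD2)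
    qed
    finally show "A \<in> null_sets Q" using A by (auto simp: sQ null_sets_def)
  qed
  let ?r = "RN_deriv N Q"
  have dens: "density N ?r = Q" using ac sQ by (rule density_RN_deriv)
  have fin: "AE x in N. ?r x \<noteq> \<infinity>"
    using ac sQ by (intro RN_deriv_finite Q.sigma_finite_measure_axioms) auto
  show thesis
  proof (rule that[of "\<lambda>x. enn2real (?r x)"])
    show "(\<lambda>x. enn2real (?r x)) \<in> borel_measurable N" by measurable
    fix f :: "'a \<Rightarrow> ennreal" assume f[measurable]: "f \<in> borel_measurable N"
    note [measurable] = d(1)
    have "(\<integral>\<^sup>+x. ennreal (enn2real (?r x)) * (indicator D x * f x) \<partial>N) = (\<integral>\<^sup>+x. ?r x * (indicator D x * f x)
        \<partial>N)"
      using fin by (intro nn_integral_cong_AE) (auto simp: top.not_eq_extremum)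
    also have "\<dots> = (\<integral>\<^sup>+x. indicator D x * f x \<partial>density N ?r)" by (subst nn_integral_density) auto
    also have "\<dots> = (\<integral>\<^sup>+y. indicator R y * (indicator D (?u y) * f (?u y)) \<partial>N)"
      unfolding dens by (subst int) auto
    also have "\<dots> = (\<integral>\<^sup>+y. indicator R y * f (u y) \<partial>N)"
      using d(5) by (intro nn_integral_cong) (auto simp: indicator_def extend_by_id_def)
    finally show "(\<integral>\<^sup>+x. ennreal (enn2real (?r x)) * (indicator D x * f x) \<partial>N) = (\<integral>\<^sup>+y. indicator R y * f (u
        y) \<partial>N)" .
  qed simp
qed

text \<open>The second component tells the direction: \<open>True\<close> moves along \<open>t
  i\<close>, \<open>False\<close> back along \<open>u i\<close>. Outside their domains the maps are the
  identity, and there the weights used below vanish.\<close>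

definition doubled_maps ::
    "('i \<Rightarrow> 'a set) \<Rightarrow> ('i \<Rightarrow> 'a set) \<Rightarrow> ('i \<Rightarrow> 'a \<Rightarrow> 'a) \<Rightarrow> ('i \<Rightarrow> 'a \<Rightarrow> 'a) \<Rightarrow> 'i \<times> bool \<Rightarrow> 'a \<Rightarrow> 'a" where
  "doubled_maps D R t u = (\<lambda>(i, b). if b then extend_by_id (D i) (t i) else extend_by_id (R i) (u i))"

text \<open>With \<open>\<rho>\<close> as in the change of variables, the weight \<open>min 1
  \<rho>\<close> along \<open>t\<close> corresponds to the weight \<open>min 1 (1/\<rho>)\<close>,
  evaluated at \<open>u y\<close>, on the way back. Both are at most \<open>1\<close>, and exchanging
  them is exactly reversibility. The last property quantifies what is lost by truncating:
  \<open>\<rho>\<close> integrates to at most \<open>1\<close>, so it exceeds \<open>m\<close> only on a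
  set \<open>Z\<close> of measure at most \<open>1/m\<close>, and elsewhere \<open>\<rho> \<le> m min 1
  \<rho>\<close>.\<close>

lemma reversible_walk_of_partial_automorphisms:
  fixes D R :: "'i \<Rightarrow> 'a set"
  assumes N: "finite_measure N" and N1: "measure N (space N) = 1" and I: "finite I" "I \<noteq> {}"
    and p: "\<And>i. i \<in> I \<Longrightarrow> partial_automorphism N (D i) (R i) (t i) (u i)"
  obtains w where "reversible_walk N (I \<times> UNIV) (doubled_maps D R t u) w"
    "\<And>i x. i \<in> I \<Longrightarrow> x \<notin> D i \<Longrightarrow> w (i, True) x = 0" "\<And>i x. i \<in> I \<Longrightarrow> x \<notin> R i \<Longrightarrow> w (i, False) x = 0"
    "\<And>i m. i \<in> I \<Longrightarrow> 1 \<le> m \<Longrightarrow> \<exists>Z\<in>sets N. measure N Z \<le> 1 / m \<and>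
      (\<forall>X\<in>sets N. X \<subseteq> D i - Z \<longrightarrow> emeasure N (t i ` X) \<le> ennreal m * (\<integral>\<^sup>+x. ennreal (w (i, True) x) * indicator
          X x \<partial>N))"
proof -
  interpret finite_measure N by fact
  note d = partial_automorphismD[OF p]
  have "\<forall>i\<in>I. \<exists>\<rho>::'a \<Rightarrow> real. \<rho> \<in> borel_measurable N \<and> (\<forall>x. 0 \<le> \<rho> x) \<and> (\<forall>f\<in>borel_measurable N.
      (\<integral>\<^sup>+x. ennreal (\<rho> x) * (indicator (D i) x * f x) \<partial>N) = (\<integral>\<^sup>+y. indicator (R i) y * f (u i y) \<partial>N))"
  proof
    fix i assume i: "i \<in> I"
    show "\<exists>\<rho>::'a \<Rightarrow> real. \<rho> \<in> borel_measurable N \<and> (\<forall>x. 0 \<le> \<rho> x) \<and> (\<forall>f\<in>borel_measurable N.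
      (\<integral>\<^sup>+x. ennreal (\<rho> x) * (indicator (D i) x * f x) \<partial>N) = (\<integral>\<^sup>+y. indicator (R i) y * f (u i y) \<partial>N))"
      by (rule change_of_variables[OF N p[OF i]]) blast
  qed
  from bchoice[OF this] obtain \<rho> :: "'i \<Rightarrow> 'a \<Rightarrow> real" where \<rho>: "\<And>i. i \<in> I \<Longrightarrow> \<rho> i \<in> borel_measurable N" "\<And>i x. i
      \<in> I \<Longrightarrow> 0 \<le> \<rho> i x"
    and cv: "\<And>i f. i \<in> I \<Longrightarrow> f \<in> borel_measurable N \<Longrightarrow>
      (\<integral>\<^sup>+x. ennreal (\<rho> i x) * (indicator (D i) x * f x) \<partial>N) = (\<integral>\<^sup>+y. indicator (R i) y * f (u i y) \<partial>N)"
    by blast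
  define v where "v i x = (if \<rho> i x = 0 then 0 else min 1 (\<rho> i x) / \<rho> i x)" for i x
  define w where "w = (\<lambda>(i, b) x. if b then indicator (D i) x * min 1 (\<rho> i x) else indicator (R i) x * v i
      (extend_by_id (R i) (u i) x))"
  let ?t = "doubled_maps D R t u"
  have v: "0 \<le> v i x" "v i x \<le> 1" "\<rho> i x * v i x = min 1 (\<rho> i x)" if "i \<in> I" for i x
    using \<rho>(2)[OF that, of x] by (auto simp: v_def min_def)
  have vm: "v i \<in> borel_measurable N" if "i \<in> I" for i
    unfolding v_def using \<rho>(1)[OF that] by measurable
  have tm: "?t (i, b) \<in> measurable N N" if "i \<in> I" for i b
    using extend_by_id_measurable[OF p[OF that]] extend_by_id_measurable[OF partial_automorphism_inverse[OF
        p[OF that]]]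
    by (cases b) (simp_all add: doubled_maps_def)
  have key: "(\<integral>\<^sup>+x. ennreal (w (i, True) x) * f (x, ?t (i, True) x) \<partial>N) = (\<integral>\<^sup>+x. ennreal (w (i, False) x) * f
      (?t (i, False) x, x) \<partial>N)"
    if i: "i \<in> I" and f[measurable]: "f \<in> borel_measurable (N \<Otimes>\<^sub>M N)" for i f
  proof -
    note [measurable] = vm[OF i] tm[OF i, of True]
    have "(\<integral>\<^sup>+x. ennreal (w (i, True) x) * f (x, ?t (i, True) x) \<partial>N) =
      (\<integral>\<^sup>+x. ennreal (\<rho> i x) * (indicator (D i) x * (ennreal (v i x) * f (x, ?t (i, True) x))) \<partial>N)"
    proof (rule nn_integral_cong)
      fix x
      have "ennreal (min 1 (\<rho> i x)) = ennreal (\<rho> i x) * ennreal (v i x)"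
        using v[OF i] \<rho>(2)[OF i] by (simp add: ennreal_mult[symmetric])
      then show "ennreal (w (i, True) x) * f (x, ?t (i, True) x) =
          ennreal (\<rho> i x) * (indicator (D i) x * (ennreal (v i x) * f (x, ?t (i, True) x)))"
        by (auto simp: w_def indicator_def mult.assoc)
    qed
    also have "\<dots> = (\<integral>\<^sup>+y. indicator (R i) y * (ennreal (v i (u i y)) * f (u i y, ?t (i, True) (u i y))) \<partial>N)"
      by (rule cv[OF i]) measurable
    also have "\<dots> = (\<integral>\<^sup>+x. ennreal (w (i, False) x) * f (?t (i, False) x, x) \<partial>N)"
      using d(5,6)[OF i] by (intro nn_integral_cong) (auto simp: w_def indicator_def doubled_maps_def
          extend_by_id_def)
    finally show ?thesis .
  qed
  show thesis
  proof (rule that[of w])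
    show "reversible_walk N (I \<times> UNIV) ?t w"
    proof (unfold_locales)
      fix j assume "j \<in> I \<times> (UNIV :: bool set)"
      then obtain i b where j: "j = (i, b)" "i \<in> I" by auto
      note [measurable] = d(1,2)[OF j(2)] \<rho>(1)[OF j(2)] vm[OF j(2)] extend_by_id_measurable[OF
          partial_automorphism_inverse[OF p[OF j(2)]]]
      show "?t j \<in> measurable N N" using tm j by simp
      show "w j \<in> borel_measurable N" unfolding w_def j by (cases b) simp_all
      show "0 \<le> w j x" "w j x \<le> 1" for x
        using v(1,2)[OF j(2)] \<rho>(2)[OF j(2)] by (auto simp: w_def j indicator_def)
    next
      fix f :: "'a \<times> 'a \<Rightarrow> ennreal" assume f[measurable]: "f \<in> borel_measurable (N \<Otimes>\<^sub>M N)"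
      have f': "(\<lambda>(x, y). f (y, x)) \<in> borel_measurable (N \<Otimes>\<^sub>M N)" by measurable
      have split: "(\<Sum>j\<in>I \<times> (UNIV :: bool set). F j) = (\<Sum>i\<in>I. F (i, True) + F (i, False))" for F :: "'i \<times> bool
          \<Rightarrow> ennreal"
        by (simp add: sum.cartesian_product' UNIV_bool add.commute)
      show "(\<Sum>j\<in>I \<times> UNIV. \<integral>\<^sup>+x. ennreal (w j x) * f (x, ?t j x) \<partial>N) = (\<Sum>j\<in>I \<times> UNIV. \<integral>\<^sup>+x. ennreal (w j x) * f
          (?t j x, x) \<partial>N)"
        unfolding split using key[OF _ f] key[OF _ f'] by (intro sum.cong) (auto simp: add.commute)
    qed (use I in auto)
    fix i assume i: "i \<in> I"
    show "w (i, True) x = 0" if "x \<notin> D i" for x using that by (simp add: w_def)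
    show "w (i, False) x = 0" if "x \<notin> R i" for x using that by (simp add: w_def)
    fix m :: real assume m: "1 \<le> m"
    note [measurable] = d(1,2)[OF i] \<rho>(1)[OF i]
    define Z where "Z = {x\<in>D i. m < \<rho> i x}"
    have Z: "Z \<in> sets N"
    proof -
      have "Z = D i \<inter> {x\<in>space N. m < \<rho> i x}" using sets.sets_into_space[OF d(1)[OF i]] by (auto simp: Z_def)
      then show ?thesis by simp
    qed
    have "ennreal m * emeasure N Z = (\<integral>\<^sup>+x. ennreal m * indicator Z x \<partial>N)" using Z by (simp add:
        nn_integral_cmult_indicator)
    also have "\<dots> \<le> (\<integral>\<^sup>+x. ennreal (\<rho> i x) * (indicator (D i) x * 1) \<partial>N)"
    proof (rule nn_integral_mono)
      fix x show "ennreal m * indicator Z x \<le> ennreal (\<rho> i x) * (indicator (D i) x * 1)"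
        by (cases "x \<in> Z") (simp_all add: Z_def ennreal_leI)
    qed
    also have "\<dots> = (\<integral>\<^sup>+y. indicator (R i) y * 1 \<partial>N)" by (rule cv[OF i]) simp
    also have "\<dots> = ennreal (measure N (R i))" using d(2)[OF i] by (simp add: emeasure_eq_measure)
    also have "\<dots> \<le> ennreal 1" using bounded_measure[of "R i"] N1 by (intro ennreal_leI) simp
    finally have "ennreal (m * measure N Z) \<le> ennreal 1" using m by (simp add: emeasure_eq_measure ennreal_mult)
    then have "m * measure N Z \<le> 1" by (subst (asm) ennreal_le_iff) simp_all
    then have "measure N Z \<le> 1 / m" using m by (simp add: pos_le_divide_eq mult.commute)
    moreover have "emeasure N (t i ` X) \<le> ennreal m * (\<integral>\<^sup>+x. ennreal (w (i, True) x) * indicator X x \<partial>N)"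
      if X: "X \<in> sets N" "X \<subseteq> D i - Z" for X
    proof -
      note [measurable] = X(1)
      have XD: "X \<subseteq> D i" using X by auto
      have "emeasure N (t i ` X) = (\<integral>\<^sup>+y. indicator (t i ` X) y \<partial>N)"
        using partial_automorphism_image_sets[OF p[OF i] X(1) XD] by simp
      also have "\<dots> = (\<integral>\<^sup>+y. indicator (R i) y * indicator X (u i y) \<partial>N)"
        unfolding partial_automorphism_image_eq[OF p[OF i] XD] by (intro nn_integral_cong) (auto simp:
            indicator_def)
      also have "\<dots> = (\<integral>\<^sup>+x. ennreal (\<rho> i x) * (indicator (D i) x * indicator X x) \<partial>N)"
        by (rule cv[OF i, symmetric]) measurable
      also have "\<dots> \<le> (\<integral>\<^sup>+x. ennreal m * (ennreal (w (i, True) x) * indicator X x) \<partial>N)"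
      proof (rule nn_integral_mono)
        fix x
        have "\<rho> i x \<le> m * min 1 (\<rho> i x)" if "x \<in> X"
        proof -
          have "\<rho> i x \<le> m" using that X by (auto simp: Z_def)
          then show ?thesis using m mult_right_mono[OF m \<rho>(2)[OF i, of x]] by (auto simp: min_def)
        qed
        then show "ennreal (\<rho> i x) * (indicator (D i) x * indicator X x) \<le> ennreal m * (ennreal (w (i, True)
            x) * indicator X x)"
          using m \<rho>(2)[OF i, of x] XD by (auto simp: indicator_def w_def ennreal_mult[symmetric] intro!:
              ennreal_leI)
      qed
      also have "\<dots> = ennreal m * (\<integral>\<^sup>+x. ennreal (w (i, True) x) * indicator X x \<partial>N)"
      proof (rule nn_integral_cmult)
        have "(\<lambda>x. ennreal (indicator (D i) x * min 1 (\<rho> i x)) * indicator X x) \<in> borel_measurable N" by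
            measurable
        then show "(\<lambda>x. ennreal (w (i, True) x) * indicator X x) \<in> borel_measurable N" by (simp add: w_def)
      qed
      finally show ?thesis .
    qed
    ultimately show "\<exists>Z\<in>sets N. measure N Z \<le> 1 / m \<and>
      (\<forall>X\<in>sets N. X \<subseteq> D i - Z \<longrightarrow> emeasure N (t i ` X) \<le> ennreal m * (\<integral>\<^sup>+x. ennreal (w (i, True) x) * indicator
          X x \<partial>N))"
      using Z by blast
  qed
qed

lemma (in reversible_walk) reversible_walk_restrict:
  assumes Y: "Y \<in> sets N"
  shows "reversible_walk (density N (indicator Y)) I t (\<lambda>i x. w i x * (indicator Y x * indicator Y (t i x)))"
proof -
  let ?N = "density N (indicator Y)"
  let ?w = "\<lambda>i x. w i x * (indicator Y x * indicator Y (t i x))"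
  note [measurable] = Y

  show ?thesis
  proof (intro reversible_walk.intro reversible_walk_axioms.intro)
    show "finite_measure ?N"
    proof
      have "emeasure ?N (space ?N) = emeasure N Y" by (simp add: emeasure_density)
      then show "emeasure ?N (space ?N) \<noteq> \<infinity>" by (simp add: emeasure_eq_measure)
    qed
    fix i assume i: "i \<in> I"
    note [measurable] = t_measurable[OF i] w_measurable[OF i]
    show "t i \<in> measurable ?N ?N" by simp
    show "?w i \<in> borel_measurable ?N" by measurable
    show "0 \<le> ?w i x" "?w i x \<le> 1" for x using w_nonneg[OF i, of x] w_le_1[OF i, of x] by (auto simp:
        indicator_def)
  next
    fix f :: "'a \<times> 'a \<Rightarrow> ennreal" assume "f \<in> borel_measurable (?N \<Otimes>\<^sub>M ?N)"
    then have f[measurable]: "f \<in> borel_measurable (N \<Otimes>\<^sub>M N)"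
      by (simp cong: measurable_cong_sets sets_pair_measure_cong)
    let ?h = "\<lambda>z. indicator Y (fst z) * indicator Y (snd z) * f z"
    have 1: "(\<integral>\<^sup>+x. ennreal (?w i x) * f (x, t i x) \<partial>?N) = (\<integral>\<^sup>+x. ennreal (w i x) * ?h (x, t i x) \<partial>N)"
      "(\<integral>\<^sup>+x. ennreal (?w i x) * f (t i x, x) \<partial>?N) = (\<integral>\<^sup>+x. ennreal (w i x) * ?h (t i x, x) \<partial>N)" if i: "i \<in> I"
          for i
    proof -
      note [measurable] = t_measurable[OF i] w_measurable[OF i]
      show "(\<integral>\<^sup>+x. ennreal (?w i x) * f (x, t i x) \<partial>?N) = (\<integral>\<^sup>+x. ennreal (w i x) * ?h (x, t i x) \<partial>N)"
        by (subst nn_integral_density) (auto intro!: nn_integral_cong simp: indicator_def)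
      show "(\<integral>\<^sup>+x. ennreal (?w i x) * f (t i x, x) \<partial>?N) = (\<integral>\<^sup>+x. ennreal (w i x) * ?h (t i x, x) \<partial>N)"
        by (subst nn_integral_density) (auto intro!: nn_integral_cong simp: indicator_def)
    qed
    have "?h \<in> borel_measurable (N \<Otimes>\<^sub>M N)" by measurable
    from reversible[OF this] show "(\<Sum>i\<in>I. \<integral>\<^sup>+x. ennreal (?w i x) * f (x, t i x) \<partial>?N) = (\<Sum>i\<in>I. \<integral>\<^sup>+x. ennreal
        (?w i x) * f (t i x, x) \<partial>?N)"
      using 1 by simp
  qed (use finite_I I_ne in auto)
qed

lemma (in reversible_walk) edge_measure_restrict:
  assumes Y: "Y \<in> sets N" and A: "A \<in> sets N" "B \<in> sets N"
  shows "emeasure (reversible_walk.edge_measure (density N (indicator Y)) I t (\<lambda>i x. w i x * (indicator Y x *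
      indicator Y (t i x)))) (A \<times> B)
    = emeasure edge_measure ((A \<inter> Y) \<times> (B \<inter> Y))"
proof -
  interpret R: reversible_walk "density N (indicator Y)" I t "\<lambda>i x. w i x * (indicator Y x * indicator Y (t i
      x))"
    by (rule reversible_walk_restrict[OF Y])
  note [measurable] = Y A
  have "emeasure R.edge_measure (A \<times> B) = (\<Sum>i\<in>I. \<integral>\<^sup>+x. ennreal (w i x * (indicator Y x * indicator Y (t i x))) *
      (indicator A x * indicator B (t i x)) \<partial>density N (indicator Y))"
    using A by (intro R.emeasure_edge_measure) auto
  also have "\<dots> = (\<Sum>i\<in>I. \<integral>\<^sup>+x. ennreal (w i x) * (indicator (A \<inter> Y) x * indicator (B \<inter> Y) (t i x)) \<partial>N)"
  proof (rule sum.cong[OF refl])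
    fix i assume i: "i \<in> I"
    note [measurable] = t_measurable[OF i] w_measurable[OF i]
    show "(\<integral>\<^sup>+x. ennreal (w i x * (indicator Y x * indicator Y (t i x))) *
      (indicator A x * indicator B (t i x)) \<partial>density N (indicator Y)) =
      (\<integral>\<^sup>+x. ennreal (w i x) * (indicator (A \<inter> Y) x * indicator (B \<inter> Y) (t i x)) \<partial>N)"
      by (subst nn_integral_density) (auto intro!: nn_integral_cong simp: indicator_def)
  qed
  also have "\<dots> = emeasure edge_measure ((A \<inter> Y) \<times> (B \<inter> Y))"
    using Y A by (intro emeasure_edge_measure[symmetric]) auto
  finally show ?thesis .
qed

text \<open>Remove from \<open>A\<close> the sets where some derivative exceeds \<open>m\<close>, of
  total measure at most \<open>card I / m\<close>; the rest, \<open>A'\<close>, still has measure at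
  least \<open>\<alpha>/2\<close>. The points that \<open>A'\<close> reaches outside \<open>A\<close>
  have measure at most \<open>m\<close> times the flow out of \<open>A\<close>, and the losses are
  absorbed by the two bounds on \<open>card I / m\<close>.\<close>

lemma edge_expansion_of_vertex_expansion:
  fixes D R :: "'i \<Rightarrow> 'a set"
  assumes rw: "reversible_walk N (I \<times> UNIV) (doubled_maps D R t u) w" and N1: "measure N (space N) = 1"
    and I: "finite I"
    and p: "\<And>i. i \<in> I \<Longrightarrow> partial_automorphism N (D i) (R i) (t i) (u i)"
    and bd: "\<And>i m. i \<in> I \<Longrightarrow> 1 \<le> m \<Longrightarrow> \<exists>Z\<in>sets N. measure N Z \<le> 1 / m \<and>
      (\<forall>X\<in>sets N. X \<subseteq> D i - Z \<longrightarrow> emeasure N (t i ` X) \<le> ennreal m * (\<integral>\<^sup>+x. ennreal (w (i, True) x) * indicator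
          X x \<partial>N))"
    and C: "0 < C" and m: "1 \<le> m" "card I / m \<le> \<alpha> / 2" "card I / m \<le> C * \<alpha> / 4"
    and vexp: "\<And>A. A \<in> sets N \<Longrightarrow> \<alpha> / 2 \<le> measure N A \<Longrightarrow> measure N A \<le> 1/2 \<Longrightarrow>
      C * measure N A \<le> measure N ((\<Union>i\<in>I. t i ` (A \<inter> D i)) - A)"
    and A: "A \<in> sets N" "\<alpha> \<le> measure N A" "measure N A \<le> 1/2"
  shows "C / (4 * m) * measure N A \<le> measure (reversible_walk.edge_measure N (I \<times> UNIV) (doubled_maps D R t u)
      w) (A \<times> (space N - A))"
proof -
  interpret reversible_walk N "I \<times> UNIV" "doubled_maps D R t u" w by fact
  interpret E: finite_measure edge_measure by (rule finite_edge_measure)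
  note d = partial_automorphismD[OF p]
  let ?\<nu> = "measure N"
  obtain Z where Z: "\<And>i. i \<in> I \<Longrightarrow> Z i \<in> sets N" "\<And>i. i \<in> I \<Longrightarrow> ?\<nu> (Z i) \<le> 1 / m"
    and Zb: "\<And>i X. i \<in> I \<Longrightarrow> X \<in> sets N \<Longrightarrow> X \<subseteq> D i - Z i \<Longrightarrow>
      emeasure N (t i ` X) \<le> ennreal m * (\<integral>\<^sup>+x. ennreal (w (i, True) x) * indicator X x \<partial>N)"
    using bd[OF _ m(1)] by metis
  define ZZ where "ZZ = (\<Union>i\<in>I. Z i)"
  define A' where "A' = A - ZZ"
  define X where "X i = {x\<in>D i. t i x \<in> space N - A} \<inter> A'" for i
  define V where "V = (\<Union>i\<in>I. t i ` (A' \<inter> D i))"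
  have ZZ: "ZZ \<in> sets N" unfolding ZZ_def using Z I by auto
  have A': "A' \<in> sets N" unfolding A'_def using A ZZ by auto
  have Xs: "X i \<in> sets N" "X i \<subseteq> D i - Z i" if "i \<in> I" for i
    using that d(7)[OF that, of "space N - A"] A A' by (auto simp: X_def A'_def ZZ_def)
  have tX: "t i ` X i \<in> sets N" if "i \<in> I" for i
    using partial_automorphism_image_sets[OF p[OF that] Xs(1)[OF that]] Xs(2)[OF that] by auto
  have V: "V \<in> sets N" unfolding V_def
    using I partial_automorphism_image_sets[OF p] A' d(1) by (intro sets.finite_UN) auto
  have "?\<nu> ZZ \<le> (\<Sum>i\<in>I. ?\<nu> (Z i))" unfolding ZZ_def using Z I by (intro finite_measure_subadditive_finite) auto
  also have "\<dots> \<le> (\<Sum>i\<in>I. 1 / m)" using Z by (intro sum_mono) auto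
  finally have \<nu>ZZ: "?\<nu> ZZ \<le> card I / m" by simp
  have "?\<nu> A \<le> ?\<nu> (A' \<union> ZZ)" using A A' ZZ by (intro finite_measure_mono) (auto simp: A'_def)
  also have "\<dots> \<le> ?\<nu> A' + ?\<nu> ZZ" using A' ZZ by (intro measure_Un_le) auto
  finally have lower: "?\<nu> A \<le> ?\<nu> A' + card I / m" using \<nu>ZZ by simp
  have upper: "?\<nu> A' \<le> ?\<nu> A" using A by (intro finite_measure_mono) (auto simp: A'_def)
  have "\<alpha> / 2 \<le> ?\<nu> A'" "?\<nu> A' \<le> 1/2" using lower upper m(2) A by linarith+
  then have "C * ?\<nu> A' \<le> ?\<nu> (V - A')" unfolding V_def by (intro vexp A')
  also have "\<dots> \<le> ?\<nu> ((\<Union>i\<in>I. t i ` X i) \<union> ZZ)"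
  proof (rule finite_measure_mono)
    show "(\<Union>i\<in>I. t i ` X i) \<union> ZZ \<in> sets N"
      using tX I ZZ by (intro sets.Un sets.finite_UN) auto
    show "V - A' \<subseteq> (\<Union>i\<in>I. t i ` X i) \<union> ZZ"
    proof
      fix y assume y: "y \<in> V - A'"
      then obtain i x where ix: "i \<in> I" "x \<in> A'" "x \<in> D i" "y = t i x" by (auto simp: V_def)
      have "y \<in> space N" using sets.sets_into_space[OF V] y by blast
      then have "y \<in> ZZ \<or> x \<in> X i" using y ix by (auto simp: X_def A'_def)
      then show "y \<in> (\<Union>i\<in>I. t i ` X i) \<union> ZZ" using ix by blast
    qed
  qed
  also have "\<dots> \<le> ?\<nu> (\<Union>i\<in>I. t i ` X i) + ?\<nu> ZZ"
    using tX I ZZ by (intro measure_Un_le sets.finite_UN) auto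
  also have "?\<nu> (\<Union>i\<in>I. t i ` X i) \<le> m * measure edge_measure (A \<times> (space N - A))"
  proof -
    have "emeasure N (\<Union>i\<in>I. t i ` X i) \<le> (\<Sum>i\<in>I. emeasure N (t i ` X i))"
      using tX I by (intro emeasure_subadditive_finite) auto
    then have "ennreal (?\<nu> (\<Union>i\<in>I. t i ` X i)) \<le> (\<Sum>i\<in>I. emeasure N (t i ` X i))"
      by (simp only: emeasure_eq_measure)
    also have "\<dots> \<le> (\<Sum>i\<in>I. ennreal m * (\<integral>\<^sup>+x. ennreal (w (i, True) x) * indicator (X i) x \<partial>N))"
      using Zb Xs by (intro sum_mono) auto
    also have "\<dots> \<le> (\<Sum>i\<in>I. ennreal m * (\<integral>\<^sup>+x. ennreal (w (i, True) x) *
        (indicator A x * indicator (space N - A) (doubled_maps D R t u (i, True) x)) \<partial>N))"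
    proof (rule sum_mono, rule mult_left_mono, rule nn_integral_mono)
      fix i x show "ennreal (w (i, True) x) * indicator (X i) x \<le> ennreal (w (i, True) x) *
        (indicator A x * indicator (space N - A) (doubled_maps D R t u (i, True) x))"
        by (auto simp: X_def A'_def indicator_def doubled_maps_def extend_by_id_def)
    qed simp
    also have "\<dots> = ennreal m * (\<Sum>i\<in>I. \<integral>\<^sup>+x. ennreal (w (i, True) x) *
        (indicator A x * indicator (space N - A) (doubled_maps D R t u (i, True) x)) \<partial>N)"
      by (simp add: sum_distrib_left)
    also have "\<dots> \<le> ennreal m * emeasure edge_measure (A \<times> (space N - A))"
    proof (rule mult_left_mono)
      let ?F = "\<lambda>j. \<integral>\<^sup>+x. ennreal (w j x) * (indicator A x * indicator (space N - A) (doubled_maps D R t u j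
          x)) \<partial>N"
      have "(\<Sum>i\<in>I. ?F (i, True)) \<le> (\<Sum>i\<in>I. \<Sum>b\<in>UNIV. ?F (i, b))"
        by (intro sum_mono) (simp add: UNIV_bool)
      also have "\<dots> = (\<Sum>j\<in>I \<times> UNIV. ?F j)" by (simp only: sum.cartesian_product')
      also have "\<dots> = emeasure edge_measure (A \<times> (space N - A))"
        using A by (intro emeasure_edge_measure[symmetric]) auto
      finally show "(\<Sum>i\<in>I. ?F (i, True)) \<le> emeasure edge_measure (A \<times> (space N - A))" .
    qed simp
    finally show ?thesis using m(1) by (simp add: E.emeasure_eq_measure ennreal_mult[symmetric])
  qed
  finally have "C * ?\<nu> A' \<le> m * measure edge_measure (A \<times> (space N - A)) + card I / m" using \<nu>ZZ by simp
  moreover have "?\<nu> A / 2 \<le> ?\<nu> A'" using lower m(2) A(2) by linarith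
  then have "C * (?\<nu> A / 2) \<le> C * ?\<nu> A'" using C by (intro mult_left_mono) auto
  moreover have "card I / m \<le> C * ?\<nu> A / 4"
    using m(3) mult_left_mono[OF A(2), of C] C by linarith
  ultimately have "C / 4 * ?\<nu> A \<le> m * measure edge_measure (A \<times> (space N - A))" by argo
  then show ?thesis using m(1) by (simp add: field_simps)
qed

text \<open>The set \<open>S\<close> of full measure is there to keep the walk inside a prescribed
  region: intersecting the expanding set with \<open>S\<close> changes neither measures nor flows, and
  the support properties of \<open>w\<close> say that the walk never leaves \<open>Y \<subseteq>
  S\<close> and only follows arrows that are defined.\<close>

lemma expanding_core:
  fixes D R :: "'i \<Rightarrow> 'a set"
  assumes N: "finite_measure N" and N1: "measure N (space N) = 1" and I: "finite I" "I \<noteq> {}"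
    and p: "\<And>i. i \<in> I \<Longrightarrow> partial_automorphism N (D i) (R i) (t i) (u i)"
    and S: "S \<in> sets N" "space N - S \<in> null_sets N"
    and \<alpha>: "0 < \<alpha>" "\<alpha> \<le> 1/4"
    and C: "0 < C" and m: "1 \<le> m" "card I / m \<le> \<alpha> / 2" "card I / m \<le> C * \<alpha> / 4"
    and vexp: "\<And>A. A \<in> sets N \<Longrightarrow> \<alpha> / 2 \<le> measure N A \<Longrightarrow> measure N A \<le> 1/2 \<Longrightarrow>
      C * measure N A \<le> measure N ((\<Union>i\<in>I. t i ` (A \<inter> D i)) - A)"
    and c: "c \<le> C / (8 * m)"
  obtains Y w where "Y \<in> sets N" "Y \<subseteq> S" "1 - \<alpha> \<le> measure N Y"
    "reversible_walk (density N (indicator Y)) (I \<times> UNIV) (doubled_maps D R t u) w"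
    "\<And>i x. i \<in> I \<Longrightarrow> w (i, True) x \<noteq> 0 \<Longrightarrow> x \<in> D i \<and> x \<in> Y \<and> t i x \<in> Y"
    "\<And>i x. i \<in> I \<Longrightarrow> w (i, False) x \<noteq> 0 \<Longrightarrow> x \<in> R i \<and> x \<in> Y \<and> u i x \<in> Y"
    "\<And>A. A \<in> sets N \<Longrightarrow> measure (density N (indicator Y)) A \<le> measure (density N (indicator Y)) (space N) / 2 \<Longrightarrow>
      c * measure (density N (indicator Y)) A \<le>
      measure (reversible_walk.edge_measure (density N (indicator Y)) (I \<times> UNIV) (doubled_maps D R t u) w) (A
          \<times> (space N - A))"
proof -
  obtain w where rw: "reversible_walk N (I \<times> UNIV) (doubled_maps D R t u) w"
    and w0: "\<And>i x. i \<in> I \<Longrightarrow> x \<notin> D i \<Longrightarrow> w (i, True) x = 0" "\<And>i x. i \<in> I \<Longrightarrow> x \<notin> R i \<Longrightarrow> w (i, False) x = 0"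
    and bd: "\<And>i m. i \<in> I \<Longrightarrow> 1 \<le> m \<Longrightarrow> \<exists>Z\<in>sets N. measure N Z \<le> 1 / m \<and>
      (\<forall>X\<in>sets N. X \<subseteq> D i - Z \<longrightarrow> emeasure N (t i ` X) \<le> ennreal m * (\<integral>\<^sup>+x. ennreal (w (i, True) x) * indicator
          X x \<partial>N))"
    by (rule reversible_walk_of_partial_automorphisms[OF N N1 I p]) blast+
  interpret reversible_walk N "I \<times> UNIV" "doubled_maps D R t u" w by (rule rw)
  interpret E: finite_measure edge_measure by (rule finite_edge_measure)
  have sym: "measure edge_measure (A \<times> B) = measure edge_measure (B \<times> A)" if "A \<in> sets N" "B \<in> sets N" for A B
    using emeasure_edge_measure_swap[OF that] by (simp add: measure_def)
  have eexp: "C / (4 * m) * measure N A \<le> measure edge_measure (A \<times> (space N - A))"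
    if "A \<in> sets N" "\<alpha> \<le> measure N A" "measure N A \<le> 1/2" for A
    using edge_expansion_of_vertex_expansion[OF rw N1 I(1) p bd C m vexp that] .
  have c4: "0 < C / (4 * m)" using C m by simp
  obtain F where F: "F \<in> sets N" "measure N F \<le> \<alpha>"
    and Fe: "\<And>A. A \<in> sets N \<Longrightarrow> A \<subseteq> space N - F \<Longrightarrow> measure N A \<le> measure N (space N - F) / 2 \<Longrightarrow>
    C / (4 * m) / 2 * measure N A \<le> measure edge_measure (A \<times> (space N - F - A))"
    by (rule expansion_after_removing_small_set[OF N N1 finite_edge_measure sets_edge_measure sym c4 \<alpha> eexp];
        blast)
  define Y where "Y = S - F"
  let ?N = "density N (indicator Y)"
  let ?w = "\<lambda>j x. w j x * (indicator Y x * indicator Y (doubled_maps D R t u j x))"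
  have Y: "Y \<in> sets N" using S F by (simp add: Y_def)
  have null: "measure N (space N - S) = 0" using S by (simp add: measure_eq_0_null_sets)

  have nullJ: "measure edge_measure (space N \<times> (space N - S)) = 0"
  proof -
    have "emeasure edge_measure ((space N - S) \<times> space N) =
        (\<Sum>j\<in>I \<times> UNIV. \<integral>\<^sup>+x. ennreal (w j x) * (indicator (space N - S) x * indicator (space N) (doubled_maps D
            R t u j x)) \<partial>N)"
      using S by (intro emeasure_edge_measure) auto
    also have "\<dots> = (\<Sum>j\<in>I \<times> (UNIV :: bool set). 0)"
    proof (rule sum.cong[OF refl])
      fix j :: "'i \<times> bool"
      have "AE x in N. x \<notin> space N - S" using S(2) by (rule AE_not_in)
      then have "(\<integral>\<^sup>+x. ennreal (w j x) * (indicator (space N - S) x * indicator (space N) (doubled_maps D R t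
          u j x)) \<partial>N) = (\<integral>\<^sup>+x. 0 \<partial>N)"
        by (intro nn_integral_cong_AE) (auto elim!: eventually_mono simp: indicator_def)
      then show "(\<integral>\<^sup>+x. ennreal (w j x) * (indicator (space N - S) x * indicator (space N) (doubled_maps D R t
          u j x)) \<partial>N) = 0" by simp
    qed
    finally have "measure edge_measure ((space N - S) \<times> space N) = 0" by (simp add: measure_def)
    then show ?thesis using sym[of "space N - S" "space N"] S by simp
  qed
  have mN: "measure ?N A = measure N (A \<inter> Y)" if "A \<in> sets N" for A
    using that Y by (simp add: measure_def emeasure_density indicator_inter_arith[symmetric] Int_commute)
  have \<nu>Y: "measure N (space N - F) \<le> measure N Y"
  proof -
    have "measure N (space N - F) \<le> measure N (Y \<union> (space N - S))"
      using Y S by (intro finite_measure_mono) (auto simp: Y_def)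
    also have "\<dots> \<le> measure N Y + measure N (space N - S)" using Y S by (intro measure_Un_le) auto
    finally show ?thesis using null by simp
  qed
  show thesis
  proof (rule that[of Y ?w])
    show "Y \<in> sets N" "Y \<subseteq> S" using Y by (auto simp: Y_def)
    show "1 - \<alpha> \<le> measure N Y" using \<nu>Y finite_measure_compl[OF F(1)] N1 F(2) by simp
    show "reversible_walk ?N (I \<times> UNIV) (doubled_maps D R t u) ?w" by (rule reversible_walk_restrict[OF Y])
    show "x \<in> D i \<and> x \<in> Y \<and> t i x \<in> Y" if "i \<in> I" "?w (i, True) x \<noteq> 0" for i x
    proof -
      have "x \<in> D i" using w0(1)[OF that(1)] that(2) by fastforce
      then show ?thesis using that(2) by (auto simp: doubled_maps_def extend_by_id_def indicator_def split:
          if_splits)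
    qed
    show "x \<in> R i \<and> x \<in> Y \<and> u i x \<in> Y" if "i \<in> I" "?w (i, False) x \<noteq> 0" for i x
    proof -
      have "x \<in> R i" using w0(2)[OF that(1)] that(2) by fastforce
      then show ?thesis using that(2) by (auto simp: doubled_maps_def extend_by_id_def indicator_def split:
          if_splits)
    qed
    fix A assume A: "A \<in> sets N" and half: "measure ?N A \<le> measure ?N (space N) / 2"
    let ?B = "A \<inter> Y"
    have B: "?B \<in> sets N" using A Y by auto
    have sp: "space N \<inter> Y = Y" using sets.sets_into_space[OF Y] by auto
    have "measure N Y \<le> measure N (space N - F)"
      using F sets.sets_into_space[OF S(1)] by (intro finite_measure_mono) (auto simp: Y_def)
    then have "measure N ?B \<le> measure N (space N - F) / 2" using half A Y sp by (simp add: mN)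
    moreover have "?B \<subseteq> space N - F" using sets.sets_into_space[OF A] by (auto simp: Y_def)
    ultimately have "C / (4 * m) / 2 * measure N ?B \<le> measure edge_measure (?B \<times> (space N - F - ?B))"
      using B by (intro Fe)
    also have "\<dots> \<le> measure edge_measure ((?B \<times> (Y - A)) \<union> (space N \<times> (space N - S)))"
      using A Y S sets.sets_into_space[OF A]
      by (intro E.finite_measure_mono) (auto simp: Y_def sets_edge_measure)
    also have "\<dots> \<le> measure edge_measure (?B \<times> (Y - A)) + measure edge_measure (space N \<times> (space N - S))"
      using A Y S by (intro measure_Un_le) (auto simp: sets_edge_measure)
    also have "\<dots> = measure edge_measure ((A \<inter> Y) \<times> ((space N - A) \<inter> Y))"
    proof -
      have "(space N - A) \<inter> Y = Y - A" using sp by auto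
      then show ?thesis using nullJ by simp
    qed
    also have "\<dots> = measure (reversible_walk.edge_measure ?N (I \<times> UNIV) (doubled_maps D R t u) ?w) (A \<times> (space
        N - A))"
      using edge_measure_restrict[OF Y A, of "space N - A"] A by (simp add: measure_def)
    finally have "C / (4 * m) / 2 * measure ?N A \<le> \<dots>" using A by (simp add: mN)
    moreover have "c * measure ?N A \<le> C / (4 * m) / 2 * measure ?N A"
      using c by (intro mult_right_mono) auto
    ultimately show "c * measure ?N A \<le> measure (reversible_walk.edge_measure ?N (I \<times> UNIV) (doubled_maps D R
        t u) ?w) (A \<times> (space N - A))"
      by linarith
  qed
qed

section \<open>Walks on the weighted space and the rank-one projection\<close>

abbreviation restricted_density :: "'a measure \<Rightarrow> ('a \<Rightarrow> complex) \<Rightarrow> 'a set \<Rightarrow> 'a measure" where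
  "restricted_density M \<xi> Y \<equiv> density (associated_measure M \<xi>) (indicator Y)"

text \<open>Multiplication by \<open>\<xi>\<close> maps \<open>L\<^sup>2(|\<xi>|\<^sup>2
  \<mu>|Y)\<close> isometrically into \<open>L\<^sup>2(\<mu>)\<close>; this operator is the walk
  transported along it. Where \<open>\<xi>\<close> vanishes the quotient is \<open>0\<close> by the
  convention for division, and such points will lie outside \<open>Y\<close>.\<close>

definition twisted_walk ::
    "'i set \<Rightarrow> ('i \<Rightarrow> 'a \<Rightarrow> 'a) \<Rightarrow> ('i \<Rightarrow> 'a \<Rightarrow> real) \<Rightarrow> 'a set \<Rightarrow> ('a \<Rightarrow> complex) \<Rightarrow> 'a operator" where
  "twisted_walk I t w Y \<xi> f x = indicator Y x * (\<xi> x * reversible_walk.walk I t w (\<lambda>y. f y / \<xi> y) x)"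

lemma walk_cong_on:
  assumes "reversible_walk N I t w" "\<And>i x. i \<in> I \<Longrightarrow> w i x \<noteq> 0 \<Longrightarrow> x \<in> Y \<and> t i x \<in> Y"
    "\<And>x. x \<in> Y \<Longrightarrow> g x = h x" "x \<in> Y"
  shows "reversible_walk.walk I t w g x = reversible_walk.walk I t w h x"
proof -
  interpret reversible_walk N I t w by fact
  have "laplacian g x = laplacian h x"
    unfolding laplacian_def
  proof (rule sum.cong[OF refl])
    fix i assume i: "i \<in> I"
    show "of_real (w i x) * (g x - g (t i x)) = of_real (w i x) * (h x - h (t i x))"
      using assms(2)[OF i, of x] assms(3) by (cases "w i x = 0") auto
  qed
  then show ?thesis using assms(3,4) by (simp add: walk_def)
qed

lemma twisted_walk_power:
  assumes rw: "reversible_walk N I t w" and sup: "\<And>i x. i \<in> I \<Longrightarrow> w i x \<noteq> 0 \<Longrightarrow> x \<in> Y \<and> t i x \<in> Y"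
    and \<xi>: "\<And>x. x \<in> Y \<Longrightarrow> \<xi> x \<noteq> 0"
  shows "(twisted_walk I t w Y \<xi> ^^ Suc k) f x =
    indicator Y x * (\<xi> x * (reversible_walk.walk I t w ^^ Suc k) (\<lambda>y. f y / \<xi> y) x)"
proof -
  let ?T = "twisted_walk I t w Y \<xi>" and ?W = "reversible_walk.walk I t w"
  have Y: "(?T ^^ k) f x / \<xi> x = (?W ^^ k) (\<lambda>y. f y / \<xi> y) x" if "x \<in> Y" for x k
    using that
  proof (induction k arbitrary: x)
    case (Suc k)
    have "(?T ^^ Suc k) f x / \<xi> x = ?W (\<lambda>y. (?T ^^ k) f y / \<xi> y) x"
      using Suc.prems \<xi> by (simp add: twisted_walk_def)
    also have "\<dots> = ?W ((?W ^^ k) (\<lambda>y. f y / \<xi> y)) x"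
      by (rule walk_cong_on[OF rw sup]) (use Suc in auto)
    finally show ?case by simp
  qed simp
  show ?thesis
  proof (cases "x \<in> Y")
    case True
    then show ?thesis using Y[OF True, of "Suc k"] \<xi>[OF True] by (simp add: field_simps)
  next
    case False
    then show ?thesis by (simp add: twisted_walk_def)
  qed
qed

lemma density_twist:
  assumes "\<xi> \<in> borel_measurable M" "Y \<in> sets M"
  shows "restricted_density M \<xi> Y = density M (\<lambda>x. ennreal ((cmod (\<xi> x))\<^sup>2 * indicator Y x))"
proof -
  note [measurable] = assms
  show ?thesis unfolding associated_measure_def
    by (subst density_density_eq) (auto intro!: density_cong AE_I2 simp: indicator_def)
qed

lemma twist_L2:
  assumes \<xi>: "\<xi> \<in> borel_measurable M" and Y: "Y \<in> sets M"
    and g: "g \<in> L2 (restricted_density M \<xi> Y)"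
  shows "(\<lambda>x. indicator Y x * (\<xi> x * g x)) \<in> L2 M"
    "L2_norm M (\<lambda>x. indicator Y x * (\<xi> x * g x)) = L2_norm (restricted_density M \<xi> Y) g"
proof -
  have gm: "g \<in> borel_measurable M" using L2_measurable[OF g] by (simp add: density_twist[OF \<xi> Y])
  note [measurable] = \<xi> Y gm
  have eq: "(cmod (\<xi> x))\<^sup>2 * indicator Y x * (cmod (g x))\<^sup>2 = (cmod (indicator Y x * (\<xi> x * g x)))\<^sup>2" for x
    by (auto simp: indicator_def norm_mult power_mult_distrib)
  have "integrable M (\<lambda>x. (cmod (\<xi> x))\<^sup>2 * indicator Y x * (cmod (g x))\<^sup>2)"
    using L2_integrable[OF g] unfolding density_twist[OF \<xi> Y] by (subst (asm) integrable_density) (auto simp: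
        indicator_def)
  then show "(\<lambda>x. indicator Y x * (\<xi> x * g x)) \<in> L2 M" unfolding eq L2_def by simp
  have "(\<integral>x. (cmod (g x))\<^sup>2 \<partial>restricted_density M \<xi> Y) = (\<integral>x. (cmod (\<xi> x))\<^sup>2 * indicator Y x * (cmod (g x))\<^sup>2
      \<partial>M)"
    unfolding density_twist[OF \<xi> Y] by (subst integral_density) (auto simp: indicator_def)
  then show "L2_norm M (\<lambda>x. indicator Y x * (\<xi> x * g x)) = L2_norm (restricted_density M \<xi> Y) g"
    unfolding eq L2_norm_def by simp
qed

lemma untwist_L2:
  assumes \<xi>: "\<xi> \<in> borel_measurable M" and Y: "Y \<in> sets M" and f: "f \<in> L2 M"
  shows "(\<lambda>x. f x / \<xi> x) \<in> L2 (restricted_density M \<xi> Y)"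
    "L2_norm (restricted_density M \<xi> Y) (\<lambda>x. f x / \<xi> x) \<le> L2_norm M f"
proof -
  note [measurable] = \<xi> Y L2_measurable[OF f]
  let ?N = "restricted_density M \<xi> Y"
  let ?g = "\<lambda>x. f x / \<xi> x"
  have le: "(\<integral>\<^sup>+x. ennreal ((cmod (?g x))\<^sup>2) \<partial>?N) \<le> (\<integral>\<^sup>+x. ennreal ((cmod (f x))\<^sup>2) \<partial>M)"
  proof -
    have "(\<integral>\<^sup>+x. ennreal ((cmod (?g x))\<^sup>2) \<partial>?N) = (\<integral>\<^sup>+x. ennreal ((cmod (\<xi> x))\<^sup>2 * indicator Y x) * ennreal
        ((cmod (?g x))\<^sup>2) \<partial>M)"
      unfolding density_twist[OF \<xi> Y] by (subst nn_integral_density) auto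
    also have "\<dots> \<le> (\<integral>\<^sup>+x. ennreal ((cmod (f x))\<^sup>2) \<partial>M)"
    proof (rule nn_integral_mono)
      fix x
      have "(cmod (\<xi> x))\<^sup>2 * indicator Y x * (cmod (?g x))\<^sup>2 \<le> (cmod (f x))\<^sup>2"
        by (cases "\<xi> x = 0") (auto simp: indicator_def norm_divide power_divide)
      then show "ennreal ((cmod (\<xi> x))\<^sup>2 * indicator Y x) * ennreal ((cmod (?g x))\<^sup>2) \<le> ennreal ((cmod (f
          x))\<^sup>2)"
        by (simp add: ennreal_mult[symmetric] ennreal_leI)
    qed
    finally show ?thesis .
  qed
  then show g: "?g \<in> L2 ?N"
    using f by (auto simp: L2_iff_nn_integral density_twist[OF \<xi> Y] elim: le_less_trans)
  show "L2_norm ?N ?g \<le> L2_norm M f"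
    by (rule L2_norm_leI[OF L2_norm_nonneg _ g]) (use le in \<open>simp add: nn_integral_eq_L2_norm[OF f]\<close>)
qed

lemma twisted_walk_bounded:
  assumes \<xi>: "\<xi> \<in> borel_measurable M" and Y: "Y \<in> sets M"
    and rw: "reversible_walk (restricted_density M \<xi> Y) I t w"
    and f: "f \<in> L2 M"
  shows "twisted_walk I t w Y \<xi> f \<in> L2 M" "L2_norm M (twisted_walk I t w Y \<xi> f) \<le> L2_norm M f"
proof -
  let ?N = "restricted_density M \<xi> Y"
  interpret reversible_walk ?N I t w by (rule rw)
  let ?g = "\<lambda>x. f x / \<xi> x"
  note g = untwist_L2[OF \<xi> Y f]
  have T: "twisted_walk I t w Y \<xi> f = (\<lambda>x. indicator Y x * (\<xi> x * walk ?g x))"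
    by (rule ext) (simp add: twisted_walk_def)
  show "twisted_walk I t w Y \<xi> f \<in> L2 M" unfolding T by (rule twist_L2[OF \<xi> Y walk_L2(1)[OF g(1)]])
  have "0 \<le> energy ?g"
    unfolding energy_def using w_nonneg by (intro integral_nonneg_AE AE_I2 sum_nonneg) auto
  then have "0 \<le> 1 / (4 * card I) * energy ?g" by simp
  then have "(L2_norm ?N (walk ?g))\<^sup>2 \<le> (L2_norm ?N ?g)\<^sup>2" using walk_L2(2)[OF g(1)] by linarith
  then have "L2_norm ?N (walk ?g) \<le> L2_norm ?N ?g" by (rule power2_le_imp_le) (rule L2_norm_nonneg)
  then show "L2_norm M (twisted_walk I t w Y \<xi> f) \<le> L2_norm M f"
    unfolding T twist_L2(2)[OF \<xi> Y walk_L2(1)[OF g(1)]] using g(2) by simp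
qed

text \<open>Let \<open>e\<close> be \<open>\<xi>\<close> cut off to \<open>Y\<close>. The first term is
  the orthogonal projection of \<open>f\<close> onto the span of \<open>e\<close>, since
  \<open>v\<close> is the squared norm of \<open>e\<close>. As \<open>\<parallel>e -
  \<xi>\<parallel>\<^sup>2 = 1 - v \<le> \<alpha>\<close>, the difference splits into a normalisation
  error of size \<open>\<alpha>\<close> and two errors of size \<open>sqrt \<alpha>\<close>.\<close>

lemma cutoff_rank_one_estimate:
  assumes \<xi>: "\<xi> \<in> L2 M" "L2_norm M \<xi> = 1" and Y: "Y \<in> sets M"
    and v: "v = (L2_norm M (cutoff Y \<xi>))\<^sup>2" "1 - \<alpha> \<le> v" "0 < v" and f: "f \<in> L2 M"
  shows "L2_norm M (\<lambda>x. L2_inner M f (cutoff Y \<xi>) / of_real v * cutoff Y \<xi> x - L2_inner M f \<xi> * \<xi> x)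
    \<le> (\<alpha> + 2 * sqrt \<alpha>) * L2_norm M f"
proof -
  let ?e = "cutoff Y \<xi>" and ?i = "L2_inner M f"
  let ?d = "\<lambda>x. ?e x - \<xi> x"
  note [measurable] = Y L2_measurable[OF \<xi>(1)] L2_measurable[OF f]
  have e: "?e \<in> L2 M" "L2_norm M ?e \<le> 1" using cutoff_in_L2[OF Y \<xi>(1)] \<xi>(2) by auto
  have d: "?d \<in> L2 M" by (intro L2_diff e \<xi>)
  have v1: "v \<le> 1" using power_mono[OF e(2) L2_norm_nonneg, of 2] v by simp
  have "(L2_norm M ?d)\<^sup>2 = (\<integral>x. (cmod (\<xi> x))\<^sup>2 - (cmod (?e x))\<^sup>2 \<partial>M)"
    unfolding L2_norm_square by (rule Bochner_Integration.integral_cong) (auto simp: cutoff_def indicator_def)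
  also have "\<dots> = (L2_norm M \<xi>)\<^sup>2 - v"
    unfolding v(1) L2_norm_square by (intro Bochner_Integration.integral_diff L2_integrable \<xi> e)
  finally have "(L2_norm M ?d)\<^sup>2 \<le> \<alpha>" using \<xi>(2) v by simp
  then have nd: "L2_norm M ?d \<le> sqrt \<alpha>" by (simp add: real_le_rsqrt)
  have ie: "?i ?e = ?i ?d + ?i \<xi>"
  proof -
    have "?i ?d + ?i \<xi> = (\<integral>x. f x * cnj (?d x) + f x * cnj (\<xi> x) \<partial>M)"
      unfolding L2_inner_def
      by (intro Bochner_Integration.integral_add[symmetric] L2_integrable_inner f d \<xi>)
    also have "\<dots> = ?i ?e" unfolding L2_inner_def by (simp add: algebra_simps)
    finally show ?thesis by simp
  qed
  let ?a = "\<lambda>x. ?i ?e * (1 / of_real v - 1) * ?e x" and ?b = "\<lambda>x. ?i ?d * ?e x" and ?c = "\<lambda>x. ?i \<xi> * ?d x"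
  have eq: "(\<lambda>x. ?i ?e / of_real v * ?e x - ?i \<xi> * \<xi> x) = (\<lambda>x. ?a x + (?b x + ?c x))"
    unfolding ie by (rule ext) (simp add: algebra_simps add_divide_distrib)
  have F: "0 \<le> L2_norm M f" by (rule L2_norm_nonneg)
  have na: "L2_norm M ?a \<le> \<alpha> * L2_norm M f"
  proof -
    have "cmod (?i ?e) \<le> L2_norm M f * sqrt v" using L2_Cauchy_Schwarz[OF f e(1)] by (simp add: v(1)
        L2_norm_nonneg)
    moreover have "L2_norm M ?e = sqrt v" by (simp add: v(1) L2_norm_nonneg)
    moreover have "cmod (1 / of_real v - 1) = (1 - v) / v"
    proof -
      have "1 / complex_of_real v - 1 = of_real ((1 - v) / v)" using v(3) by (simp add: field_simps)
      then show ?thesis using v(3) v1 by (simp only: norm_of_real) simp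
    qed
    moreover have "L2_norm M ?a = cmod (?i ?e) * cmod (1 / of_real v - 1) * L2_norm M ?e"
      by (simp only: L2_cmult(2)[OF e(1)] norm_mult)
    moreover have "cmod (?i ?e) * ((1 - v) / v) * sqrt v \<le> L2_norm M f * sqrt v * ((1 - v) / v) * sqrt v"
      using calculation(1) v(3) v1 by (intro mult_right_mono) auto
    ultimately have "L2_norm M ?a \<le> L2_norm M f * sqrt v * ((1 - v) / v) * sqrt v" by simp
    also have "\<dots> = (sqrt v * sqrt v) / v * ((1 - v) * L2_norm M f)" by (simp only: divide_inverse mult_ac)
    also have "\<dots> = (1 - v) * L2_norm M f" using v(3) by simp
    also have "\<dots> \<le> \<alpha> * L2_norm M f" using v(2) F by (intro mult_right_mono) auto
    finally show ?thesis .
  qed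
  have nb: "L2_norm M ?b \<le> sqrt \<alpha> * L2_norm M f"
  proof -
    have "cmod (?i ?d) \<le> L2_norm M f * sqrt \<alpha>"
      using L2_Cauchy_Schwarz[OF f d] mult_left_mono[OF nd F] by linarith
    then have "cmod (?i ?d) * L2_norm M ?e \<le> (L2_norm M f * sqrt \<alpha>) * 1"
      using e(2) L2_norm_nonneg[of M ?e] by (intro mult_mono) (auto intro: order_trans[OF norm_ge_zero])
    then show ?thesis unfolding L2_cmult(2)[OF e(1)] by (simp add: mult.commute)
  qed
  have nc: "L2_norm M ?c \<le> sqrt \<alpha> * L2_norm M f"
  proof -
    have "cmod (?i \<xi>) \<le> L2_norm M f" using L2_Cauchy_Schwarz[OF f \<xi>(1)] \<xi>(2) by simp
    then have "cmod (?i \<xi>) * L2_norm M ?d \<le> L2_norm M f * sqrt \<alpha>"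
      using nd L2_norm_nonneg[of M ?d] F by (intro mult_mono) auto
    then show ?thesis unfolding L2_cmult(2)[OF d] by (simp add: mult.commute)
  qed
  have L: "?a \<in> L2 M" "?b \<in> L2 M" "?c \<in> L2 M" using L2_cmult(1) e(1) d by auto
  have "L2_norm M (\<lambda>x. ?a x + (?b x + ?c x)) \<le> L2_norm M ?a + (L2_norm M ?b + L2_norm M ?c)"
    using L2_norm_triangle[OF L(1) L2_add[OF L(2,3)]] L2_norm_triangle[OF L(2,3)] by linarith
  also have "\<dots> \<le> (\<alpha> + 2 * sqrt \<alpha>) * L2_norm M f" using na nb nc by (simp add: algebra_simps)
  finally show ?thesis unfolding eq .
qed

text \<open>Put \<open>g = f / \<xi>\<close> and let \<open>z\<close> be its mean over \<open>Y\<close>.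
  The walk fixes the constant \<open>z\<close> and contracts \<open>g - z\<close>; after multiplication
  by \<open>\<xi>\<close> the constant becomes the image of \<open>f\<close> under the projection onto
  the restriction of \<open>\<xi>\<close> to \<open>Y\<close>.\<close>

lemma twisted_walk_approximates_projection:
  assumes \<xi>: "\<xi> \<in> L2 M" "L2_norm M \<xi> = 1" and Y: "Y \<in> sets M" and \<xi>0: "\<And>x. x \<in> Y \<Longrightarrow> \<xi> x \<noteq> 0"
    and rw: "reversible_walk (restricted_density M \<xi> Y) I t w"
    and sup: "\<And>i x. i \<in> I \<Longrightarrow> w i x \<noteq> 0 \<Longrightarrow> x \<in> Y \<and> t i x \<in> Y"
    and \<alpha>: "\<alpha> \<le> 1/4" "1 - \<alpha> \<le> measure (associated_measure M \<xi>) Y"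
    and c: "0 < c" "c \<le> 1"
    and exp: "\<And>A. A \<in> sets M \<Longrightarrow> measure (restricted_density M \<xi> Y) A \<le>
        measure (restricted_density M \<xi> Y) (space M) / 2 \<Longrightarrow>
      c * measure (restricted_density M \<xi> Y) A \<le>
      measure (reversible_walk.edge_measure (restricted_density M \<xi> Y) I t w) (A \<times> (space M - A))"
    and f: "f \<in> L2 M"
  shows "L2_norm M (\<lambda>x. (twisted_walk I t w Y \<xi> ^^ Suc k) f x - L2_inner M f \<xi> * \<xi> x)
    \<le> (2 * sqrt ((1 - c\<^sup>2 / (16 * (card I)\<^sup>2)) ^ Suc k) + \<alpha> + 2 * sqrt \<alpha>) * L2_norm M f"
proof -
  have \<xi>m: "\<xi> \<in> borel_measurable M" by (rule L2_measurable[OF \<xi>(1)])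
  let ?N = "restricted_density M \<xi> Y"
  interpret reversible_walk ?N I t w by (rule rw)
  note [measurable] = \<xi>m Y L2_measurable[OF f]
  have spN: "space ?N = space M" and seN: "sets ?N = sets M" by (simp_all add: associated_measure_def)
  define v where "v = measure ?N (space ?N)"
  define g where "g = (\<lambda>x. f x / \<xi> x)"
  define z where "z = (\<integral>x. g x \<partial>?N) / of_real v"
  let ?e = "cutoff Y \<xi>"
  have g: "g \<in> L2 ?N" "L2_norm ?N g \<le> L2_norm M f" unfolding g_def by (rule untwist_L2[OF \<xi>m Y f])+
  have vm: "v = measure (associated_measure M \<xi>) Y"
  proof -
    have "Y \<inter> space M = Y" using sets.sets_into_space[OF Y] by auto
    then show ?thesis
      by (simp add: v_def measure_def spN emeasure_density associated_measure_def nn_integral_density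
          indicator_inter_arith[symmetric])
  qed
  have v: "1 - \<alpha> \<le> v" "0 < v" using \<alpha> vm by auto
  have one: "(L2_norm ?N (\<lambda>x. 1))\<^sup>2 = v" by (simp add: L2_norm_square v_def)
  have ve: "v = (L2_norm M ?e)\<^sup>2"
    using twist_L2(2)[OF \<xi>m Y const_in_L2[of 1]] one by (simp add: cutoff_def)
  have zi: "(\<integral>x. g x \<partial>?N) = L2_inner M f ?e"
  proof -
    have "(\<integral>x. g x \<partial>?N) = (\<integral>x. ((cmod (\<xi> x))\<^sup>2 * indicator Y x) *\<^sub>R g x \<partial>M)"
      unfolding density_twist[OF \<xi>m Y] g_def by (subst integral_density) (auto simp: indicator_def)
    also have "\<dots> = L2_inner M f ?e"
      unfolding L2_inner_def
    proof (rule Bochner_Integration.integral_cong[OF refl])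
      fix x
      show "((cmod (\<xi> x))\<^sup>2 * indicator Y x) *\<^sub>R g x = f x * cnj (?e x)"
      proof (cases "\<xi> x = 0")
        case False
        have "of_real ((cmod (\<xi> x))\<^sup>2) * (f x / \<xi> x) = f x * cnj (\<xi> x)"
          using False by (simp add: complex_norm_square del: of_real_power)
        then show ?thesis by (auto simp: g_def cutoff_def indicator_def scaleR_conv_of_real)
      qed (simp add: g_def cutoff_def)
    qed
    finally show ?thesis .
  qed
  define h where "h = (\<lambda>x. g x - z)"
  have h: "h \<in> L2 ?N" unfolding h_def by (intro L2_diff g const_in_L2)
  have mean: "(\<integral>x. h x \<partial>?N) = 0"
  proof -
    have "(\<integral>x. h x \<partial>?N) = (\<integral>x. g x \<partial>?N) - of_real v * z"
      unfolding h_def using L2_integrable_finite[OF g(1)]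
      by (subst Bochner_Integration.integral_diff) (auto simp: v_def scaleR_conv_of_real)
    then show ?thesis using v by (simp add: z_def)
  qed
  have nh: "L2_norm ?N h \<le> 2 * L2_norm M f"
  proof -
    have "cmod (\<integral>x. g x \<partial>?N) \<le> L2_norm ?N g * sqrt v"
    proof -
      have "L2_norm ?N (\<lambda>x. 1) = sqrt v" using one L2_norm_nonneg[of ?N "\<lambda>x. 1"] by (simp add: real_sqrt_unique)
      then show ?thesis using L2_Cauchy_Schwarz[OF g(1) const_in_L2[of 1]] by (simp add: L2_inner_def)
    qed
    then have "cmod z * sqrt v \<le> L2_norm ?N g * sqrt v / v * sqrt v"
      using v by (simp add: z_def norm_divide divide_right_mono mult_right_mono)
    also have "\<dots> = L2_norm ?N g * ((sqrt v * sqrt v) / v)" by (simp only: divide_inverse mult_ac)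
    also have "\<dots> = L2_norm ?N g" using v(2) by simp
    finally have "cmod z * sqrt v \<le> L2_norm ?N g" .
    moreover have "L2_norm ?N (\<lambda>x. - z) = cmod z * sqrt v"
    proof -
      have "(L2_norm ?N (\<lambda>x. - z))\<^sup>2 = (cmod z * sqrt v)\<^sup>2"
        using v by (simp add: L2_norm_square power_mult_distrib v_def)
      then show ?thesis using L2_norm_nonneg[of ?N "\<lambda>x. - z"] v by (simp add: power2_eq_iff_nonneg)
    qed
    moreover have "L2_norm ?N h \<le> L2_norm ?N g + L2_norm ?N (\<lambda>x. - z)"
      using L2_norm_triangle[OF g(1) const_in_L2[of "- z"]] by (simp add: h_def)
    ultimately show ?thesis using g(2) by linarith
  qed
  let ?q = "1 - c\<^sup>2 / (16 * (card I)\<^sup>2)"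
  have small: "c\<^sup>2 / (16 * (card I)\<^sup>2) \<le> 1"
  proof -
    have "1 \<le> real (card I)" using card_pos by simp
    then have "1\<^sup>2 \<le> (real (card I))\<^sup>2" by (intro power_mono) auto
    moreover have "c\<^sup>2 \<le> 1\<^sup>2" using c by (intro power_mono) auto
    ultimately show ?thesis by (auto simp: divide_le_eq_1)
  qed
  have exp': "c * measure ?N A \<le> measure edge_measure (A \<times> (space ?N - A))"
    if "A \<in> sets ?N" "measure ?N A \<le> measure ?N (space ?N) / 2" for A
    using exp[of A] that unfolding spN seN by blast
  have "(L2_norm ?N ((walk ^^ Suc k) h))\<^sup>2 \<le> ?q ^ Suc k * (L2_norm ?N h)\<^sup>2"
    by (rule walk_contraction[OF c(1) exp' h mean small])
  then have "sqrt ((L2_norm ?N ((walk ^^ Suc k) h))\<^sup>2) \<le> sqrt (?q ^ Suc k * (L2_norm ?N h)\<^sup>2)"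
    by (simp only: real_sqrt_le_iff)
  then have "L2_norm ?N ((walk ^^ Suc k) h) \<le> sqrt (?q ^ Suc k) * L2_norm ?N h"
    by (simp only: real_sqrt_mult real_sqrt_abs abs_of_nonneg[OF L2_norm_nonneg])
  also have "\<dots> \<le> sqrt (?q ^ Suc k) * (2 * L2_norm M f)" using nh small by (intro mult_left_mono) auto
  finally have nw: "L2_norm ?N ((walk ^^ Suc k) h) \<le> 2 * sqrt (?q ^ Suc k) * L2_norm M f" by simp
  let ?A = "\<lambda>x. indicator Y x * (\<xi> x * (walk ^^ Suc k) h x)"
  let ?B = "\<lambda>x. L2_inner M f ?e / of_real v * ?e x - L2_inner M f \<xi> * \<xi> x"
  have A: "?A \<in> L2 M" "L2_norm M ?A = L2_norm ?N ((walk ^^ Suc k) h)"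
    by (rule twist_L2[OF \<xi>m Y walk_power_L2[OF h]])+
  have B: "?B \<in> L2 M" by (intro L2_diff L2_cmult cutoff_in_L2 \<xi> Y)
  have "(twisted_walk I t w Y \<xi> ^^ Suc k) f x - L2_inner M f \<xi> * \<xi> x = ?A x + ?B x" for x
  proof -
    have tw: "(twisted_walk I t w Y \<xi> ^^ Suc k) f x = indicator Y x * (\<xi> x * (walk ^^ Suc k) g x)"
      unfolding g_def by (rule twisted_walk_power[OF rw sup \<xi>0])
    have wk: "(walk ^^ Suc k) h x = (walk ^^ Suc k) g x - z"
      unfolding h_def walk_power_diff_const ..
    have zz: "L2_inner M f ?e / of_real v = z" by (simp add: z_def zi)
    have ce: "?e x = indicator Y x * \<xi> x" by (simp add: cutoff_def)
    show ?thesis unfolding tw wk zz ce by (simp only: algebra_simps)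
  qed
  then have "L2_norm M (\<lambda>x. (twisted_walk I t w Y \<xi> ^^ Suc k) f x - L2_inner M f \<xi> * \<xi> x) = L2_norm M (\<lambda>x. ?A
      x + ?B x)"
    by presburger
  also have "\<dots> \<le> L2_norm M ?A + L2_norm M ?B" by (rule L2_norm_triangle[OF A(1) B])
  also have "L2_norm M ?B \<le> (\<alpha> + 2 * sqrt \<alpha>) * L2_norm M f"
    by (rule cutoff_rank_one_estimate[OF \<xi> Y ve v f])
  finally show ?thesis using A(2) nw by (simp add: algebra_simps)
qed

section \<open>The direct sum of rank-one projections\<close>

text \<open>A rank-one \<open>T\<close> sends \<open>f\<close> to a multiple \<open>a \<xi>\<close>, and
  self-adjointness together with \<open>T \<xi> = \<xi>\<close> identifies \<open>a\<close> with the
  inner product.\<close>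

lemma rank_one_projection_eq_inner:
  assumes T: "orthogonal_projection M T" "rank_one M T" and \<xi>: "\<xi> \<in> op_range M T" "L2_norm M \<xi> = 1"
    and f: "f \<in> L2 M"
  shows "AE x in M. T f x = L2_inner M f \<xi> * \<xi> x"
proof -
  have B: "T \<in> bounded_ops M" and idem: "\<And>f. f \<in> L2 M \<Longrightarrow> AE x in M. T (T f) x = T f x"
    and sa: "\<And>f g. f \<in> L2 M \<Longrightarrow> g \<in> L2 M \<Longrightarrow> L2_inner M (T f) g = L2_inner M f (T g)"
    using T(1) by (auto simp: orthogonal_projection_def)
  obtain f0 where \<xi>2: "\<xi> \<in> L2 M" and f0: "f0 \<in> L2 M" "AE x in M. \<xi> x = T f0 x" using \<xi> by (auto simp:
      op_range_def)
  note [measurable] = L2_measurable[OF \<xi>2] L2_measurable[OF f] L2_measurable[OF bounded_opsD(1)[OF B f]]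
    L2_measurable[OF bounded_opsD(1)[OF B \<xi>2]]
  have T\<xi>: "AE x in M. T \<xi> x = \<xi> x"
    using bounded_ops_cong_AE[OF B \<xi>2 bounded_opsD(1)[OF B f0(1)] f0(2)] idem[OF f0(1)] f0(2) by
        eventually_elim simp
  obtain g where g: "\<And>h. h \<in> op_range M T \<Longrightarrow> \<exists>c. AE x in M. h x = c * g x" using T(2) by (auto simp:
      rank_one_def)
  have "T f \<in> op_range M T" using bounded_opsD(1)[OF B f] f by (auto simp: op_range_def)
  then obtain c where c: "AE x in M. T f x = c * g x" using g by blast
  obtain d where d: "AE x in M. \<xi> x = d * g x" using g \<xi>(1) by blast
  have "d \<noteq> 0"
  proof
    assume "d = 0"
    then have "AE x in M. \<xi> x = 0" using d by simp
    then show False using L2_norm_eq_0_iff[OF \<xi>2] \<xi>(2) by simp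
  qed
  define a where "a = c / d"
  have "a * d = c" using \<open>d \<noteq> 0\<close> by (simp add: a_def)
  then have a: "AE x in M. T f x = a * \<xi> x"
    using c d by (auto elim!: eventually_elim2 simp: mult.assoc[symmetric])
  have "L2_inner M f \<xi> = L2_inner M f (T \<xi>)"
    unfolding L2_inner_def using T\<xi> by (intro integral_cong_AE) auto
  also have "\<dots> = L2_inner M (T f) \<xi>" using sa[OF f \<xi>2] by simp
  also have "\<dots> = (\<integral>x. a * of_real ((cmod (\<xi> x))\<^sup>2) \<partial>M)"
    unfolding L2_inner_def using a
    by (intro integral_cong_AE) (auto elim!: eventually_mono simp: complex_norm_square simp del: of_real_power)
  also have "\<dots> = a * of_real ((L2_norm M \<xi>)\<^sup>2)" by (simp add: L2_norm_square del: of_real_power)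
  finally have "L2_inner M f \<xi> = a" using \<xi>(2) by simp
  then show ?thesis using a by simp
qed

text \<open>From the index \<open>n + 1\<close> on, every partial sum agrees with \<open>Q n\<close> on
  the fibre \<open>n\<close>, and norms on a fibre are bounded by norms on the whole space.\<close>

lemma SOT_sums_fibre:
  assumes P: "SOT_sums (disj_measure M) (\<lambda>n. extend_by_zero n (Q n)) P"
    and Q: "\<And>n. Q n \<in> bounded_ops (M n)" and f: "f \<in> L2 (disj_measure M)"
  shows "AE x in M n. P f (n, x) = Q n (\<lambda>y. f (n, y)) x"
proof -
  let ?D = "disj_measure M"
  have PB: "P \<in> bounded_ops ?D" and lim: "(\<lambda>k. L2_norm ?D (\<lambda>x. (\<Sum>n<k. extend_by_zero n (Q n) f x) - P f x)) \<longlonglongrightarrow> 0"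
    using P f by (auto simp: SOT_sums_def)
  have ext: "extend_by_zero m (Q m) f = single_fibre m (Q m (\<lambda>y. f (m, y)))" for m
    by (auto simp: extend_by_zero_def single_fibre_def)
  have Qf: "Q m (\<lambda>y. f (m, y)) \<in> L2 (M m)" for m by (rule bounded_opsD(1)[OF Q L2_fibre(1)[OF f]])
  have E: "extend_by_zero m (Q m) f \<in> L2 ?D" for m unfolding ext by (rule single_fibre_L2(1)[OF Qf])
  have Pf: "P f \<in> L2 ?D" by (rule bounded_opsD(1)[OF PB f])
  let ?d = "\<lambda>x. Q n (\<lambda>y. f (n, y)) x - P f (n, x)"
  have d: "?d \<in> L2 (M n)" by (intro L2_diff Qf L2_fibre(1)[OF Pf])
  have "L2_norm (M n) ?d \<le> L2_norm ?D (\<lambda>x. (\<Sum>n<k. extend_by_zero n (Q n) f x) - P f x)" if "n < k" for k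
  proof -
    have "(\<lambda>x. (\<Sum>n<k. extend_by_zero n (Q n) f x) - P f x) \<in> L2 ?D" by (intro L2_diff L2_sum E Pf)
    from L2_fibre(2)[OF this, of n]
    have "L2_norm (M n) (\<lambda>x. (\<Sum>m<k. extend_by_zero m (Q m) f (n, x)) - P f (n, x))
      \<le> L2_norm ?D (\<lambda>x. (\<Sum>n<k. extend_by_zero n (Q n) f x) - P f x)" .
    moreover have "(\<Sum>m<k. extend_by_zero m (Q m) f (n, x)) = Q n (\<lambda>y. f (n, y)) x" for x
      using that by (simp add: extend_by_zero_def if_distrib sum.delta cong: if_cong)
    ultimately show ?thesis by simp
  qed
  then have "L2_norm (M n) ?d \<le> 0"
    by (intro LIMSEQ_le_const[OF lim]) (auto intro!: exI[of _ "Suc n"])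
  then have "AE x in M n. ?d x = 0" using L2_norm_eq_0_iff[OF d] L2_norm_nonneg[of "M n" ?d] by simp
  then show ?thesis by eventually_elim simp
qed

section \<open>Operators of finite dynamical propagation\<close>

lemma N_decomposable_admissible_family:
  assumes "N_decomposable G len M N K"
  obtains Ks where "\<And>i. i \<in> {1..N} \<Longrightarrow> admissible G len M (Ks i)" "K = (\<Union>i\<in>{1..N}. Ks i)"
  using assms unfolding N_decomposable_def by blast

lemma N_decomposable_subset_arrows:
  assumes "N_decomposable G len M N K" shows "K \<subseteq> arrows G"
  using assms by (auto simp: N_decomposable_def admissible_def bisection_def)

text \<open>If \<open>T1\<close> propagates along \<open>K1\<close> and \<open>T2\<close> along
  \<open>K2\<close>, insert the cutoff to \<open>r(K1 \<cdot> A)\<close> between them: \<open>T1\<close>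
  sees nothing from outside that set, and \<open>T2\<close> brings nothing into it from \<open>B\<close>
  unless \<open>B\<close> meets \<open>r(K2 K1 \<cdot> A)\<close> in positive measure. The products of
  the bisections involved, together with units and inverses, form a decomposable set again.\<close>

lemma finite_dyn_propagation_comp:
  assumes G: "groupoid G" and len: "length_function G len" and M: "space M = unit_space G"
    and 1: "finite_dyn_propagation G len M T1" and 2: "finite_dyn_propagation G len M T2"
  shows "finite_dyn_propagation G len M (T1 \<circ> T2)"
proof -
  interpret groupoid G by fact
  obtain K1 N1 L1 where B1: "T1 \<in> bounded_ops M" and L1: "0 < L1" and K1: "N_decomposable G len M N1 K1"
      "set_length len K1 \<le> ennreal L1"
    and z1: "\<And>A B. A \<in> sets M \<Longrightarrow> B \<in> sets M \<Longrightarrow> emeasure M (range_act G K1 A \<inter> B) = 0 \<Longrightarrow> op_is_zero M (cutoff A \<circ>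
        T1 \<circ> cutoff B)"
    using 1 unfolding finite_dyn_propagation_def by blast
  obtain K2 N2 L2' where B2: "T2 \<in> bounded_ops M" and L2': "0 < L2'" and K2: "N_decomposable G len M N2 K2"
      "set_length len K2 \<le> ennreal L2'"
    and z2: "\<And>A B. A \<in> sets M \<Longrightarrow> B \<in> sets M \<Longrightarrow> emeasure M (range_act G K2 A \<inter> B) = 0 \<Longrightarrow> op_is_zero M (cutoff A \<circ>
        T2 \<circ> cutoff B)"
    using 2 unfolding finite_dyn_propagation_def by blast
  obtain H1 where H1: "\<And>i. i \<in> {1..N1} \<Longrightarrow> admissible G len M (H1 i)" "K1 = (\<Union>i\<in>{1..N1}. H1 i)"
    using N_decomposable_admissible_family[OF K1(1)] by metis
  obtain H2 where H2: "\<And>i. i \<in> {1..N2} \<Longrightarrow> admissible G len M (H2 i)" "K2 = (\<Union>i\<in>{1..N2}. H2 i)"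
    using N_decomposable_admissible_family[OF K2(1)] by metis
  let ?J = "{1..N2} \<times> {1..N1}"
  obtain e where e: "bij_betw e {1..card ?J} ?J" using ex_bij_betw_nat_finite_1[of ?J] by auto
  define B where "B j = set_mult G (H2 (fst (e j))) (H1 (snd (e j)))" for j
  have ej: "e j \<in> ?J" if "j \<in> {1..card ?J}" for j using e that unfolding bij_betw_def by blast
  have Bad: "admissible G len M (B j)" if "j \<in> {1..card ?J}" for j
    unfolding B_def by (intro admissible_set_mult G len H1 H2) (use ej[OF that] in auto)
  define K where "K = unital_symmetric_hull G {1..card ?J} B"
  have KN: "N_decomposable G len M (2 * card ?J + 1) K"
    unfolding K_def by (rule N_decomposable_hull[OF G len M Bad])
  have arr: "K1 \<subseteq> arrows G" "K2 \<subseteq> arrows G" using N_decomposable_subset_arrows[OF K1(1)]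
      N_decomposable_subset_arrows[OF K2(1)] .
  have nn: "0 \<le> len a" if "a \<in> arrows G" for a using len that by (auto simp: length_function_def)
  have l1: "len a \<le> L1" if "a \<in> K1" for a
    using K1(2) that arr nn L1 by (subst (asm) set_length_le_iff) auto
  have l2: "len a \<le> L2'" if "a \<in> K2" for a
    using K2(2) that arr nn L2' by (subst (asm) set_length_le_iff) auto
  have KL: "set_length len K \<le> ennreal (L1 + L2')"
    unfolding K_def
  proof (rule set_length_hull[OF len])
    show "0 < L1 + L2'" using L1 L2' by simp
    fix j assume j: "j \<in> {1..card ?J}"
    show "B j \<subseteq> arrows G" using Bad[OF j] by (auto simp: admissible_def bisection_def)
    fix a assume "a \<in> B j"
    then obtain b c where a: "a = gmult G b c" "b \<in> H2 (fst (e j))" "c \<in> H1 (snd (e j))" "src G b = rng G c"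
      by (auto simp: B_def set_mult_def)
    then have bc: "b \<in> K2" "c \<in> K1" using ej[OF j] unfolding H1(2) H2(2) by auto
    then have "len a \<le> len b + len c" using a arr len unfolding length_function_def by blast
    then show "len a \<le> L1 + L2'" using l1[OF bc(2)] l2[OF bc(1)] by simp
  qed
  have range: "range_act G K2 (range_act G K1 A) \<subseteq> range_act G K A" for A
  proof
    fix y assume "y \<in> range_act G K2 (range_act G K1 A)"
    then obtain b c where b: "b \<in> K2" "y = rng G b" "src G b = rng G c" "c \<in> K1" "src G c \<in> A"
      by (auto simp: range_act_def)
    then obtain i k where ik: "i \<in> {1..N2}" "b \<in> H2 i" "k \<in> {1..N1}" "c \<in> H1 k" unfolding H1(2) H2(2) by blast
    have "(i, k) \<in> e ` {1..card ?J}" using e ik by (auto simp: bij_betw_def)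
    then obtain j where j: "j \<in> {1..card ?J}" "e j = (i, k)" by force
    have "gmult G b c \<in> B j" using ik j b by (auto simp: B_def set_mult_def)
    then have "gmult G b c \<in> K" using j unfolding K_def unital_symmetric_hull_def by blast
    moreover have "src G (gmult G b c) = src G c" "rng G (gmult G b c) = rng G b"
      using b arr src_mult rng_mult by blast+
    ultimately show "y \<in> range_act G K A" using b(2,5) unfolding range_act_def by (intro CollectI exI[of _
        "gmult G b c"]) auto
  qed
  obtain b1 where b1: "0 \<le> b1" "\<And>f. f \<in> L2 M \<Longrightarrow> L2_norm M (T1 f) \<le> b1 * L2_norm M f" by (rule bounded_opsE[OF
      B1]) blast
  obtain b2 where b2: "0 \<le> b2" "\<And>f. f \<in> L2 M \<Longrightarrow> L2_norm M (T2 f) \<le> b2 * L2_norm M f" by (rule bounded_opsE[OF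
      B2]) blast
  have "T1 \<circ> T2 \<in> bounded_ops M"
    unfolding bounded_ops_def
  proof (intro CollectI conjI ballI allI)
    fix f assume f: "f \<in> L2 M"
    note Tf = bounded_opsD(1)[OF B2 f]
    show "(T1 \<circ> T2) f \<in> L2 M" using bounded_opsD(1)[OF B1 Tf] by simp
    show "AE x in M. (T1 \<circ> T2) (\<lambda>y. c * f y) x = c * (T1 \<circ> T2) f x" for c
      using bounded_ops_cong_AE[OF B1 bounded_opsD(1)[OF B2 L2_cmult(1)[OF f]] L2_cmult(1)[OF Tf]
          bounded_opsD(3)[OF B2 f, of c]]
        bounded_opsD(3)[OF B1 Tf, of c] by eventually_elim simp
    fix g assume g: "g \<in> L2 M"
    note Tg = bounded_opsD(1)[OF B2 g]
    show "AE x in M. (T1 \<circ> T2) (\<lambda>y. f y + g y) x = (T1 \<circ> T2) f x + (T1 \<circ> T2) g x"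
      using bounded_ops_cong_AE[OF B1 bounded_opsD(1)[OF B2 L2_add[OF f g]] L2_add[OF Tf Tg]
          bounded_opsD(2)[OF B2 f g]]
        bounded_opsD(2)[OF B1 Tf Tg] by eventually_elim simp
  next
    have "L2_norm M ((T1 \<circ> T2) f) \<le> (b1 * b2) * L2_norm M f" if "f \<in> L2 M" for f
      using b1(2)[OF bounded_opsD(1)[OF B2 that]] mult_left_mono[OF b2(2)[OF that] b1(1)] by (simp add:
          mult.assoc)
    then show "\<exists>B. \<forall>f\<in>L2 M. L2_norm M ((T1 \<circ> T2) f) \<le> B * L2_norm M f" by blast
  qed
  moreover have "op_is_zero M (cutoff A \<circ> (T1 \<circ> T2) \<circ> cutoff B')"
    if A: "A \<in> sets M" and B': "B' \<in> sets M" and z: "emeasure M (range_act G K A \<inter> B') = 0" for A B'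
    unfolding op_is_zero_def
  proof
    fix f assume f: "f \<in> L2 M"
    let ?A1 = "range_act G K1 A"
    have A1: "?A1 \<in> sets M" by (rule range_act_decomposable_sets[OF G len K1(1) A])
    define h where "h = T2 (cutoff B' f)"
    have h: "h \<in> L2 M" unfolding h_def by (intro bounded_opsD(1)[OF B2] cutoff_in_L2 f B')
    have "emeasure M (range_act G K2 ?A1 \<inter> B') \<le> emeasure M (range_act G K A \<inter> B')"
      using range[of A] range_act_decomposable_sets[OF G len KN A] B' by (intro emeasure_mono) auto
    then have "op_is_zero M (cutoff ?A1 \<circ> T2 \<circ> cutoff B')" using z by (intro z2 A1 B') simp
    then have h1: "AE x in M. cutoff ?A1 h x = 0" using f by (auto simp: op_is_zero_def h_def)
    have c1: "cutoff ?A1 h \<in> L2 M" and c2: "cutoff (space M - ?A1) h \<in> L2 M"     using cutoff_in_L2(1)[OF A1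
        h] cutoff_in_L2(1)[OF sets.compl_sets[OF A1] h] by auto
    have t1: "AE x in M. T1 (cutoff ?A1 h) x = T1 (\<lambda>x. 0) x" by (rule bounded_ops_cong_AE[OF B1 c1 zero_in_L2
        h1])
    have t0: "AE x in M. T1 (\<lambda>x. 0) x = 0" using bounded_opsD(3)[OF B1 zero_in_L2, of 0] by simp
    have "?A1 \<inter> (space M - ?A1) = {}" by auto
    then have "op_is_zero M (cutoff A \<circ> T1 \<circ> cutoff (space M - ?A1))" using A1 A by (intro z1) auto
    then have t2: "AE x in M. cutoff A (T1 (cutoff (space M - ?A1) h)) x = 0" using h by (auto simp:
        op_is_zero_def)
    have "AE x in M. h x = cutoff ?A1 h x + cutoff (space M - ?A1) h x"
      by (rule AE_I2) (auto simp: cutoff_def indicator_def)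
    then have "AE x in M. T1 h x = T1 (\<lambda>x. cutoff ?A1 h x + cutoff (space M - ?A1) h x) x"
      by (rule bounded_ops_cong_AE[OF B1 h L2_add[OF c1 c2]])
    with bounded_opsD(2)[OF B1 c1 c2] t1 t0 t2
    show "AE x in M. (cutoff A \<circ> (T1 \<circ> T2) \<circ> cutoff B') f x = 0"
      by eventually_elim (auto simp: cutoff_def h_def)
  qed
  ultimately show ?thesis
    unfolding finite_dyn_propagation_def using KN KL L1 L2'
    by (intro conjI exI[of _ K] exI[of _ "2 * card ?J + 1"] exI[of _ "L1 + L2'"]) auto
qed

lemma finite_dyn_propagation_power:
  assumes G: "groupoid G" and len: "length_function G len" and M: "space M = unit_space G"
    and T: "finite_dyn_propagation G len M T"
  shows "finite_dyn_propagation G len M (T ^^ Suc k)"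
proof (induction k)
  case (Suc k)
  show ?case
    unfolding funpow.simps(2)[of "Suc k"] by (rule finite_dyn_propagation_comp[OF G len M T Suc])
qed (use T in simp)

text \<open>The corner of \<open>T\<close> agrees with the corner of \<open>T - S\<close> whenever the
  corner of \<open>S\<close> vanishes.\<close>

lemma dyn_Roe_subset_quasi_local:
  "dyn_Roe_algebra G len M \<subseteq> dyn_quasi_local_algebra G len M"
proof
  fix T assume "T \<in> dyn_Roe_algebra G len M"
  then have TB: "T \<in> bounded_ops M"
    and ap: "\<And>\<epsilon>. 0 < \<epsilon> \<Longrightarrow> \<exists>S. finite_dyn_propagation G len M S \<and> op_norm M (op_diff T S) < \<epsilon>"
    by (auto simp: dyn_Roe_algebra_def)
  have "\<exists>K N L. 0 < N \<and> 0 < L \<and> N_decomposable G len M N K \<and> set_length len K \<le> ennreal L \<and>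
        (\<forall>A\<in>sets M. \<forall>B\<in>sets M. emeasure M (range_act G K A \<inter> B) = 0 \<longrightarrow> op_norm M (cutoff A \<circ> T \<circ> cutoff B) < \<epsilon>)"
    if "0 < \<epsilon>" for \<epsilon>
  proof -
    obtain S where S: "finite_dyn_propagation G len M S" "op_norm M (op_diff T S) < \<epsilon>" using ap \<open>0 < \<epsilon>\<close> by blast
    obtain K N L where SB: "S \<in> bounded_ops M" and K: "0 < (N::nat)" "0 < L" "N_decomposable G len M N K"
        "set_length len K \<le> ennreal L"
      and z: "\<And>A B. A \<in> sets M \<Longrightarrow> B \<in> sets M \<Longrightarrow> emeasure M (range_act G K A \<inter> B) = 0 \<Longrightarrow> op_is_zero M (cutoff A \<circ>
          S \<circ> cutoff B)"
      using S(1) unfolding finite_dyn_propagation_def by blast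
    obtain b where b: "0 \<le> b" "\<And>f. f \<in> L2 M \<Longrightarrow> L2_norm M (T f) \<le> b * L2_norm M f" by (rule bounded_opsE[OF TB])
        blast
    obtain b' where b': "0 \<le> b'" "\<And>f. f \<in> L2 M \<Longrightarrow> L2_norm M (S f) \<le> b' * L2_norm M f" by (rule bounded_opsE[OF
        SB]) blast
    have D: "op_diff T S f \<in> L2 M" "L2_norm M (op_diff T S f) \<le> (b + b') * L2_norm M f" if f: "f \<in> L2 M" for f
    proof -
      note TS = bounded_opsD(1)[OF TB f] bounded_opsD(1)[OF SB f]
      show "op_diff T S f \<in> L2 M" unfolding op_diff_def by (intro L2_diff TS)
      have "L2_norm M (\<lambda>x. T f x + - S f x) \<le> L2_norm M (T f) + L2_norm M (\<lambda>x. - S f x)"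
        by (intro L2_norm_triangle TS L2_uminus)
      also have "L2_norm M (\<lambda>x. - S f x) = L2_norm M (S f)" by (simp add: L2_norm_def)
      finally show "L2_norm M (op_diff T S f) \<le> (b + b') * L2_norm M f"
        using b(2)[OF f] b'(2)[OF f] by (simp add: op_diff_def algebra_simps)
    qed
    have "op_norm M (cutoff A \<circ> T \<circ> cutoff B) < \<epsilon>"
      if A: "A \<in> sets M" and B: "B \<in> sets M" and e: "emeasure M (range_act G K A \<inter> B) = 0" for A B
    proof -
      have "op_norm M (cutoff A \<circ> T \<circ> cutoff B) \<le> op_norm M (op_diff T S)"
      proof (rule op_norm_least)
        fix f assume f: "f \<in> L2 M" "L2_norm M f \<le> 1"
        let ?f = "cutoff B f"
        have Bf: "?f \<in> L2 M" "L2_norm M ?f \<le> 1" using cutoff_in_L2[OF B f(1)] f(2) by auto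
        have zero: "AE x in M. cutoff A (S ?f) x = 0" using z[OF A B e] f(1) by (auto simp: op_is_zero_def)
        have "L2_norm M (cutoff A (T ?f)) = L2_norm M (cutoff A (op_diff T S ?f))"
        proof (rule L2_cong_AE(2))
          show "cutoff A (op_diff T S ?f) \<in> L2 M" by (intro cutoff_in_L2 A D(1) Bf)
          show "cutoff A (T ?f) \<in> borel_measurable M"
            by (intro L2_measurable cutoff_in_L2 A bounded_opsD(1)[OF TB Bf(1)])
          show "AE x in M. cutoff A (T ?f) x = cutoff A (op_diff T S ?f) x"
            using zero by eventually_elim (simp add: cutoff_def op_diff_def algebra_simps)
        qed
        also have "\<dots> \<le> L2_norm M (op_diff T S ?f)" by (intro cutoff_in_L2 A D(1) Bf)
        also have "\<dots> \<le> op_norm M (op_diff T S)"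
          by (rule op_norm_upper[OF D(2) _ Bf]) (use b b' in auto)
        finally show "L2_norm M ((cutoff A \<circ> T \<circ> cutoff B) f) \<le> op_norm M (op_diff T S)" by simp
      qed
      then show ?thesis using S(2) by simp
    qed
    then show ?thesis using K by blast
  qed
  then show "T \<in> dyn_quasi_local_algebra G len M" using TB by (simp add: dyn_quasi_local_algebra_def)
qed

section \<open>The associated measure and the support of the unit vector\<close>

lemma associated_measure_simps [simp]:
  "space (associated_measure M \<xi>) = space M" "sets (associated_measure M \<xi>) = sets M"
  by (simp_all add: associated_measure_def)

lemma associated_measure_eq_norm:
  assumes "\<xi> \<in> L2 M" "A \<in> sets M"
  shows "emeasure (associated_measure M \<xi>) A = ennreal ((L2_norm M (cutoff A \<xi>))\<^sup>2)"
    "measure (associated_measure M \<xi>) A = (L2_norm M (cutoff A \<xi>))\<^sup>2"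
proof -
  note [measurable] = L2_measurable[OF assms(1)] assms(2)
  have "emeasure (associated_measure M \<xi>) A = (\<integral>\<^sup>+x. ennreal ((cmod (cutoff A \<xi> x))\<^sup>2) \<partial>M)"
    unfolding associated_measure_def by (subst emeasure_density) (auto intro!: nn_integral_cong simp:
        cutoff_def indicator_def)
  also have "\<dots> = ennreal ((L2_norm M (cutoff A \<xi>))\<^sup>2)"
    by (rule nn_integral_eq_L2_norm[OF cutoff_in_L2(1)[OF assms(2,1)]])
  finally show 1: "emeasure (associated_measure M \<xi>) A = ennreal ((L2_norm M (cutoff A \<xi>))\<^sup>2)" .
  then show "measure (associated_measure M \<xi>) A = (L2_norm M (cutoff A \<xi>))\<^sup>2" by (simp add: measure_def)
qed

lemma associated_measure_prob:
  assumes "\<xi> \<in> L2 M" "L2_norm M \<xi> = 1"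
  shows "finite_measure (associated_measure M \<xi>)" "measure (associated_measure M \<xi>) (space M) = 1"
proof -
  show "finite_measure (associated_measure M \<xi>)"
    by (intro finite_measureI) (simp add: associated_measure_eq_norm[OF assms(1)])
  have "L2_norm M (cutoff (space M) \<xi>) = L2_norm M \<xi>"
    unfolding L2_norm_def by (simp add: cutoff_def cong: Bochner_Integration.integral_cong)
  then show "measure (associated_measure M \<xi>) (space M) = 1"
    using assms by (simp add: associated_measure_eq_norm[OF assms(1)])
qed

lemma support_sets:
  assumes "\<xi> \<in> borel_measurable M" shows "{x\<in>space M. \<xi> x \<noteq> (0::complex)} \<in> sets M"
  using assms by measurable

lemma associated_measure_null_iff:
  assumes "\<xi> \<in> borel_measurable M" "A \<in> sets M" "A \<subseteq> {x\<in>space M. \<xi> x \<noteq> 0}"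
  shows "A \<in> null_sets (associated_measure M \<xi>) \<longleftrightarrow> A \<in> null_sets M"
proof -
  have "A \<in> null_sets (associated_measure M \<xi>) \<longleftrightarrow> (AE x in M. x \<notin> A)"
    unfolding associated_measure_def using assms
    by (subst null_sets_density_iff) (auto elim!: eventually_mono)
  then show ?thesis using assms(2) AE_iff_null_sets[OF assms(2)] by simp
qed

lemma associated_measure_off_support:
  assumes "\<xi> \<in> borel_measurable M"
  shows "space M - {x\<in>space M. \<xi> x \<noteq> 0} \<in> null_sets (associated_measure M \<xi>)"
  unfolding associated_measure_def using assms support_sets[OF assms]
  by (subst null_sets_density_iff) auto

text \<open>Both ends of every arrow are required to lie in the support, so that the restricted
  bisection maps the support to the support, where \<open>M\<close> and its associated measure have the
  same null sets.\<close>

definition on_support :: "'g groupoid_ops \<Rightarrow> 'g measure \<Rightarrow> ('g \<Rightarrow> complex) \<Rightarrow> 'g set \<Rightarrow> 'g set" where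
  "on_support G M \<xi> K = {a\<in>K. src G a \<in> {x\<in>space M. \<xi> x \<noteq> 0} \<and> rng G a \<in> {x\<in>space M. \<xi> x \<noteq> 0}}"

lemma admissible_on_support:
  assumes G: "groupoid G" "length_function G len" and \<xi>: "\<xi> \<in> borel_measurable M"
  shows "admissible G len M K \<Longrightarrow> admissible G len (associated_measure M \<xi>) (on_support G M \<xi> K)"
    "admissible G len (associated_measure M \<xi>) K \<Longrightarrow> admissible G len M (on_support G M \<xi> K)"
proof -
  have S: "{x\<in>space M. \<xi> x \<noteq> 0} \<in> sets M" by (rule support_sets[OF \<xi>])
  then have S': "{x\<in>space M. \<xi> x \<noteq> 0} \<in> sets (associated_measure M \<xi>)" by simp
  show "admissible G len M K \<Longrightarrow> admissible G len (associated_measure M \<xi>) (on_support G M \<xi> K)"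
    unfolding on_support_def
    by (rule admissible_restrict[OF G _ S]) (use associated_measure_null_iff[OF \<xi>] in auto)
  show "admissible G len (associated_measure M \<xi>) K \<Longrightarrow> admissible G len M (on_support G M \<xi> K)"
    unfolding on_support_def
    by (rule admissible_restrict[OF G _ S']) (use associated_measure_null_iff[OF \<xi>] in auto)
qed

section \<open>Expansion and approximation\<close>

text \<open>Expansion at one scale \<open>\<alpha>\<close>. The constants come before the set
  \<open>K\<close>, as uniformity over the groupoids demands.\<close>

definition expanding_at ::
    "'g groupoid_ops \<Rightarrow> ('g \<Rightarrow> real) \<Rightarrow> 'g measure \<Rightarrow> real \<Rightarrow> real \<Rightarrow> nat \<Rightarrow> real \<Rightarrow> bool" where
  "expanding_at G len \<nu> \<alpha> c N L \<longleftrightarrow>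
     (\<exists>K. N_decomposable G len \<nu> N K \<and> set_length len K \<le> ennreal L \<and>
        (\<forall>A\<in>sets \<nu>. \<alpha> \<le> measure \<nu> A \<and> measure \<nu> A \<le> 1/2 \<longrightarrow>
           measure \<nu> (range_act G K A - A) > c * measure \<nu> A))"

lemma asymptotically_expanding_iff:
  "asymptotically_expanding G len \<nu> C N L \<longleftrightarrow> (\<forall>\<alpha>\<in>{0<..1/2}. 0 < C \<alpha> \<and> 0 < N \<alpha> \<and> 0 < L \<alpha> \<and>
     expanding_at G len \<nu> \<alpha> (C \<alpha>) (N \<alpha>) (L \<alpha>))"
  unfolding asymptotically_expanding_def expanding_at_def ..

text \<open>Everything that is needed on one fibre, with constants that refer only to
  \<open>\<alpha>\<close>, \<open>C\<close>, \<open>N\<close> and \<open>L\<close>. Locality is stated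
  pointwise: \<open>T f\<close> at \<open>x\<close> depends only on the values of \<open>f\<close> at
  points reached from \<open>x\<close> by arrows of the hull. There are \<open>2 N\<close> maps in the
  walk, whence \<open>64 N\<^sup>2 = 16 (2 N)\<^sup>2\<close>.\<close>

lemma fibre_approximation:
  assumes G: "groupoid G" and len: "length_function G len" and M: "space M = unit_space G"
    and \<xi>: "\<xi> \<in> L2 M" "L2_norm M \<xi> = 1"
    and expanding: "expanding_at G len (associated_measure M \<xi>) (\<alpha> / 2) C N L" and N: "0 < N" and L: "0 < L"
    and \<alpha>: "0 < \<alpha>" "\<alpha> \<le> 1/4"
    and C: "0 < C" and m: "1 \<le> m" "N / m \<le> \<alpha> / 2" "N / m \<le> C * \<alpha> / 4"
    and c: "0 < c" "c \<le> 1" "c \<le> C / (8 * m)"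
  shows "\<exists>T B. (\<forall>i\<in>{1..N}. admissible G len M (B i) \<and> (\<forall>a\<in>B i. len a \<le> L)) \<and>
    (\<forall>f\<in>L2 M. T f \<in> L2 M \<and> L2_norm M (T f) \<le> L2_norm M f) \<and>
    (\<forall>f g x. T (\<lambda>y. f y + g y) x = T f x + T g x) \<and> (\<forall>f a x. T (\<lambda>y. a * f y) x = a * T f x) \<and>
    (\<forall>f. \<forall>x\<in>space M. (\<forall>y\<in>range_act G (unital_symmetric_hull G {1..N} B) {x}. f y = 0) \<longrightarrow> T f x = 0) \<and>
    (\<forall>f\<in>L2 M. \<forall>k. L2_norm M (\<lambda>x. (T ^^ Suc k) f x - L2_inner M f \<xi> * \<xi> x)
      \<le> (2 * sqrt ((1 - c\<^sup>2 / (64 * (real N)\<^sup>2)) ^ Suc k) + \<alpha> + 2 * sqrt \<alpha>) * L2_norm M f)"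
proof -
  interpret groupoid G by fact
  let ?\<nu> = "associated_measure M \<xi>"
  let ?S = "{x\<in>space M. \<xi> x \<noteq> 0}"
  have \<xi>m: "\<xi> \<in> borel_measurable M" by (rule L2_measurable[OF \<xi>(1)])
  obtain K where K: "N_decomposable G len ?\<nu> N K" "set_length len K \<le> ennreal L"
    and vexp: "\<And>A. A \<in> sets ?\<nu> \<Longrightarrow> \<alpha> / 2 \<le> measure ?\<nu> A \<Longrightarrow> measure ?\<nu> A \<le> 1/2 \<Longrightarrow>
      C * measure ?\<nu> A < measure ?\<nu> (range_act G K A - A)"
    using expanding unfolding expanding_at_def by blast
  obtain Ks where Ks: "\<And>i. i \<in> {1..N} \<Longrightarrow> admissible G len ?\<nu> (Ks i)" "K = (\<Union>i\<in>{1..N}. Ks i)"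
    using N_decomposable_admissible_family[OF K(1)] by metis
  have "\<forall>i\<in>{1..N}. \<exists>t u. partial_automorphism ?\<nu> (src G ` Ks i) (rng G ` Ks i) t u \<and> (\<forall>a\<in>Ks i. rng G a = t
      (src G a))"
    using Ks(1) unfolding admissible_iff_partial_automorphism[OF G len] by blast
  then obtain t u where p: "\<And>i. i \<in> {1..N} \<Longrightarrow> partial_automorphism ?\<nu> (src G ` Ks i) (rng G ` Ks i) (t i) (u i)"
    and t: "\<And>i a. i \<in> {1..N} \<Longrightarrow> a \<in> Ks i \<Longrightarrow> rng G a = t i (src G a)" by metis
  have u: "u i (rng G a) = src G a" if "i \<in> {1..N}" "a \<in> Ks i" for i a
    using that t partial_automorphismD(4)[OF p[OF that(1)], of "src G a"] by auto
  let ?D = "\<lambda>i. src G ` Ks i" and ?R = "\<lambda>i. rng G ` Ks i"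
  have act: "(\<Union>i\<in>{1..N}. t i ` (A \<inter> ?D i)) = range_act G K A" for A
    unfolding Ks(2) range_act_def using t by force
  have fin: "finite_measure ?\<nu>" and one: "measure ?\<nu> (space ?\<nu>) = 1"
    using associated_measure_prob[OF \<xi>] by auto
  obtain Y w where Y: "Y \<in> sets ?\<nu>" "Y \<subseteq> ?S" "1 - \<alpha> \<le> measure ?\<nu> Y"
    and rw: "reversible_walk (density ?\<nu> (indicator Y)) ({1..N} \<times> UNIV) (doubled_maps ?D ?R t u) w"
    and wT: "\<And>i x. i \<in> {1..N} \<Longrightarrow> w (i, True) x \<noteq> 0 \<Longrightarrow> x \<in> ?D i \<and> x \<in> Y \<and> t i x \<in> Y"
    and wF: "\<And>i x. i \<in> {1..N} \<Longrightarrow> w (i, False) x \<noteq> 0 \<Longrightarrow> x \<in> ?R i \<and> x \<in> Y \<and> u i x \<in> Y"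
    and exp: "\<And>A. A \<in> sets ?\<nu> \<Longrightarrow> measure (density ?\<nu> (indicator Y)) A \<le> measure (density ?\<nu> (indicator Y))
        (space ?\<nu>) / 2 \<Longrightarrow>
      c * measure (density ?\<nu> (indicator Y)) A \<le>
      measure (reversible_walk.edge_measure (density ?\<nu> (indicator Y)) ({1..N} \<times> UNIV) (doubled_maps ?D ?R t
          u) w) (A \<times> (space ?\<nu> - A))"
  proof (rule expanding_core[where N = ?\<nu> and I = "{1..N}" and D = ?D and R = ?R and t = t and u = u and S = ?S
        and \<alpha> = \<alpha> and C = C and m = m and c = c])
    show "{1..N} \<noteq> {}" using N by simp
    show "?S \<in> sets ?\<nu>" using support_sets[OF \<xi>m] by simp
    show "space ?\<nu> - ?S \<in> null_sets ?\<nu>" using associated_measure_off_support[OF \<xi>m] by simp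
    show "C * measure ?\<nu> A \<le> measure ?\<nu> ((\<Union>i\<in>{1..N}. t i ` (A \<inter> ?D i)) - A)"
      if "A \<in> sets ?\<nu>" "\<alpha> / 2 \<le> measure ?\<nu> A" "measure ?\<nu> A \<le> 1/2" for A
      unfolding act by (rule less_imp_le[OF vexp[OF that]])
  qed (use fin one p \<alpha> C m c in auto)
  let ?I = "{1..N} \<times> (UNIV :: bool set)" and ?t = "doubled_maps ?D ?R t u"
  define T where "T = twisted_walk ?I ?t w Y \<xi>"
  define B where "B i = on_support G M \<xi> (Ks i)" for i
  have YM: "Y \<in> sets M" using Y(1) by simp
  have sup: "x \<in> Y \<and> ?t j x \<in> Y" if "j \<in> ?I" "w j x \<noteq> 0" for j x
  proof (cases j)
    case (Pair i b)
    then show ?thesis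
      using that wT[of i x] wF[of i x] by (cases b) (auto simp: doubled_maps_def extend_by_id_def)
  qed
  interpret R: reversible_walk "density ?\<nu> (indicator Y)" ?I ?t w by (rule rw)
  have adm: "admissible G len M (B i)" if "i \<in> {1..N}" for i
    unfolding B_def by (rule admissible_on_support(2)[OF G len \<xi>m Ks(1)[OF that]])
  have nn: "0 \<le> len a" if "a \<in> K" for a
    using that N_decomposable_subset_arrows[OF K(1)] len by (auto simp: length_function_def)
  have lenB: "len a \<le> L" if "i \<in> {1..N}" "a \<in> B i" for i a
  proof -
    have "a \<in> K" using that unfolding B_def on_support_def Ks(2) by blast
    then show ?thesis using K(2) L nn by (subst (asm) set_length_le_iff) auto
  qed
  have lin: "T (\<lambda>y. f y + g y) x = T f x + T g x" "T (\<lambda>y. a * f y) x = a * T f x" for f g a x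
    unfolding T_def twisted_walk_def R.walk_def R.laplacian_def
    by (simp_all add: add_divide_distrib sum.distrib sum_distrib_left algebra_simps sum_subtractf)
  have loc: "T f x = 0" if x: "x \<in> space M" and z: "\<forall>y\<in>range_act G (unital_symmetric_hull G {1..N} B) {x}. f y
      = 0" for f x
  proof (cases "x \<in> Y")
    case True
    let ?H = "unital_symmetric_hull G {1..N} B"
    have "x \<in> range_act G ?H {x}"
      using x src_of_unit[of x] rng_of_unit[of x] unfolding M range_act_def unital_symmetric_hull_def by force
    then have fx: "f x = 0" using z by blast
    have ft: "w j x = 0 \<or> f (?t j x) = 0" if j: "j \<in> ?I" for j
    proof (rule disjCI)
      assume nz: "f (?t j x) \<noteq> 0"
      show "w j x = 0"
      proof (rule ccontr)
        assume wj: "w j x \<noteq> 0"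
        obtain i b where jb: "j = (i, b)" "i \<in> {1..N}" using j by auto
        have "?t j x \<in> range_act G ?H {x}"
        proof (cases b)
          case True
          then have w: "x \<in> ?D i" "x \<in> Y" "t i x \<in> Y" using wT[OF jb(2), of x] wj jb by auto
          then obtain a where a: "a \<in> Ks i" "x = src G a" by blast
          have "a \<in> B i" using a t[OF jb(2) a(1)] w Y(2) by (auto simp: B_def on_support_def)
          then have "a \<in> ?H" using jb(2) unfolding unital_symmetric_hull_def by blast
          then have "rng G a \<in> range_act G ?H {x}" using a(2) unfolding range_act_def by blast
          then show ?thesis using t[OF jb(2) a(1)] a w(1) True jb by (simp add: doubled_maps_def
              extend_by_id_def)
        next
          case False
          then have w: "x \<in> ?R i" "x \<in> Y" "u i x \<in> Y" using wF[OF jb(2), of x] wj jb by auto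
          then obtain a where a: "a \<in> Ks i" "x = rng G a" by blast
          have aB: "a \<in> B i" using a u[OF jb(2) a(1)] w Y(2) by (auto simp: B_def on_support_def)
          then have "ginv G a \<in> ?H" using jb(2) unfolding unital_symmetric_hull_def by blast
          moreover have "a \<in> arrows G" using adm[OF jb(2)] aB by (auto simp: admissible_def bisection_def)
          then have "src G (ginv G a) = x" "rng G (ginv G a) = src G a" using a(2) src_inv rng_inv by auto
          ultimately have "src G a \<in> range_act G ?H {x}" unfolding range_act_def by force
          then show ?thesis using u[OF jb(2) a(1)] a w(1) False jb by (simp add: doubled_maps_def
              extend_by_id_def)
        qed
        then show False using z nz by blast
      qed
    qed
    have "R.laplacian (\<lambda>y. f y / \<xi> y) x = 0"
      unfolding R.laplacian_def using ft fx by (intro sum.neutral) force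
    then show ?thesis using fx unfolding T_def twisted_walk_def R.walk_def by simp
  qed (simp add: T_def twisted_walk_def)
  have cardI: "real (16 * (card ?I)\<^sup>2) = 64 * (real N)\<^sup>2" by (simp add: power_mult_distrib)
  have approx: "L2_norm M (\<lambda>x. (T ^^ Suc k) f x - L2_inner M f \<xi> * \<xi> x)
      \<le> (2 * sqrt ((1 - c\<^sup>2 / (64 * (real N)\<^sup>2)) ^ Suc k) + \<alpha> + 2 * sqrt \<alpha>) * L2_norm M f"
    if f: "f \<in> L2 M" for f k
  proof -
    have "L2_norm M (\<lambda>x. (T ^^ Suc k) f x - L2_inner M f \<xi> * \<xi> x)
      \<le> (2 * sqrt ((1 - c\<^sup>2 / (16 * (card ?I)\<^sup>2)) ^ Suc k) + \<alpha> + 2 * sqrt \<alpha>) * L2_norm M f"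
      unfolding T_def
    proof (rule twisted_walk_approximates_projection[OF \<xi> YM _ rw sup \<alpha>(2) Y(3) c(1,2) _ f])
      show "\<xi> x \<noteq> 0" if "x \<in> Y" for x using that Y(2) by auto
    qed (use exp in auto)
    then show ?thesis by (simp only: cardI)
  qed
  have bdd: "T f \<in> L2 M \<and> L2_norm M (T f) \<le> L2_norm M f" if "f \<in> L2 M" for f
    unfolding T_def using twisted_walk_bounded[OF \<xi>m YM rw that] by blast
  show ?thesis
    using adm lenB bdd lin loc approx by (intro exI[of _ T] exI[of _ B]) blast
qed

text \<open>The test function is \<open>\<xi>\<^sub>n\<close> cut off to the complement \<open>V\<close>
  of the set reached from \<open>A\<close>. The projection sends it to \<open>\<nu>(V)
  \<xi>\<^sub>n\<close>, whose part over \<open>A\<close> has norm \<open>\<nu>(V) sqrt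
  (\<nu>(A))\<close>. Quasi-locality at \<open>\<epsilon> = sqrt \<alpha> / 4\<close> forces
  \<open>\<nu>(V) < 1/4\<close>; so more than \<open>3/4\<close> is reached, and more than \<open>1/4
  \<ge> \<nu>(A)/2\<close> lies outside \<open>A\<close>.\<close>

lemma quasi_local_imp_expanding:
  fixes G :: "nat \<Rightarrow> 'g groupoid_ops"
  assumes G: "\<And>n. groupoid (G n)" and len: "\<And>n. length_function (G n) (len n)"
    and M: "\<And>n. space (M n) = unit_space (G n)"
    and \<xi>: "\<And>n. \<xi> n \<in> L2 (M n)" "\<And>n. L2_norm (M n) (\<xi> n) = 1"
    and P: "P \<in> dyn_quasi_local_algebra (disj_groupoid G) (disj_length len) (disj_measure M)"
    and Pf: "\<And>f n. f \<in> L2 (disj_measure M) \<Longrightarrow>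
      AE x in M n. P f (n, x) = L2_inner (M n) (\<lambda>y. f (n, y)) (\<xi> n) * \<xi> n x"
    and \<alpha>: "\<alpha> \<in> {0<..1/2}"
  shows "\<exists>N L. 0 < N \<and> 0 < L \<and> (\<forall>n. expanding_at (G n) (len n) (associated_measure (M n) (\<xi> n)) \<alpha> (1/2) N L)"
proof -
  let ?G = "disj_groupoid G" and ?len = "disj_length len" and ?D = "disj_measure M"
  define \<epsilon> where "\<epsilon> = sqrt \<alpha> / 4"
  have \<epsilon>: "0 < \<epsilon>" using \<alpha> by (simp add: \<epsilon>_def)
  have PB: "P \<in> bounded_ops ?D" using P by (simp add: dyn_quasi_local_algebra_def)
  have "\<exists>K N L. 0 < N \<and> 0 < L \<and> N_decomposable ?G ?len ?D N K \<and> set_length ?len K \<le> ennreal L \<and>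
        (\<forall>A\<in>sets ?D. \<forall>B\<in>sets ?D. emeasure ?D (range_act ?G K A \<inter> B) = 0 \<longrightarrow> op_norm ?D (cutoff A \<circ> P \<circ> cutoff B)
            < \<epsilon>)"
    using P \<epsilon> unfolding dyn_quasi_local_algebra_def by blast
  then obtain K N L where L: "0 < L" and K: "N_decomposable ?G ?len ?D N K" "set_length ?len K \<le> ennreal L"
    and ql: "\<And>A B. A \<in> sets ?D \<Longrightarrow> B \<in> sets ?D \<Longrightarrow> emeasure ?D (range_act ?G K A \<inter> B) = 0 \<Longrightarrow> op_norm ?D (cutoff A \<circ>
        P \<circ> cutoff B) < \<epsilon>"
    by blast
  have gG: "groupoid ?G" by (rule groupoid_disj_groupoid[OF G])
  have gl: "length_function ?G ?len" by (rule length_function_disj_length[OF len])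
  obtain Ks where Ks: "\<And>i. i \<in> {1..N} \<Longrightarrow> admissible ?G ?len ?D (Ks i)" "K = (\<Union>i\<in>{1..N}. Ks i)"
    using N_decomposable_admissible_family[OF K(1)] by metis
  have Karr: "K \<subseteq> arrows ?G" by (rule N_decomposable_subset_arrows[OF K(1)])
  have lenK: "len n a \<le> L" if "(n, a) \<in> K" for n a
  proof -
    have "0 \<le> ?len b" if "b \<in> K" for b using that Karr gl unfolding length_function_def by blast
    then have "\<forall>b\<in>K. ?len b \<le> L" using K(2) L by (subst (asm) set_length_le_iff) auto
    then show ?thesis using that by force
  qed
  obtain b where b: "0 \<le> b" "\<And>f. f \<in> L2 ?D \<Longrightarrow> L2_norm ?D (P f) \<le> b * L2_norm ?D f" by (rule bounded_opsE[OF
      PB]) blast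
  have main: "expanding_at (G n) (len n) (associated_measure (M n) (\<xi> n)) \<alpha> (1/2) (2 * N + 1) L" for n
  proof -
    let ?\<nu> = "associated_measure (M n) (\<xi> n)"
    let ?S = "{x\<in>space (M n). \<xi> n x \<noteq> 0}"
    have \<xi>m: "\<xi> n \<in> borel_measurable (M n)" by (rule L2_measurable[OF \<xi>(1)])
    interpret \<nu>: finite_measure ?\<nu> by (rule associated_measure_prob[OF \<xi>])
    have \<nu>1: "measure ?\<nu> (space (M n)) = 1" by (rule associated_measure_prob[OF \<xi>])
    define B where "B i = on_support (G n) (M n) (\<xi> n) (Pair n -` Ks i)" for i
    define K' where "K' = unital_symmetric_hull (G n) {1..N} B"
    have B: "admissible (G n) (len n) ?\<nu> (B i)" if "i \<in> {1..N}" for i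
      unfolding B_def by (intro admissible_on_support(1)[OF G len \<xi>m] admissible_fibre[OF G len] Ks that)
    have K'N: "N_decomposable (G n) (len n) ?\<nu> (2 * N + 1) K'"
      unfolding K'_def by (rule N_decomposable_hull[OF G len _ B]) (simp add: M)
    have K'L: "set_length (len n) K' \<le> ennreal L"
      unfolding K'_def
    proof (rule set_length_hull[OF len L])
      fix i assume i: "i \<in> {1..N}"
      show "B i \<subseteq> arrows (G n)" using B[OF i] by (auto simp: admissible_def bisection_def)
      show "len n a \<le> L" if "a \<in> B i" for a
        using that i unfolding B_def on_support_def by (intro lenK) (auto simp: Ks(2))
    qed
    have S: "?S \<in> sets (M n)" by (rule support_sets[OF \<xi>m])
    have offS: "measure ?\<nu> (space (M n) - ?S) = 0"
      using associated_measure_off_support[OF \<xi>m] by (simp add: measure_eq_0_null_sets)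
    have inS: "measure ?\<nu> X \<le> measure ?\<nu> (X \<inter> ?S)" if X: "X \<in> sets (M n)" for X
    proof -
      have "measure ?\<nu> X \<le> measure ?\<nu> ((X \<inter> ?S) \<union> (space (M n) - ?S))"
        using X S sets.sets_into_space[OF X] by (intro \<nu>.finite_measure_mono) auto
      also have "\<dots> \<le> measure ?\<nu> (X \<inter> ?S) + measure ?\<nu> (space (M n) - ?S)"
        using X S by (intro measure_Un_le) auto
      finally show ?thesis using offS by simp
    qed
    have "1/2 * measure ?\<nu> A < measure ?\<nu> (range_act (G n) K' A - A)"
      if A: "A \<in> sets ?\<nu>" and a1: "\<alpha> \<le> measure ?\<nu> A" and a2: "measure ?\<nu> A \<le> 1/2" for A
    proof -
      define A1 where "A1 = A \<inter> ?S"
      have A1: "A1 \<in> sets (M n)" using A S by (auto simp: A1_def)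
      have \<nu>A1: "\<alpha> \<le> measure ?\<nu> A1" using inS[of A] A a1 by (simp add: A1_def)
      define E where "E = Pair n ` A1"
      have E: "E \<in> sets ?D" unfolding E_def sets_disj_measure using A1 by (intro sigma_sets.Basic) auto
      have vE: "Pair n -` E = A1" by (auto simp: E_def)
      define Q where "Q = range_act (G n) (Pair n -` K) A1"
      have Qs: "range_act ?G K E \<in> sets ?D" by (rule range_act_decomposable_sets[OF gG gl K(1) E])
      have Qv: "Pair n -` range_act ?G K E = Q" by (simp add: range_act_fibre vE Q_def)
      have Q: "Q \<in> sets (M n)" using sets_vimage_Pair_disj_measure[OF Qs, of n] Qv by simp
      define V where "V = space (M n) - Q"
      have V: "V \<in> sets (M n)" using Q by (simp add: V_def)
      define F where "F = Pair n ` V"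
      have F: "F \<in> sets ?D" unfolding F_def sets_disj_measure using V by (intro sigma_sets.Basic) auto
      have "range_act ?G K E \<inter> F = {}" using Qv by (auto simp: F_def V_def)
      then have small: "op_norm ?D (cutoff E \<circ> P \<circ> cutoff F) < \<epsilon>" using ql[OF E F] by simp
      define f where "f = single_fibre n (cutoff V (\<xi> n))"
      have cV: "cutoff V (\<xi> n) \<in> L2 (M n)" by (rule cutoff_in_L2[OF V \<xi>(1)])
      have f: "f \<in> L2 ?D" "L2_norm ?D f \<le> 1"
        using single_fibre_L2[of _ M n, OF cV] cutoff_in_L2(2)[OF V \<xi>(1)] \<xi>(2) by (simp_all add: f_def)
      have Ff: "cutoff F f = f" by (rule ext) (auto simp: cutoff_def f_def single_fibre_def F_def indicator_def)
      have PF: "cutoff E (P f) \<in> L2 ?D" by (intro cutoff_in_L2 E bounded_opsD(1)[OF PB f(1)])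
      have "L2_inner (M n) (\<lambda>y. f (n, y)) (\<xi> n) = (\<integral>x. of_real ((cmod (cutoff V (\<xi> n) x))\<^sup>2) \<partial>M n)"
        unfolding L2_inner_def
      proof (rule Bochner_Integration.integral_cong[OF refl])
        fix x show "f (n, x) * cnj (\<xi> n x) = of_real ((cmod (cutoff V (\<xi> n) x))\<^sup>2)"
          by (auto simp: f_def single_fibre_def cutoff_def indicator_def complex_norm_square simp del:
              of_real_power)
      qed
      also have "\<dots> = of_real (measure ?\<nu> V)"
        by (simp add: associated_measure_eq_norm[OF \<xi>(1) V] L2_norm_square del: of_real_power)
      finally have inner: "L2_inner (M n) (\<lambda>y. f (n, y)) (\<xi> n) = of_real (measure ?\<nu> V)" .
      let ?h = "\<lambda>x. of_real (measure ?\<nu> V) * cutoff A1 (\<xi> n) x"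
      have cA: "cutoff A1 (\<xi> n) \<in> L2 (M n)" by (rule cutoff_in_L2[OF A1 \<xi>(1)])
      have "L2_norm (M n) (\<lambda>x. cutoff E (P f) (n, x)) = L2_norm (M n) ?h"
      proof (rule L2_cong_AE(2)[OF L2_cmult(1)[OF cA]])
        show "(\<lambda>x. cutoff E (P f) (n, x)) \<in> borel_measurable (M n)" by (rule L2_measurable[OF L2_fibre(1)[OF
            PF]])
        show "AE x in M n. cutoff E (P f) (n, x) = ?h x"
          using Pf[OF f(1), of n] unfolding inner
          by eventually_elim (auto simp: cutoff_def E_def indicator_def)
      qed
      also have "\<dots> = measure ?\<nu> V * sqrt (measure ?\<nu> A1)"
        unfolding L2_cmult(2)[OF cA] associated_measure_eq_norm(2)[OF \<xi>(1) A1] by (simp add: L2_norm_nonneg)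
      finally have "measure ?\<nu> V * sqrt (measure ?\<nu> A1) \<le> L2_norm ?D (cutoff E (P f))"
        using L2_fibre(2)[OF PF, of n] by simp
      also have "\<dots> = L2_norm ?D ((cutoff E \<circ> P \<circ> cutoff F) f)" by (simp add: Ff)
      also have "\<dots> \<le> op_norm ?D (cutoff E \<circ> P \<circ> cutoff F)"
      proof (rule op_norm_upper[OF _ b(1) f])
        fix g assume g: "g \<in> L2 ?D"
        note cg = cutoff_in_L2[OF F g]
        have "L2_norm ?D (cutoff E (P (cutoff F g))) \<le> L2_norm ?D (P (cutoff F g))"
          by (intro cutoff_in_L2 E bounded_opsD(1)[OF PB cg(1)])
        also have "\<dots> \<le> b * L2_norm ?D (cutoff F g)" by (rule b(2)[OF cg(1)])
        also have "\<dots> \<le> b * L2_norm ?D g" by (intro mult_left_mono cg b)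
        finally show "L2_norm ?D ((cutoff E \<circ> P \<circ> cutoff F) g) \<le> b * L2_norm ?D g" by simp
      qed
      finally have "measure ?\<nu> V * sqrt (measure ?\<nu> A1) < sqrt \<alpha> / 4" using small by (simp add: \<epsilon>_def)
      moreover have "measure ?\<nu> V * sqrt \<alpha> \<le> measure ?\<nu> V * sqrt (measure ?\<nu> A1)"
        using \<nu>A1 by (intro mult_left_mono) auto
      ultimately have "measure ?\<nu> V * sqrt \<alpha> < (1/4) * sqrt \<alpha>" by simp
      then have \<nu>V: "measure ?\<nu> V < 1/4" using \<alpha> by (simp add: mult_less_cancel_right)
      have "measure ?\<nu> V = 1 - measure ?\<nu> Q" using \<nu>.finite_measure_compl[of Q] Q \<nu>1 by (simp add: V_def)
      then have \<nu>Q: "3/4 < measure ?\<nu> (Q \<inter> ?S)" using \<nu>V inS[OF Q] by simp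
      have sub: "Q \<inter> ?S \<subseteq> range_act (G n) K' A"
      proof
        fix y assume y: "y \<in> Q \<inter> ?S"
        then obtain a where a: "(n, a) \<in> K" "y = rng (G n) a" "src (G n) a \<in> A1" by (auto simp: Q_def
            range_act_def)
        then obtain i where i: "i \<in> {1..N}" "(n, a) \<in> Ks i" unfolding Ks(2) by blast
        have "a \<in> B i" using i a y by (auto simp: B_def on_support_def A1_def)
        then have "a \<in> K'" using i(1) unfolding K'_def unital_symmetric_hull_def by blast
        then show "y \<in> range_act (G n) K' A" using a by (auto simp: range_act_def A1_def)
      qed
      have K'A: "range_act (G n) K' A \<in> sets ?\<nu>" by (rule range_act_decomposable_sets[OF G len K'N A])
      have "measure ?\<nu> (Q \<inter> ?S) \<le> measure ?\<nu> ((range_act (G n) K' A - A) \<union> A)"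
        using sub K'A A by (intro \<nu>.finite_measure_mono) auto
      also have "\<dots> \<le> measure ?\<nu> (range_act (G n) K' A - A) + measure ?\<nu> A"
        using K'A A by (intro measure_Un_le) auto
      finally show ?thesis using \<nu>Q a2 by simp
    qed
    then show ?thesis unfolding expanding_at_def using K'N K'L by blast
  qed
  show ?thesis using main L by (intro exI[of _ "2 * N + 1"] exI[of _ L]) auto
qed

text \<open>The operators on the fibres are combined to an operator \<open>S\<close> on the disjoint
  union, which propagates along the union of the bisections, and a power of \<open>S\<close>
  approximates \<open>P\<close> on all fibres at once.\<close>

lemma expanding_imp_Roe:
  fixes G :: "nat \<Rightarrow> 'g groupoid_ops"
  assumes G: "\<And>n. groupoid (G n)" and len: "\<And>n. length_function (G n) (len n)"
    and M: "\<And>n. space (M n) = unit_space (G n)"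
    and \<xi>: "\<And>n. \<xi> n \<in> L2 (M n)" "\<And>n. L2_norm (M n) (\<xi> n) = 1"
    and PB: "P \<in> bounded_ops (disj_measure M)"
    and Pf: "\<And>f n. f \<in> L2 (disj_measure M) \<Longrightarrow>
      AE x in M n. P f (n, x) = L2_inner (M n) (\<lambda>y. f (n, y)) (\<xi> n) * \<xi> n x"
    and exp: "\<And>n. asymptotically_expanding (G n) (len n) (associated_measure (M n) (\<xi> n)) C N L"
  shows "P \<in> dyn_Roe_algebra (disj_groupoid G) (disj_length len) (disj_measure M)"
proof -
  let ?G = "disj_groupoid G" and ?len = "disj_length len" and ?D = "disj_measure M"
  have gG: "groupoid ?G" by (rule groupoid_disj_groupoid[OF G])
  have gl: "length_function ?G ?len" by (rule length_function_disj_length[OF len])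
  have gM: "space ?D = unit_space ?G" by (simp add: space_disj_measure M)
  have "\<exists>S. finite_dyn_propagation ?G ?len ?D S \<and> op_norm ?D (op_diff P S) < \<epsilon>" if \<epsilon>: "0 < \<epsilon>" for \<epsilon>
  proof -
    \<comment> \<open>Then \<open>\<alpha> + 2 sqrt \<alpha> \<le> 3 sqrt \<alpha> \<le>
      \<epsilon>/4\<close> bounds the error from removing a set of measure \<open>\<alpha>\<close>; a
      power \<open>k\<close> with \<open>2 sqrt (q^(k+1)) \<le> \<epsilon>/4\<close> takes care of the
      rest.\<close>
    define \<alpha> where "\<alpha> = min (1/4) ((\<epsilon> / 12)\<^sup>2)"
    have \<alpha>: "0 < \<alpha>" "\<alpha> \<le> 1/4" "\<alpha> / 2 \<in> {0<..1/2}" using \<epsilon> by (auto simp: \<alpha>_def)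
    have s\<alpha>: "sqrt \<alpha> \<le> \<epsilon> / 12" using \<epsilon> by (intro real_le_lsqrt) (auto simp: \<alpha>_def)
    have "\<alpha> * \<alpha> \<le> 1 * \<alpha>" using \<alpha> by (intro mult_right_mono) auto
    then have \<alpha>s: "\<alpha> \<le> sqrt \<alpha>" using \<alpha> by (intro real_le_rsqrt) (simp add: power2_eq_square)
    \<comment> \<open>Expansion is used at \<open>\<alpha>/2\<close> because some measure is lost by
      truncating the derivatives.\<close>
    define C0 N0 L0 where "C0 = C (\<alpha> / 2)" and "N0 = N (\<alpha> / 2)" and "L0 = L (\<alpha> / 2)"
    have pos: "0 < C0" "0 < N0" "0 < L0"
      and exK: "\<And>n. expanding_at (G n) (len n) (associated_measure (M n) (\<xi> n)) (\<alpha> / 2) C0 N0 L0"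
      using exp \<alpha>(3) unfolding asymptotically_expanding_iff C0_def N0_def L0_def by blast+
    define m where "m = max 1 (max (2 * N0 / \<alpha>) (4 * N0 / (C0 * \<alpha>)))"
    have m: "1 \<le> m" "N0 / m \<le> \<alpha> / 2" "N0 / m \<le> C0 * \<alpha> / 4"
    proof -
      show m1: "1 \<le> m" by (simp add: m_def)
      have "2 * N0 / \<alpha> \<le> m" "4 * N0 / (C0 * \<alpha>) \<le> m" by (simp_all add: m_def)
      then show "N0 / m \<le> \<alpha> / 2" "N0 / m \<le> C0 * \<alpha> / 4"
        using m1 \<alpha>(1) pos(1) by (simp_all add: field_simps)
    qed
    define c where "c = min 1 (C0 / (8 * m))"
    have c: "0 < c" "c \<le> 1" "c \<le> C0 / (8 * m)" using pos m(1) by (auto simp: c_def)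
    define q where "q = 1 - c\<^sup>2 / (64 * (real N0)\<^sup>2)"
    have q: "0 \<le> q" "q < 1"
    proof -
      have "c\<^sup>2 \<le> 1\<^sup>2" using c by (intro power_mono) auto
      moreover have "1\<^sup>2 \<le> (real N0)\<^sup>2" using pos(2) by (intro power_mono) auto
      ultimately have "c\<^sup>2 \<le> 64 * (real N0)\<^sup>2" by simp
      then show "0 \<le> q" using pos(2) by (simp add: q_def)
      show "q < 1" using c pos(2) by (simp add: q_def)
    qed
    have "0 < (\<epsilon> / 8)\<^sup>2" using \<epsilon> by simp
    then obtain k where k: "q ^ k < (\<epsilon> / 8)\<^sup>2" using real_arch_pow_inv q(2) by blast
    have "q ^ Suc k \<le> q ^ k" using q by (simp add: mult_left_le_one_le)
    then have "q ^ Suc k \<le> (\<epsilon> / 8)\<^sup>2" using k by linarith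
    then have sq: "sqrt (q ^ Suc k) \<le> \<epsilon> / 8" using \<epsilon> by (intro real_le_lsqrt) auto
    define \<delta> where "\<delta> = 2 * sqrt (q ^ Suc k) + \<alpha> + 2 * sqrt \<alpha>"
    have \<delta>: "0 \<le> \<delta>" "\<delta> \<le> \<epsilon> / 2" using sq s\<alpha> \<alpha>s \<alpha>(1) q by (auto simp: \<delta>_def)
    define good where "good = (\<lambda>n (T :: 'g operator) B. (\<forall>i\<in>{1..N0}. admissible (G n) (len n) (M n) (B i) \<and>
        (\<forall>a\<in>B i. len n a \<le> L0)) \<and>
      (\<forall>f\<in>L2 (M n). T f \<in> L2 (M n) \<and> L2_norm (M n) (T f) \<le> L2_norm (M n) f) \<and>
      (\<forall>f g x. T (\<lambda>y. f y + g y) x = T f x + T g x) \<and> (\<forall>f a x. T (\<lambda>y. a * f y) x = a * T f x) \<and>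
      (\<forall>f. \<forall>x\<in>space (M n). (\<forall>y\<in>range_act (G n) (unital_symmetric_hull (G n) {1..N0} B) {x}. f y = 0) \<longrightarrow> T f x =
          0) \<and>
      (\<forall>f\<in>L2 (M n). \<forall>k. L2_norm (M n) (\<lambda>x. (T ^^ Suc k) f x - L2_inner (M n) f (\<xi> n) * \<xi> n x)
        \<le> (2 * sqrt (q ^ Suc k) + \<alpha> + 2 * sqrt \<alpha>) * L2_norm (M n) f))"
    have "\<exists>T B. good n T B" for n
      unfolding good_def q_def
      by (rule fibre_approximation[OF G len M \<xi> exK pos(2,3) \<alpha>(1,2) pos(1) m c])
    then obtain T B where TB: "\<And>n. good n (T n) (B n)" by metis
    have B: "\<And>n i. i \<in> {1..N0} \<Longrightarrow> admissible (G n) (len n) (M n) (B n i)"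
        "\<And>n i a. i \<in> {1..N0} \<Longrightarrow> a \<in> B n i \<Longrightarrow> len n a \<le> L0"
      and Tb: "\<And>n f. f \<in> L2 (M n) \<Longrightarrow> T n f \<in> L2 (M n)" "\<And>n f. f \<in> L2 (M n) \<Longrightarrow> L2_norm (M n) (T n f) \<le> L2_norm (M
          n) f"
      and Tlin: "\<And>n f g x. T n (\<lambda>y. f y + g y) x = T n f x + T n g x" "\<And>n f a x. T n (\<lambda>y. a * f y) x = a * T n
          f x"
      and Tloc: "\<And>n f x. x \<in> space (M n) \<Longrightarrow>
        (\<And>y. y \<in> range_act (G n) (unital_symmetric_hull (G n) {1..N0} (B n)) {x} \<Longrightarrow> f y = 0) \<Longrightarrow> T n f x = 0"
      and Tap: "\<And>n f. f \<in> L2 (M n) \<Longrightarrow>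
        L2_norm (M n) (\<lambda>x. (T n ^^ Suc k) f x - L2_inner (M n) f (\<xi> n) * \<xi> n x) \<le> \<delta> * L2_norm (M n) f"
      using TB unfolding good_def \<delta>_def by blast+
    define S :: "(nat \<times> 'g) operator" where "S = (\<lambda>f (n, x). T n (\<lambda>y. f (n, y)) x)"
    define U where "U i = (SIGMA n:UNIV. B n i)" for i
    define H where "H = unital_symmetric_hull ?G {1..N0} U"
    have SL: "S f \<in> L2 ?D" "L2_norm ?D (S f) \<le> 1 * L2_norm ?D f" if f: "f \<in> L2 ?D" for f
    proof -
      have "(\<lambda>x. S f (n, x)) \<in> L2 (M n)" "L2_norm (M n) (\<lambda>x. S f (n, x)) \<le> 1 * L2_norm (M n) (\<lambda>x. f (n, x))"
          for n
        using Tb L2_fibre(1)[OF f] by (simp_all add: S_def)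
      then show "S f \<in> L2 ?D" "L2_norm ?D (S f) \<le> 1 * L2_norm ?D f"
        using L2_norm_fibrewise[OF f, of "S f" 1] by simp_all
    qed
    have SB: "S \<in> bounded_ops ?D"
      unfolding bounded_ops_def
    proof (intro CollectI conjI ballI allI)
      show "\<exists>B. \<forall>f\<in>L2 ?D. L2_norm ?D (S f) \<le> B * L2_norm ?D f" using SL(2) by blast
    qed (use SL(1) Tlin in \<open>auto simp: S_def\<close>)
    have Uad: "admissible ?G ?len ?D (U i)" if "i \<in> {1..N0}" for i
      unfolding U_def by (rule admissible_disj_groupoid[OF G len B(1)[OF that] B(2)[OF that]])
    have HN: "N_decomposable ?G ?len ?D (2 * N0 + 1) H"
      unfolding H_def by (rule N_decomposable_hull[OF gG gl gM Uad])
    have HL: "set_length ?len H \<le> ennreal L0"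
      unfolding H_def
    proof (rule set_length_hull[OF gl pos(3)])
      fix i assume i: "i \<in> {1..N0}"
      show "U i \<subseteq> arrows ?G" using Uad[OF i] by (auto simp: admissible_def bisection_def)
      show "?len a \<le> L0" if "a \<in> U i" for a using that B(2)[OF i] by (auto simp: U_def)
    qed
    have Hf: "Pair n -` H = unital_symmetric_hull (G n) {1..N0} (B n)" for n
    proof -
      have "Pair n -` ginv ?G ` U i = ginv (G n) ` B n i" for i
      proof (intro equalityI subsetI)
        fix a assume "a \<in> Pair n -` ginv ?G ` U i"
        then obtain b where "b \<in> U i" "(n, a) = ginv ?G b" by blast
        then show "a \<in> ginv (G n) ` B n i" by (cases b) (auto simp: U_def)
      next
        fix a assume "a \<in> ginv (G n) ` B n i"
        then obtain b where b: "b \<in> B n i" "a = ginv (G n) b" by blast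
        then have "(n, a) = ginv ?G (n, b)" "(n, b) \<in> U i" by (auto simp: U_def)
        then show "a \<in> Pair n -` ginv ?G ` U i" by blast
      qed
      moreover have "Pair n -` U i = B n i" for i by (auto simp: U_def)
      moreover have "Pair n -` unit_space ?G = unit_space (G n)" by auto
      ultimately show ?thesis unfolding H_def unital_symmetric_hull_def vimage_Un vimage_UN by (simp only:)
    qed
    have "finite_dyn_propagation ?G ?len ?D S"
      unfolding finite_dyn_propagation_def
    proof (intro conjI exI[of _ H] exI[of _ "2 * N0 + 1"] exI[of _ L0] SB HN HL ballI impI)
      fix A A' assume A: "A \<in> sets ?D" and A': "A' \<in> sets ?D" and z: "emeasure ?D (range_act ?G H A \<inter> A') = 0"
      let ?Z = "range_act ?G H A \<inter> A'"
      have Z: "?Z \<in> null_sets ?D"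
        using z range_act_decomposable_sets[OF gG gl HN A] A' by (auto simp: null_sets_def)
      have A'Z: "A' - ?Z \<in> sets ?D" using A' Z by auto
      show "op_is_zero ?D (cutoff A \<circ> S \<circ> cutoff A')"
        unfolding op_is_zero_def
      proof
        fix f assume f: "f \<in> L2 ?D"
        have "AE x in ?D. cutoff A' f x = cutoff (A' - ?Z) f x"
          using AE_not_in[OF Z] by eventually_elim (auto simp: cutoff_def indicator_def)
        then have ae: "AE x in ?D. S (cutoff A' f) x = S (cutoff (A' - ?Z) f) x"
          by (intro bounded_ops_cong_AE[OF SB] cutoff_in_L2 A' A'Z f)
        \<comment> \<open>The null set \<open>Z\<close> may be removed from \<open>A'\<close>; then
          \<open>S\<close> vanishes on \<open>A\<close> at every point.\<close>
        have zero: "cutoff A (S (cutoff (A' - ?Z) f)) p = 0" for p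
        proof (cases "p \<in> A")
          case True
          obtain n x where p: "p = (n, x)" by (cases p)
          have x: "x \<in> space (M n)" using True p sets.sets_into_space[OF A] by (auto simp: space_disj_measure)
          have "T n (\<lambda>y. cutoff (A' - ?Z) f (n, y)) x = 0"
          proof (rule Tloc[OF x])
            fix y assume y: "y \<in> range_act (G n) (unital_symmetric_hull (G n) {1..N0} (B n)) {x}"
            have "range_act (G n) (Pair n -` H) {x} \<subseteq> range_act (G n) (Pair n -` H) (Pair n -` A)"
              using True p by (intro range_act_mono) auto
            then have "y \<in> Pair n -` range_act ?G H A" using y unfolding range_act_fibre Hf by blast
            then show "cutoff (A' - ?Z) f (n, y) = 0" by (simp add: cutoff_def indicator_def)
          qed
          then show ?thesis by (simp add: cutoff_def S_def p)
        qed (simp add: cutoff_def)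
        show "AE x in ?D. (cutoff A \<circ> S \<circ> cutoff A') f x = 0"
          using ae
        proof eventually_elim
          case (elim p)
          then show ?case using zero[of p] by (simp add: cutoff_def)
        qed
      qed
    qed (use pos in auto)
    then have fdp: "finite_dyn_propagation ?G ?len ?D (S ^^ Suc k)" by (rule finite_dyn_propagation_power[OF
        gG gl gM])
    have Sk: "(\<lambda>x. (S ^^ j) f (n, x)) = (T n ^^ j) (\<lambda>y. f (n, y))" for j f n
      by (induction j) (auto simp: S_def)
    have SkL: "(S ^^ j) f \<in> L2 ?D" if "f \<in> L2 ?D" for j f using that by (induction j) (auto intro: SL)
    have "op_norm ?D (op_diff P (S ^^ Suc k)) \<le> \<delta>"
    proof (rule op_norm_least)
      fix f assume f: "f \<in> L2 ?D" "L2_norm ?D f \<le> 1"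
      note ff = L2_fibre(1)[OF f(1)]
      have PS: "op_diff P (S ^^ Suc k) f \<in> L2 ?D"
        unfolding op_diff_def by (intro L2_diff bounded_opsD(1)[OF PB f(1)] SkL f)
      have "L2_norm ?D (op_diff P (S ^^ Suc k) f) \<le> \<delta> * L2_norm ?D f"
      proof (rule L2_norm_fibrewise(2)[OF f(1) L2_fibre(1)[OF PS] \<delta>(1)])
        fix n
        let ?r = "\<lambda>x. (T n ^^ Suc k) (\<lambda>y. f (n, y)) x - L2_inner (M n) (\<lambda>y. f (n, y)) (\<xi> n) * \<xi> n x"
        have Tk: "(T n ^^ Suc k) (\<lambda>y. f (n, y)) \<in> L2 (M n)"
          using L2_fibre(1)[OF SkL[OF f(1)], of "Suc k" n] unfolding Sk .
        have r: "?r \<in> L2 (M n)" by (intro L2_diff Tk L2_cmult \<xi>)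
        have "L2_norm (M n) (\<lambda>x. op_diff P (S ^^ Suc k) f (n, x)) = L2_norm (M n) (\<lambda>x. - ?r x)"
        proof (rule L2_cong_AE(2)[OF L2_uminus[OF r]])
          show "(\<lambda>x. op_diff P (S ^^ Suc k) f (n, x)) \<in> borel_measurable (M n)"
            by (rule L2_measurable[OF L2_fibre(1)[OF PS]])
          have eq: "(S ^^ Suc k) f (n, x) = (T n ^^ Suc k) (\<lambda>y. f (n, y)) x" for x
            using Sk[of "Suc k" f n] by (rule fun_cong)
          show "AE x in M n. op_diff P (S ^^ Suc k) f (n, x) = - ?r x"
            using Pf[OF f(1), of n] by eventually_elim (simp only: op_diff_def eq minus_diff_eq)
        qed
        also have "\<dots> = L2_norm (M n) ?r" unfolding L2_norm_def by (simp only: norm_minus_cancel)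
        also have "\<dots> \<le> \<delta> * L2_norm (M n) (\<lambda>y. f (n, y))" by (rule Tap[OF ff])
        finally show "L2_norm (M n) (\<lambda>x. op_diff P (S ^^ Suc k) f (n, x)) \<le> \<delta> * L2_norm (M n) (\<lambda>y. f (n, y))" .
      qed
      also have "\<dots> \<le> \<delta> * 1" using f(2) \<delta>(1) by (intro mult_left_mono) auto
      finally show "L2_norm ?D (op_diff P (S ^^ Suc k) f) \<le> \<delta>" by simp
    qed
    then have "op_norm ?D (op_diff P (S ^^ Suc k)) < \<epsilon>" using \<delta>(2) \<epsilon> by linarith
    then show ?thesis using fdp by blast
  qed
  then show ?thesis using PB by (simp add: dyn_Roe_algebra_def)
qed

theorem theorem5p3:
  fixes G :: "nat \<Rightarrow> 'g groupoid_ops"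
    and len :: "nat \<Rightarrow> 'g \<Rightarrow> real"
    and M :: "nat \<Rightarrow> 'g measure"
    and Pn :: "nat \<Rightarrow> 'g operator"
    and P :: "(nat \<times> 'g) operator"
    and \<xi> :: "nat \<Rightarrow> 'g \<Rightarrow> complex"
  assumes "\<And>n. groupoid (G n)"
    and "\<And>n. length_function (G n) (len n)"
    and "\<And>n. space (M n) = unit_space (G n)"
    and "\<And>n. orthogonal_projection (M n) (Pn n)"
    and "\<And>n. rank_one (M n) (Pn n)"
    and "SOT_sums (disj_measure M) (\<lambda>n. extend_by_zero n (Pn n)) P"
    and "\<And>n. \<xi> n \<in> op_range (M n) (Pn n)"
    and "\<And>n. L2_norm (M n) (\<xi> n) = 1"
  shows "(P \<in> dyn_Roe_algebra (disj_groupoid G) (disj_length len) (disj_measure M) \<longleftrightarrow>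
          P \<in> dyn_quasi_local_algebra (disj_groupoid G) (disj_length len) (disj_measure M))
       \<and> (P \<in> dyn_quasi_local_algebra (disj_groupoid G) (disj_length len) (disj_measure M) \<longleftrightarrow>
          (\<exists>C N L. \<forall>n. asymptotically_expanding (G n) (len n)
             (associated_measure (M n) (\<xi> n)) C N L))"
proof -
  let ?roe = "P \<in> dyn_Roe_algebra (disj_groupoid G) (disj_length len) (disj_measure M)"
  let ?ql = "P \<in> dyn_quasi_local_algebra (disj_groupoid G) (disj_length len) (disj_measure M)"
  let ?ex = "\<exists>C N L. \<forall>n. asymptotically_expanding (G n) (len n) (associated_measure (M n) (\<xi> n)) C N L"
  have \<xi>: "\<xi> n \<in> L2 (M n)" for n using assms(7) by (simp add: op_range_def)
  have PB: "P \<in> bounded_ops (disj_measure M)" using assms(6) by (simp add: SOT_sums_def)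
  have Pn: "Pn n \<in> bounded_ops (M n)" for n using assms(4) by (simp add: orthogonal_projection_def)
  have Pf: "AE x in M n. P f (n, x) = L2_inner (M n) (\<lambda>y. f (n, y)) (\<xi> n) * \<xi> n x"
    if f: "f \<in> L2 (disj_measure M)" for f n
    using SOT_sums_fibre[OF assms(6) Pn f, of n]
      rank_one_projection_eq_inner[OF assms(4,5,7,8) L2_fibre(1)[OF f], of n]
    by eventually_elim simp
  have 1: "?roe \<Longrightarrow> ?ql" using dyn_Roe_subset_quasi_local by blast
  have 2: "?ex" if ql: ?ql
  proof -
    let ?Q = "\<lambda>\<alpha> N L. 0 < N \<and> 0 < L \<and>
      (\<forall>n. expanding_at (G n) (len n) (associated_measure (M n) (\<xi> n)) \<alpha> (1/2) N L)"
    have "\<forall>\<alpha>. \<exists>NL. \<alpha> \<in> {0<..1/2} \<longrightarrow> ?Q \<alpha> (fst NL) (snd NL)"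
    proof (intro allI)
      fix \<alpha> :: real
      show "\<exists>NL. \<alpha> \<in> {0<..1/2} \<longrightarrow> ?Q \<alpha> (fst NL) (snd NL)"
      proof (cases "\<alpha> \<in> {0<..1/2}")
        case True
        obtain N L where "?Q \<alpha> N L"
          using quasi_local_imp_expanding[OF assms(1-3) \<xi> assms(8) ql Pf True] by blast
        then have "?Q \<alpha> (fst (N, L)) (snd (N, L))" by simp
        then show ?thesis by blast
      qed blast
    qed
    from choice[OF this] obtain NL where NL: "\<And>\<alpha>. \<alpha> \<in> {0<..1/2} \<Longrightarrow> ?Q \<alpha> (fst (NL \<alpha>)) (snd (NL \<alpha>))" by blast
    have "asymptotically_expanding (G n) (len n) (associated_measure (M n) (\<xi> n))
        (\<lambda>_. 1/2) (\<lambda>\<alpha>. fst (NL \<alpha>)) (\<lambda>\<alpha>. snd (NL \<alpha>))" for n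
      unfolding asymptotically_expanding_iff using NL by simp
    then show ?thesis by blast
  qed
  have 3: "?roe" if ex: ?ex
  proof -
    from ex obtain C N L where e: "\<And>n. asymptotically_expanding (G n) (len n) (associated_measure (M n) (\<xi> n))
        C N L" by blast
    show ?thesis by (rule expanding_imp_Roe[OF assms(1-3) \<xi> assms(8) PB Pf e])
  qed
  show ?thesis using 1 2 3 by blast
qed

end
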